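(* Let $G$ be an infinite locally finite graph. The following three statements are equivalent: (1) $G$ has a Hamiltonian circle. (2) $G$ has a spanning subgraph $F$ that is faithful to $G$, such that $F$ has a Hamiltonian curve and every end $\alpha$ of $F$ has degree $d(\alpha)=2$ (degree taken in $F$). (3) $G$ has a spanning subgraph $F$ that is faithful to $G$, such that $F$ has a Hamiltonian curve and every end $\alpha$ of $F$ has degree $d(\alpha)\le 3$ (degree taken in $F$).
   Context: A graph is locally finite if every vertex has finite degree. A ray is a one-way infinite path; its subrays are its tails. Two rays $R_1,R_2$ of a graph $H$ are equivalent in $H$ if for every finite $S\subseteq V(H)$ some component of $H-S$ contains tails of both; the equivalence classes are the ends of $H$. For finite $S$ and an end $\alpha$, $C(S,\alpha)$ is the component of $H-S$ containing tails of the rays of $\alpha$. The Freudenthal compactification $|H|$ is the 1-complex of $H$ (each edge a copy of $[0,1]$) together with its ends, where a basic open neighbourhood of an end $\alpha$ is, for finite $S$, the union of $C(S,\alpha)$, all ends whose rays have tails in $C(S,\alpha)$, and the inner points of edges between $S$ and $C(S,\alpha)$. A circle of $H$ is the image of a homeomorphic embedding of the unit circle $S^1$ into $|H|$; it is Hamiltonian if it contains every vertex of $H$. A Hamiltonian curve of $H$ is the image of a continuous map $\sigma:S^1\to|H|$ whose image contains every vertex of $H$ and such that every vertex has exactly one preimage (ends may be visited more than once). A subgraph $F$ of $G$ is faithful to $G$ if (i) every end of $G$ contains a ray of $F$, and (ii) any two rays of $F$ are equivalent in $F$ if and only if they are equivalent in $G$. The degree $d(\alpha)$ of an end $\alpha$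 is the maximum number of pairwise vertex-disjoint rays in $\alpha$. *)

theory Defs
  imports "HOL-Analysis.Analysis" "HOL-Library.Extended_Nat"
begin

definition graph :: "'v set \<Rightarrow> 'v set set \<Rightarrow> bool" where
  "graph V E \<longleftrightarrow> (\<forall>e\<in>E. \<exists>u v. u \<noteq> v \<and> u \<in> V \<and> v \<in> V \<and> e = {u, v})"

definition locally_finite :: "'v set \<Rightarrow> 'v set set \<Rightarrow> bool" where
  "locally_finite V E \<longleftrightarrow> (\<forall>v\<in>V. finite {e\<in>E. v \<in> e})"

definition spanning_subgraph :: "'v set \<Rightarrow> 'v set set \<Rightarrow> 'v set \<Rightarrow> 'v set set \<Rightarrow> bool" where
  "spanning_subgraph VF EF V E \<longleftrightarrow> VF = V \<and> EF \<subseteq> E"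

definition is_ray :: "'v set \<Rightarrow> 'v set set \<Rightarrow> (nat \<Rightarrow> 'v) \<Rightarrow> bool" where
  "is_ray V E R \<longleftrightarrow> inj R \<and> (\<forall>n. R n \<in> V) \<and> (\<forall>n. {R n, R (Suc n)} \<in> E)"

definition comp_of :: "'v set \<Rightarrow> 'v set set \<Rightarrow> 'v set \<Rightarrow> 'v \<Rightarrow> 'v set" where
  "comp_of V E S u = {w. (\<lambda>a b. a \<in> V - S \<and> b \<in> V - S \<and> {a, b} \<in> E)\<^sup>*\<^sup>* u w}"

definition components :: "'v set \<Rightarrow> 'v set set \<Rightarrow> 'v set \<Rightarrow> 'v set set" where
  "components V E S = {comp_of V E S u | u. u \<in> V - S}"

definition has_tail_in :: "(nat \<Rightarrow> 'v) \<Rightarrow> 'v set \<Rightarrow> bool" where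
  "has_tail_in R C \<longleftrightarrow> (\<exists>k. \<forall>n\<ge>k. R n \<in> C)"

definition ray_equiv :: "'v set \<Rightarrow> 'v set set \<Rightarrow> (nat \<Rightarrow> 'v) \<Rightarrow> (nat \<Rightarrow> 'v) \<Rightarrow> bool" where
  "ray_equiv V E R1 R2 \<longleftrightarrow>
     (\<forall>S. finite S \<and> S \<subseteq> V \<longrightarrow> (\<exists>C\<in>components V E S. has_tail_in R1 C \<and> has_tail_in R2 C))"

definition ends :: "'v set \<Rightarrow> 'v set set \<Rightarrow> (nat \<Rightarrow> 'v) set set" where
  "ends V E = {{R'. is_ray V E R' \<and> ray_equiv V E R R'} | R. is_ray V E R}"

definition end_comp :: "'v set \<Rightarrow> 'v set set \<Rightarrow> 'v set \<Rightarrow> (nat \<Rightarrow> 'v) set \<Rightarrow> 'v set" where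
  "end_comp V E S \<alpha> = \<Union>{C \<in> components V E S. \<exists>R\<in>\<alpha>. has_tail_in R C}"

definition end_degree :: "'v set \<Rightarrow> 'v set set \<Rightarrow> (nat \<Rightarrow> 'v) set \<Rightarrow> enat" where
  "end_degree V E \<alpha> = Sup {enat (card Rs) | Rs. finite Rs \<and> Rs \<subseteq> \<alpha> \<and>
        pairwise (\<lambda>R1 R2. range R1 \<inter> range R2 = {}) Rs}"

definition faithful :: "'v set \<Rightarrow> 'v set set \<Rightarrow> 'v set \<Rightarrow> 'v set set \<Rightarrow> bool" where
  "faithful VF EF V E \<longleftrightarrow>
     (\<forall>\<alpha>\<in>ends V E. \<exists>R\<in>\<alpha>. is_ray VF EF R) \<and>
     (\<forall>R1 R2. is_ray VF EF R1 \<and> is_ray VF EF R2 \<longrightarrow>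
        (ray_equiv VF EF R1 R2 \<longleftrightarrow> ray_equiv V E R1 R2))"

text \<open>Points of the 1-complex are represented by barycentric coordinates:
  a vertex v is the indicator of v, the point of the edge uv at parameter t
  (measured from u) is the function with value 1-t at u and t at v.  This
  identifies the point (u,v,t) with (v,u,1-t) automatically.\<close>

datatype 'v fpoint = Pt "'v \<Rightarrow> real" | EndPt "(nat \<Rightarrow> 'v) set"

definition vtx :: "'v \<Rightarrow> 'v \<Rightarrow> real" where
  "vtx v = (\<lambda>w. if w = v then 1 else 0)"

definition seg :: "'v \<Rightarrow> 'v \<Rightarrow> real \<Rightarrow> 'v \<Rightarrow> real" where
  "seg u v t = (\<lambda>w. if w = u then 1 - t else if w = v then t else 0)"

definition edge_open_sets :: "'v set set \<Rightarrow> 'v fpoint set set" where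
  "edge_open_sets E = {{Pt (seg u v t) | t. a < t \<and> t < b} | u v a b.
       {u, v} \<in> E \<and> 0 \<le> a \<and> a < b \<and> b \<le> 1}"

definition vertex_open_sets :: "'v set \<Rightarrow> 'v set set \<Rightarrow> 'v fpoint set set" where
  "vertex_open_sets V E = {insert (Pt (vtx v)) {Pt (seg v w t) | w t. {v, w} \<in> E \<and> 0 < t \<and> t < \<epsilon>}
       | v \<epsilon>. v \<in> V \<and> 0 < \<epsilon> \<and> \<epsilon> \<le> 1}"

definition end_nbhd :: "'v set \<Rightarrow> 'v set set \<Rightarrow> 'v set \<Rightarrow> (nat \<Rightarrow> 'v) set \<Rightarrow> 'v fpoint set" where
  "end_nbhd V E S \<alpha> =
     (let C = end_comp V E S \<alpha> in
        {Pt (vtx v) | v. v \<in> C}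
      \<union> {Pt (seg u v t) | u v t. {u, v} \<in> E \<and> u \<in> C \<and> 0 < t \<and> t < 1}
      \<union> {EndPt \<beta> | \<beta>. \<beta> \<in> ends V E \<and> (\<exists>R\<in>\<beta>. has_tail_in R C)})"

definition end_open_sets :: "'v set \<Rightarrow> 'v set set \<Rightarrow> 'v fpoint set set" where
  "end_open_sets V E = {end_nbhd V E S \<alpha> | S \<alpha>. finite S \<and> S \<subseteq> V \<and> \<alpha> \<in> ends V E}"

definition freudenthal :: "'v set \<Rightarrow> 'v set set \<Rightarrow> 'v fpoint topology" where
  "freudenthal V E =
     topology_generated_by (edge_open_sets E \<union> vertex_open_sets V E \<union> end_open_sets V E)"

abbreviation circle_top :: "complex topology" where
  "circle_top \<equiv> top_of_set (sphere 0 1)"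

definition has_hamiltonian_circle :: "'v set \<Rightarrow> 'v set set \<Rightarrow> bool" where
  "has_hamiltonian_circle V E \<longleftrightarrow>
     (\<exists>\<sigma>. embedding_map circle_top (freudenthal V E) \<sigma> \<and>
          (\<forall>v\<in>V. Pt (vtx v) \<in> \<sigma> ` sphere 0 1))"

definition has_hamiltonian_curve :: "'v set \<Rightarrow> 'v set set \<Rightarrow> bool" where
  "has_hamiltonian_curve V E \<longleftrightarrow>
     (\<exists>\<sigma>. continuous_map circle_top (freudenthal V E) \<sigma> \<and>
          (\<forall>v\<in>V. \<exists>!z. z \<in> sphere 0 1 \<and> \<sigma> z = Pt (vtx v)))"

end

(*
From a Hamiltonian circle to a sparse subgraph. Cut the circle at a vertex and parametrise it by [0,1].
Since the circle visits every end once, each interval of it induces a connected subgraph of G. Refine a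
finite set of vertices of the circle in stages: for each gap between two consecutive chosen vertices p, q
add to F a path of G from p to q inside the gap, and choose all vertices of these paths (and one more
vertex of an enumeration) for the next stage. Then {p, q} separates the inside of the gap from the
outside in F, which bounds the degrees of the ends by 2, and F is connected on every interval between
two vertices. So rays of F converge to points of the circle, and are equivalent in F, and in G, iff they
converge to the same point.

From a Hamiltonian curve of F with end degrees at most 3 to a Hamiltonian circle. By Menger's theorem an
end of degree less than 4 can be separated from any finite vertex set S by fewer than four vertices
outside S. A curve that visits the end, then a vertex, then the end again would have to pass this separator
four times, in distinct vertices. Hence, up to constant stretches, the curve visits each end only once, and
collapsing its fibres gives an injective curve. The natural map from |F| to |G| is continuous and
injective on ends because F is faithful, and |G| is Hausdorff, so that curve is an embedding into |G|.
*)
theory Submission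
  imports Defs
begin

subsection \<open>Connectivity, rays and ends\<close>

text \<open>The edges of the circle alone do not form a suitable subgraph: they fall apart into
  double rays, so the two sides of an end become inequivalent, and an end that is a limit of other
  ends need not contain any ray of circle edges. The paths across the gaps repair both. As each path
  stays in its gap and its vertices become boundary vertices, no edge of F leads from the inside of
  a gap to its outside. In the other direction, end degrees count rays, while the argument needs a
  finite separator. A sequence of nested minimal separators shrinking to the end mediates: Menger's
  theorem joins consecutive ones by disjoint paths, whose concatenations are as many disjoint rays
  as the first separator has elements. The constant 3 comes from the vertex \<open>v0\<close> at
  which the loop is cut: the order v0, end, vertex, end, v0 gives four time intervals, each of which
  contains a vertex of the separator. A continuous curve may rest at an end or run back and forth
  inside an edge, so an injective curve needs a new parametrisation of the circle.\<close>

definition conn :: "'v set set \<Rightarrow> 'v set \<Rightarrow> 'v \<Rightarrow> 'v \<Rightarrow> bool" where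
  "conn E W x y \<longleftrightarrow> (\<lambda>a b. a \<in> W \<and> b \<in> W \<and> {a, b} \<in> E)\<^sup>*\<^sup>* x y"

lemma comp_of_conn: "comp_of V E S u = {w. conn E (V - S) u w}"
  by (simp add: comp_of_def conn_def)

text \<open>Being a reflexive closure, \<open>conn E W x x\<close> also holds for \<open>x\<close>
  outside \<open>W\<close>; this is why several lemmas ask for \<open>x \<in> W\<close> besides a
  connection.\<close>

lemma conn_refl [simp]: "conn E W x x"
  by (simp add: conn_def)

lemma conn_trans: "conn E W x y \<Longrightarrow> conn E W y z \<Longrightarrow> conn E W x z"
  unfolding conn_def by (rule rtranclp_trans)

lemma conn_edge: "x \<in> W \<Longrightarrow> y \<in> W \<Longrightarrow> {x, y} \<in> E \<Longrightarrow> conn E W x y"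
  unfolding conn_def by (rule r_into_rtranclp) simp

lemma conn_sym: "conn E W x y \<Longrightarrow> conn E W y x"
  unfolding conn_def
  by (induction rule: rtranclp_induct) (auto simp: insert_commute intro: converse_rtranclp_into_rtranclp)

lemma conn_mono:
  assumes "conn E W x y" "W \<subseteq> W'" "E \<subseteq> E'"
  shows "conn E' W' x y"
  using assms(1) unfolding conn_def
  by (rule rtranclp_mono[THEN predicate2D, rotated]) (use assms in auto)

lemma conn_mem: "conn E W x y \<Longrightarrow> x \<in> W \<Longrightarrow> y \<in> W"
  unfolding conn_def by (induction rule: rtranclp_induct) auto

lemma conn_induct [consumes 1, case_names refl step]:
  assumes "conn E W x y" "P x"
    and "\<And>y z. conn E W x y \<Longrightarrow> y \<in> W \<Longrightarrow> z \<in> W \<Longrightarrow> {y, z} \<in> E \<Longrightarrow> P y \<Longrightarrow> P z"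
  shows "P y"
  using assms(1) unfolding conn_def
  by (induction rule: rtranclp_induct) (auto intro: assms(2,3) simp: conn_def)

text \<open>Paths are handled as finite connected vertex sets instead of lists. Since
  \<open>U\<close> is connected within itself, it can be reused inside any larger vertex
  set.\<close>

lemma conn_finite_support:
  assumes "conn E W x y" "x \<in> W"
  obtains U where "finite U" "U \<subseteq> W" "x \<in> U" "y \<in> U" "\<And>u v. u \<in> U \<Longrightarrow> v \<in> U \<Longrightarrow> conn E U u v"
proof -
  have "\<exists>U. finite U \<and> U \<subseteq> W \<and> x \<in> U \<and> y \<in> U \<and> (\<forall>u\<in>U. conn E U x u)"
    using assms(1)
  proof (induction rule: conn_induct)
    case refl
    show ?case using assms(2) by (intro exI[of _ "{x}"]) auto
  next
    case (step y z)
    then obtain U where U: "finite U" "U \<subseteq> W" "x \<in> U" "y \<in> U" "\<forall>u\<in>U. conn E U x u"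
      by blast
    have 1: "conn E (insert z U) x u" if "u \<in> U" for u
      using U that by (blast intro: conn_mono)
    have "conn E (insert z U) x z"
      using 1[OF U(4)] conn_edge[of y "insert z U" z E] U step by (blast intro: conn_trans)
    with 1 U step show ?case by (intro exI[of _ "insert z U"]) auto
  qed
  then obtain U where U: "finite U" "U \<subseteq> W" "x \<in> U" "y \<in> U" "\<forall>u\<in>U. conn E U x u"
    by blast
  show thesis by (rule that[OF U(1-4)]) (use U(5) in \<open>blast intro: conn_trans conn_sym\<close>)
qed

lemma conn_comp:
  assumes "conn E (W - X) u x" "conn E (W - X) u y"
  shows "conn E {w. conn E (W - X) u w} x y"
proof -
  have "conn E {w. conn E (W - X) u w} u z" if "conn E (W - X) u z" for z
    using that
  proof (induction rule: conn_induct)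
    case (step y z)
    then have "conn E (W - X) u z" by (blast intro: conn_trans conn_edge)
    with step show ?case by (blast intro: conn_trans conn_edge)
  qed simp
  with assms show ?thesis by (blast intro: conn_trans conn_sym)
qed

locale lfgraph =
  fixes V :: "'v set" and E :: "'v set set"
  assumes gr: "graph V E" and lf: "locally_finite V E"
begin

lemma subgraph_lfgraph: assumes "EF \<subseteq> E" shows "lfgraph V EF"
proof
  show "graph V EF" using gr assms unfolding graph_def by blast
  show "locally_finite V EF"
    unfolding locally_finite_def
  proof
    fix v assume "v \<in> V"
    then have "finite {e \<in> E. v \<in> e}" using lf by (simp add: locally_finite_def)
    then show "finite {e \<in> EF. v \<in> e}" by (rule rev_finite_subset) (use assms in auto)
  qed
qed

lemma edgeD: "{x, y} \<in> E \<Longrightarrow> x \<in> V \<and> y \<in> V \<and> x \<noteq> y"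
  using gr unfolding graph_def by (metis doubleton_eq_iff)

lemma finite_nbrs: "finite {y. {x, y} \<in> E}"
proof (cases "x \<in> V")
  case True
  then have "finite {e \<in> E. x \<in> e}" using lf by (simp add: locally_finite_def)
  then have "finite ((\<lambda>y. {x, y}) -` {e \<in> E. x \<in> e})"
    by (rule finite_vimageI) (auto simp: inj_def doubleton_eq_iff)
  then show ?thesis by (rule rev_finite_subset) auto
qed (use edgeD in \<open>auto intro: finite_subset[of _ "{}"]\<close>)

text \<open>The closed neighbourhood. It is finite by local finiteness, and a component that misses
  it has no edge to \<open>S\<close>.\<close>

definition nbhd :: "'v set \<Rightarrow> 'v set" where
  "nbhd S = S \<union> (\<Union>x\<in>S. {y. {x, y} \<in> E})"

lemma nbhd_finite: "finite S \<Longrightarrow> finite (nbhd S)"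
  by (simp add: nbhd_def finite_nbrs)

lemma nbhd_sub: "S \<subseteq> V \<Longrightarrow> nbhd S \<subseteq> V"
  using edgeD by (auto simp: nbhd_def)

lemma comp_of_self: "u \<in> comp_of V E S u"
  by (simp add: comp_of_conn)

lemma comp_of_sub: "u \<in> V - S \<Longrightarrow> comp_of V E S u \<subseteq> V - S"
  by (auto simp: comp_of_conn dest: conn_mem)

lemma comp_of_eq: "w \<in> comp_of V E S u \<Longrightarrow> comp_of V E S w = comp_of V E S u"
  by (auto simp: comp_of_conn intro: conn_trans conn_sym)

lemma components_eq:
  assumes "C \<in> components V E S" "D \<in> components V E S" "x \<in> C" "x \<in> D"
  shows "C = D"
proof -
  obtain u v where "C = comp_of V E S u" "D = comp_of V E S v" using assms by (auto simp: components_def)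
  with assms show ?thesis using comp_of_eq by metis
qed

lemma components_sub: "C \<in> components V E S \<Longrightarrow> C \<subseteq> V - S"
  unfolding components_def using comp_of_sub by auto

lemma components_step:
  assumes "C \<in> components V E S" "x \<in> C" "{x, y} \<in> E" "y \<notin> S"
  shows "y \<in> C"
proof -
  obtain u where u: "u \<in> V - S" "C = comp_of V E S u" using assms by (auto simp: components_def)
  have "conn E (V - S) x y"
    using assms edgeD components_sub[OF assms(1)] by (intro conn_edge) auto
  with assms u show ?thesis by (auto simp: comp_of_conn intro: conn_trans)
qed

lemma components_conn:
  assumes "C \<in> components V E S" "x \<in> C" "y \<in> C"
  shows "conn E C x y"
  using assms unfolding components_def comp_of_conn by (auto intro: conn_comp)

lemma components_closed:
  assumes "C \<in> components V E S" "x \<in> C" "conn E W x y" "W \<inter> S = {}"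
  shows "y \<in> C"
  using assms(3,2) by (induction rule: conn_induct) (use assms components_step in blast)+

lemma tail_common:
  assumes "has_tail_in R C" "has_tail_in R D"
  shows "\<exists>n. R n \<in> C \<and> R n \<in> D"
  using assms unfolding has_tail_in_def by (metis nat_le_linear)

lemma tail_mono: "has_tail_in R C \<Longrightarrow> C \<subseteq> D \<Longrightarrow> has_tail_in R D"
  unfolding has_tail_in_def by blast

lemma ray_tail_avoids_finite:
  fixes R :: "nat \<Rightarrow> 'v"
  assumes "inj R" "finite S"
  shows "\<exists>k. \<forall>n\<ge>k. R n \<notin> S"
proof -
  have "finite (R -` S)" using assms by (rule finite_vimageI[rotated])
  then obtain k where "R -` S \<subseteq> {..<k}" using finite_nat_iff_bounded by metis
  then show ?thesis by (intro exI[of _ k]) fastforce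
qed

lemma ray_conn:
  assumes R: "is_ray V E R" and W: "\<And>n. n \<ge> k \<Longrightarrow> R n \<in> W" and "n \<ge> k"
  shows "conn E W (R k) (R n)"
  using \<open>n \<ge> k\<close>
proof (induction rule: dec_induct)
  case (step n)
  then show ?case
    using W R conn_edge[of "R n" W "R (Suc n)" E] unfolding is_ray_def by (blast intro: conn_trans le_SucI)
qed simp

lemma ray_tail_component:
  assumes R: "is_ray V E R" and "finite S"
  shows "\<exists>C\<in>components V E S. has_tail_in R C"
proof -
  obtain k where k: "\<forall>n\<ge>k. R n \<notin> S"
    using ray_tail_avoids_finite assms by (metis is_ray_def)
  then have W: "\<And>n. n \<ge> k \<Longrightarrow> R n \<in> V - S" using R by (auto simp: is_ray_def)
  have "comp_of V E S (R k) \<in> components V E S" using W by (auto simp: components_def)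
  moreover have "has_tail_in R (comp_of V E S (R k))"
    unfolding has_tail_in_def comp_of_conn using ray_conn[OF R W] by blast
  ultimately show ?thesis by blast
qed

lemma ray_equiv_refl: "is_ray V E R \<Longrightarrow> ray_equiv V E R R"
  unfolding ray_equiv_def using ray_tail_component by blast

lemma ray_equiv_sym: "ray_equiv V E R R' \<Longrightarrow> ray_equiv V E R' R"
  unfolding ray_equiv_def by blast

lemma ray_equiv_trans:
  assumes "ray_equiv V E R R'" "ray_equiv V E R' R''" shows "ray_equiv V E R R''"
  unfolding ray_equiv_def
proof (intro allI impI)
  fix S assume S: "finite S \<and> S \<subseteq> V"
  obtain C D where C: "C \<in> components V E S" "has_tail_in R C" "has_tail_in R' C"
    and D: "D \<in> components V E S" "has_tail_in R' D" "has_tail_in R'' D"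
    using assms S unfolding ray_equiv_def by meson
  then have "C = D" using tail_common components_eq by metis
  then show "\<exists>C\<in>components V E S. has_tail_in R C \<and> has_tail_in R'' C" using C D by blast
qed

section \<open>Ends as classes of rays, and the component in which an end lives\<close>

definition end_of :: "(nat \<Rightarrow> 'v) \<Rightarrow> (nat \<Rightarrow> 'v) set" where
  "end_of R = {R'. is_ray V E R' \<and> ray_equiv V E R R'}"

lemma end_of_end: "is_ray V E R \<Longrightarrow> end_of R \<in> ends V E"
  by (auto simp: ends_def end_of_def)

lemma end_of_self: "is_ray V E R \<Longrightarrow> R \<in> end_of R"
  by (simp add: end_of_def ray_equiv_refl)

lemma end_nonempty: "\<alpha> \<in> ends V E \<Longrightarrow> \<exists>R. R \<in> \<alpha>"
  by (auto simp: ends_def intro: ray_equiv_refl)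

lemma end_ray: "\<alpha> \<in> ends V E \<Longrightarrow> R \<in> \<alpha> \<Longrightarrow> is_ray V E R"
  by (auto simp: ends_def)

lemma end_eq: "\<alpha> \<in> ends V E \<Longrightarrow> R \<in> \<alpha> \<Longrightarrow> \<alpha> = end_of R"
  unfolding ends_def end_of_def using ray_equiv_sym ray_equiv_trans by blast

lemma end_of_eq_iff: "is_ray V E R \<Longrightarrow> is_ray V E R' \<Longrightarrow> end_of R = end_of R' \<longleftrightarrow> ray_equiv V E R R'"
  unfolding end_of_def using ray_equiv_sym ray_equiv_trans ray_equiv_refl by blast

text \<open>\<open>end_comp\<close> is a union over all rays of the end. Equivalent rays have tails
  in a common component and distinct components are disjoint, so the union has a single
  member.\<close>

lemma end_comp_component_eq:
  assumes "\<alpha> \<in> ends V E" "finite S" "S \<subseteq> V" "R \<in> \<alpha>" "C \<in> components V E S" "has_tail_in R C"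
  shows "end_comp V E S \<alpha> = C"
proof -
  have "D = C" if D: "D \<in> components V E S" "R' \<in> \<alpha>" "has_tail_in R' D" for D R'
  proof -
    have "ray_equiv V E R R'" using end_eq[OF assms(1,4)] D by (auto simp: end_of_def)
    then obtain B where "B \<in> components V E S" "has_tail_in R B" "has_tail_in R' B"
      using assms by (auto simp: ray_equiv_def)
    then show ?thesis using D assms tail_common components_eq by metis
  qed
  then have "{C \<in> components V E S. \<exists>R\<in>\<alpha>. has_tail_in R C} = {C}" using assms by blast
  then show ?thesis by (simp add: end_comp_def)
qed

lemma end_comp:
  assumes "\<alpha> \<in> ends V E" "finite S" "S \<subseteq> V"
  shows end_comp_component: "end_comp V E S \<alpha> \<in> components V E S"
    and end_comp_tail: "R \<in> \<alpha> \<Longrightarrow> has_tail_in R (end_comp V E S \<alpha>)"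
proof -
  have *: "end_comp V E S \<alpha> \<in> components V E S \<and> has_tail_in R (end_comp V E S \<alpha>)" if R: "R \<in> \<alpha>" for R
    using end_comp_component_eq[OF assms R] ray_tail_component[OF end_ray[OF assms(1) R] assms(2)] by metis
  then show "end_comp V E S \<alpha> \<in> components V E S" using end_nonempty[OF assms(1)] by blast
  show "R \<in> \<alpha> \<Longrightarrow> has_tail_in R (end_comp V E S \<alpha>)" using * by blast
qed

lemma end_comp_sub: "\<alpha> \<in> ends V E \<Longrightarrow> finite S \<Longrightarrow> S \<subseteq> V \<Longrightarrow> end_comp V E S \<alpha> \<subseteq> V - S"
  using end_comp_component components_sub by blast

lemma mem_endI:
  assumes "\<alpha> \<in> ends V E" "is_ray V E R"
    and "\<And>S. finite S \<Longrightarrow> S \<subseteq> V \<Longrightarrow> has_tail_in R (end_comp V E S \<alpha>)"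
  shows "R \<in> \<alpha>"
proof -
  obtain R0 where R0: "R0 \<in> \<alpha>" using end_nonempty assms by blast
  have "ray_equiv V E R0 R"
    unfolding ray_equiv_def using assms(3) end_comp[OF assms(1)] R0 by blast
  then show ?thesis using end_eq[OF assms(1) R0] assms(2) by (simp add: end_of_def)
qed

lemma end_comp_eq:
  assumes "\<alpha> \<in> ends V E" "\<beta> \<in> ends V E" "finite S" "S \<subseteq> V" "R \<in> \<beta>" "has_tail_in R (end_comp V E S \<alpha>)"
  shows "end_comp V E S \<beta> = end_comp V E S \<alpha>"
  using end_comp_component_eq[OF assms(2-5) end_comp_component[OF assms(1,3,4)] assms(6)] .

lemma ends_separate:
  assumes "\<alpha> \<in> ends V E" "\<beta> \<in> ends V E" "\<alpha> \<noteq> \<beta>"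
  obtains S where "finite S" "S \<subseteq> V" "end_comp V E S \<alpha> \<inter> end_comp V E S \<beta> = {}"
proof -
  obtain R where R: "R \<in> \<beta>" using end_nonempty assms by blast
  have "R \<notin> \<alpha>" using end_eq assms R by metis
  then obtain S where S: "finite S" "S \<subseteq> V" "\<not> has_tail_in R (end_comp V E S \<alpha>)"
    using mem_endI[OF assms(1) end_ray[OF assms(2) R]] by blast
  have "end_comp V E S \<alpha> \<noteq> end_comp V E S \<beta>"
    using S R end_comp_tail[OF assms(2) S(1,2) R] by auto
  then have "end_comp V E S \<alpha> \<inter> end_comp V E S \<beta> = {}"
    using components_eq[OF end_comp_component[OF assms(1) S(1,2)] end_comp_component[OF assms(2) S(1,2)]]
    by blast
  with S that show ?thesis by blast
qed

text \<open>No inclusion between \<open>S\<close> and \<open>T\<close> is assumed: the component at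
  \<open>T\<close> is connected, misses \<open>S\<close> and shares vertices of a ray with the
  component at \<open>S\<close>, so it stays inside the latter.\<close>

lemma end_comp_nest:
  assumes \<alpha>: "\<alpha> \<in> ends V E" and S: "finite S" "S \<subseteq> V" and T: "finite T" "T \<subseteq> V"
    and dj: "end_comp V E T \<alpha> \<inter> S = {}"
  shows "end_comp V E T \<alpha> \<subseteq> end_comp V E S \<alpha>"
proof
  fix x assume x: "x \<in> end_comp V E T \<alpha>"
  obtain R where R: "R \<in> \<alpha>" using end_nonempty \<alpha> by blast
  obtain n where n: "R n \<in> end_comp V E T \<alpha>" "R n \<in> end_comp V E S \<alpha>"
    using tail_common end_comp_tail \<alpha> S T R by metis
  show "x \<in> end_comp V E S \<alpha>"
    using components_closed[OF end_comp_component[OF \<alpha> S] n(2) components_conn[OF end_comp_component[OF \<alpha> T] n(1) x] dj] .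
qed

lemma end_comp_antimono:
  assumes "\<alpha> \<in> ends V E" "finite T" "T \<subseteq> V" "S \<subseteq> T"
  shows "end_comp V E T \<alpha> \<subseteq> end_comp V E S \<alpha>"
  using assms end_comp_sub[OF assms(1-3)]
  by (intro end_comp_nest) (auto intro: finite_subset)

text \<open>Koenig's lemma. The walk keeps the set \<open>X\<close> of vertices used so far and a
  current vertex \<open>x\<close> from which infinitely many vertices can be reached in
  \<open>W - X\<close>. After the removal of \<open>x\<close> these are shared among its finitely
  many neighbours, so one neighbour again reaches infinitely many.\<close>

lemma ray_exists:
  assumes W: "W \<subseteq> V" "infinite W" and conn: "\<And>x y. x \<in> W \<Longrightarrow> y \<in> W \<Longrightarrow> conn E W x y"
  obtains R where "is_ray V E R" "range R \<subseteq> W"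
proof -
  let ?C = "\<lambda>X x. {w. conn E (W - X) x w}"
  define P where "P = (\<lambda>(X, x). x \<in> W - X \<and> infinite (?C X x))"
  obtain w where w: "w \<in> W" using W by (metis finite.emptyI ex_in_conv)
  have "W \<subseteq> ?C {} w" using conn w by auto
  then have start: "P ({}, w)" using w W by (auto simp: P_def dest: finite_subset)
  have step: "\<exists>s'. P s' \<and> fst s' = insert (snd s) (fst s) \<and> {snd s, snd s'} \<in> E" if "P s" for s
  proof -
    obtain X x where s: "s = (X, x)" by force
    with that have x: "x \<in> W - X" "infinite (?C X x)" by (auto simp: P_def)
    let ?N = "{y. {x, y} \<in> E} \<inter> (W - insert x X)"
    \<comment> \<open>The induction remembers the neighbour at which the walk last left
      \<open>x\<close>.\<close>
    have "z = x \<or> (\<exists>y\<in>?N. conn E (W - insert x X) y z)" if "conn E (W - X) x z" for z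
      using that
    proof (induction rule: conn_induct)
      case (step y z)
      show ?case
      proof (cases "z = x")
        case False
        show ?thesis
        proof (cases "y = x")
          case True
          with step False have "z \<in> ?N" by auto
          then show ?thesis by (intro disjI2 bexI[of _ z]) auto
        next
          case yx: False
          then obtain u where u: "u \<in> ?N" "conn E (W - insert x X) u y" using step by blast
          have "conn E (W - insert x X) y z" using step yx False by (intro conn_edge) auto
          then show ?thesis using u conn_trans by metis
        qed
      qed simp
    qed simp
    then have "?C X x \<subseteq> insert x (\<Union>y\<in>?N. ?C (insert x X) y)" by blast
    with x have "infinite (\<Union>y\<in>?N. ?C (insert x X) y)"
      by (metis finite.insertI finite_subset)
    then obtain y where y: "y \<in> ?N" "infinite (?C (insert x X) y)"
      using finite_nbrs[of x] by blast
    then show ?thesis by (intro exI[of _ "(insert x X, y)"]) (auto simp: P_def s)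
  qed
  obtain f where f: "\<And>n. P (f n)" "\<And>n. fst (f (Suc n)) = insert (snd (f n)) (fst (f n))"
      "\<And>n. {snd (f n), snd (f (Suc n))} \<in> E"
    using dependent_nat_choice[of "\<lambda>_. P" "\<lambda>_ s s'. fst s' = insert (snd s) (fst s) \<and> {snd s, snd s'} \<in> E"]
      start step by metis
  define R where "R = (\<lambda>n. snd (f n))"
  have mem: "R n \<in> W - fst (f n)" for n using f(1)[of n] by (auto simp: P_def R_def split: prod.splits)
  have "R m \<in> fst (f n)" if "m < n" for m n
    using that by (induction n) (auto simp: f(2) R_def less_Suc_eq)
  then have "R m \<noteq> R n" if "m < n" for m n using mem that by (metis DiffD2)
  then have "inj R" by (metis injI nat_neq_iff)
  then have "is_ray V E R" using mem W f(3) by (auto simp: is_ray_def R_def)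
  with mem that show thesis by blast
qed

end

lemma end_degree_ge:
  assumes "finite Rs" "Rs \<subseteq> \<alpha>" "pairwise (\<lambda>R1 R2. range R1 \<inter> range R2 = {}) Rs"
  shows "enat (card Rs) \<le> end_degree V E \<alpha>"
  unfolding end_degree_def by (rule Sup_upper) (use assms in blast)

subsection \<open>Menger's theorem\<close>

text \<open>Menger's theorem is proved for directed graphs: a removed arc \<open>(x, y)\<close> then
  has its tail on the side of \<open>A\<close> and its head on the side of \<open>B\<close>.\<close>

definition linked :: "('v \<times> 'v) set \<Rightarrow> 'v set \<Rightarrow> 'v \<Rightarrow> 'v \<Rightarrow> bool" where
  "linked r W x y \<longleftrightarrow> (\<lambda>a b. a \<in> W \<and> b \<in> W \<and> (a, b) \<in> r)\<^sup>*\<^sup>* x y"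

lemma linked_refl [simp]: "linked r W x x"
  by (simp add: linked_def)

lemma linked_trans: "linked r W x y \<Longrightarrow> linked r W y z \<Longrightarrow> linked r W x z"
  unfolding linked_def by (rule rtranclp_trans)

lemma linked_edge: "x \<in> W \<Longrightarrow> y \<in> W \<Longrightarrow> (x, y) \<in> r \<Longrightarrow> linked r W x y"
  unfolding linked_def by (rule r_into_rtranclp) simp

lemma linked_mono:
  assumes "linked r W x y" "W \<subseteq> W'" "r \<subseteq> r'"
  shows "linked r' W' x y"
  using assms(1) unfolding linked_def
  by (rule rtranclp_mono[THEN predicate2D, rotated]) (use assms in auto)

lemma linked_induct [consumes 1, case_names refl step]:
  assumes "linked r W x y" "P x"
    and "\<And>y z. linked r W x y \<Longrightarrow> y \<in> W \<Longrightarrow> z \<in> W \<Longrightarrow> (y, z) \<in> r \<Longrightarrow> P y \<Longrightarrow> P z"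
  shows "P y"
  using assms(1) unfolding linked_def
  by (induction rule: rtranclp_induct) (auto intro: assms(2,3) simp: linked_def)

lemma linked_converse:
  fixes r :: "('a \<times> 'a) set"
  shows "linked (r\<inverse>) W y x \<longleftrightarrow> linked r W x y"
proof -
  have 1: "linked (r\<inverse>) W y x" if "linked r W x y" for x y and r :: "('a \<times> 'a) set"
    using that
  proof (induction rule: linked_induct)
    case (step u v)
    then have "linked (r\<inverse>) W v u" by (intro linked_edge) auto
    with step show ?case by (blast intro: linked_trans)
  qed simp
  show ?thesis using 1[of r x y] 1[of "r\<inverse>" y x] by auto
qed

lemma linked_first_hit:
  assumes "linked r W a b" "a \<in> W"
  obtains "linked r (W - B) a b" "b \<notin> B" "a \<notin> B"
    | b' where "b' \<in> B" "b' \<in> W" "linked r (W - B \<union> {b'}) a b'" "a \<in> W - B \<union> {b'}"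
proof -
  have "(b \<notin> B \<and> a \<notin> B \<and> linked r (W - B) a b) \<or>
      (\<exists>b'\<in>B \<inter> W. linked r (W - B \<union> {b'}) a b' \<and> a \<in> W - B \<union> {b'})" (is "?P b \<or> ?Q")
    using assms(1)
  proof (induction rule: linked_induct)
    case refl
    show ?case using assms(2) by (cases "a \<in> B") auto
  next
    case (step y z)
    then consider "?Q" | "y \<notin> B" "a \<notin> B" "linked r (W - B) a y" by blast
    then show ?case
    proof cases
      case 2
      show ?thesis
      proof (cases "z \<in> B")
        case True
        have "linked r (W - B \<union> {z}) a y" using 2 by (rule_tac linked_mono[of r "W - B"]) auto
        then have "linked r (W - B \<union> {z}) a z"
          using 2 step by (elim linked_trans) (auto intro: linked_edge)
        with True step 2 assms show ?thesis by blast
      next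
        case False
        then have "linked r (W - B) a z"
          using 2 step by (blast intro: linked_trans linked_edge)
        with False 2 show ?thesis by blast
      qed
    qed simp
  qed
  with that show thesis by blast
qed

text \<open>The set \<open>X\<close> may meet \<open>A\<close> and \<open>B\<close>. As
  \<open>linked\<close> is reflexive, it has to contain \<open>A \<inter> B\<close>.\<close>

definition separates :: "('v \<times> 'v) set \<Rightarrow> 'v set \<Rightarrow> 'v set \<Rightarrow> 'v set \<Rightarrow> bool" where
  "separates r A B X \<longleftrightarrow> (\<forall>a\<in>A - X. \<forall>b\<in>B - X. \<not> linked r (- X) a b)"

text \<open>A family of disjoint connectors stands for a family of disjoint paths: each member contains a
  path from \<open>A\<close> to \<open>B\<close>, but may contain further vertices.\<close>

definition connectors :: "('v \<times> 'v) set \<Rightarrow> 'v set \<Rightarrow> 'v set \<Rightarrow> 'i set \<Rightarrow> ('i \<Rightarrow> 'v set) \<Rightarrow> bool" where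
  "connectors r A B I f \<longleftrightarrow> disjoint_family_on f I \<and>
     (\<forall>i\<in>I. \<exists>a\<in>A \<inter> f i. \<exists>b\<in>B \<inter> f i. linked r (f i) a b)"

lemma connectors_converse: "connectors (r\<inverse>) B A I f \<longleftrightarrow> connectors r A B I f"
  unfolding connectors_def linked_converse by blast

lemma separates_converse: "separates (r\<inverse>) B A X \<longleftrightarrow> separates r A B X"
  unfolding separates_def linked_converse by blast

text \<open>When the number of connectors equals the size of the target set, each connector can be cut at
  the unique target vertex that it contains.\<close>

lemma connectors_indexed:
  assumes f: "connectors r A P {..<k} f" and P: "finite P" "card P = k"
  obtains g where "disjoint_family_on g P" "\<And>s. s \<in> P \<Longrightarrow> s \<in> g s"
    "\<And>s. s \<in> P \<Longrightarrow> \<exists>a\<in>A \<inter> g s. linked r (g s) a s"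
    "\<And>s w. s \<in> P \<Longrightarrow> w \<in> g s \<Longrightarrow> w \<noteq> s \<Longrightarrow> w \<notin> P \<and> (\<exists>a\<in>A. a \<notin> P \<and> linked r (- P) a w)"
    "\<And>s w. s \<in> P \<Longrightarrow> w \<in> g s \<Longrightarrow> w = s \<Longrightarrow> s \<in> A \<or> (\<exists>a\<in>A. a \<notin> P \<and> linked r (- (P - {s})) a w)"
proof -
  have dj: "f i \<inter> f j = {}" if "i < k" "j < k" "i \<noteq> j" for i j
    using f that by (auto simp: connectors_def disjoint_family_on_def)
  have "\<exists>a s. a \<in> A \<and> a \<in> f i \<and> s \<in> P \<and> s \<in> f i \<and> linked r (f i - P \<union> {s}) a s \<and> a \<in> f i - P \<union> {s}" if "i < k" for i
  proof -
    have "\<exists>a\<in>A \<inter> f i. \<exists>b\<in>P \<inter> f i. linked r (f i) a b" using f that by (simp add: connectors_def)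
    then obtain a b where ab: "a \<in> A" "a \<in> f i" "b \<in> P" "b \<in> f i" "linked r (f i) a b"
      by (elim bexE IntE)
    from ab(5,2) show ?thesis by (rule linked_first_hit[where B = P]) (use ab in auto)
  qed
  then obtain a s where as: "\<And>i. i < k \<Longrightarrow> a i \<in> A \<and> a i \<in> f i \<and> s i \<in> P \<and> s i \<in> f i \<and>
      linked r (f i - P \<union> {s i}) (a i) (s i) \<and> a i \<in> f i - P \<union> {s i}"
    by metis
  have inj: "inj_on s {..<k}" using as dj by (intro inj_onI) (metis disjoint_iff lessThan_iff)
  have img: "s ` {..<k} = P"
    using as P inj by (intro card_subset_eq) (auto simp: card_image)
  define h where "h = the_inv_into {..<k} s"
  have h: "h x < k" "s (h x) = x" if "x \<in> P" for x
    using that inj img the_inv_into_into[OF inj, of x "{..<k}"] f_the_inv_into_f[OF inj, of x]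
    by (auto simp: h_def)
  define c where "c = (\<lambda>x. f (h x) - P \<union> {x})"
  \<comment> \<open>Connectors may contain stray vertices. Only \<open>x\<close> and what the walk
    from \<open>A\<close> reaches before \<open>x\<close> is kept, so that every other vertex of
    \<open>g x\<close> is reached from \<open>A\<close> off \<open>P\<close>. This is what later
    confines the intersections of front and back parts to the separator.\<close>
  define g where "g = (\<lambda>x. {w \<in> c x. w = x \<or> (a (h x) \<notin> P \<and> linked r (c x - {x}) (a (h x)) w)})"
  have cP: "c x - {x} \<subseteq> - P" for x by (auto simp: c_def)
  show thesis
  proof
    show "disjoint_family_on g P"
      unfolding disjoint_family_on_def
    proof (intro ballI impI)
      fix x y assume "x \<in> P" "y \<in> P" "x \<noteq> y"
      moreover have "h x \<noteq> h y" using h calculation by metis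
      moreover have "c x \<subseteq> f (h x)" "c y \<subseteq> f (h y)" using as h calculation by (fastforce simp: c_def)+
      ultimately have "c x \<inter> c y = {}" using dj h by blast
      then show "g x \<inter> g y = {}" by (auto simp: g_def)
    qed
    fix x assume x: "x \<in> P"
    show "x \<in> g x" by (auto simp: g_def c_def)
    have ah: "a (h x) \<in> A" "a (h x) \<in> c x" "linked r (c x) (a (h x)) x"
      using as[OF h(1)[OF x]] h(2)[OF x] by (auto simp: c_def)
    have alink: "a (h x) = x \<or> a (h x) \<notin> P \<and> linked r (g x) (a (h x)) x \<and> linked r (- (P - {x})) (a (h x)) x"
    proof (cases "a (h x) = x")
      case False
      then have nP: "a (h x) \<notin> P" using ah by (auto simp: c_def)
      \<comment> \<open>The walk is cut at its first arrival at \<open>x\<close>; the vertex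
        \<open>w'\<close> before that arrival is reached inside \<open>c x - {x}\<close>.\<close>
      have "(w = x \<and> (\<exists>w'. linked r (c x - {x}) (a (h x)) w' \<and> w' \<in> c x - {x} \<and> (w', x) \<in> r)) \<or>
          (w \<noteq> x \<and> linked r (c x - {x}) (a (h x)) w) \<or>
          (\<exists>w'. linked r (c x - {x}) (a (h x)) w' \<and> w' \<in> c x - {x} \<and> (w', x) \<in> r)"
        if "linked r (c x) (a (h x)) w" for w
        using that
      proof (induction rule: linked_induct)
        case refl then show ?case using False by auto
      next
        case (step y z)
        then show ?case
          by (cases "z = x") (auto intro: linked_trans[OF _ linked_edge])
      qed
      from this[OF ah(3)] obtain w' where w': "linked r (c x - {x}) (a (h x)) w'" "w' \<in> c x - {x}" "(w', x) \<in> r"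
        by auto
      have "linked r (g x) (a (h x)) w" if "linked r (c x - {x}) (a (h x)) w" for w
        using that
      proof (induction rule: linked_induct)
        case (step y z)
        have "linked r (c x - {x}) (a (h x)) z" using step by (blast intro: linked_trans linked_edge)
        then have "y \<in> g x" "z \<in> g x" using step nP by (auto simp: g_def)
        with step show ?case by (blast intro: linked_trans linked_edge)
      qed simp
      then have "linked r (g x) (a (h x)) w'" using w' by blast
      moreover have "w' \<in> g x" "x \<in> g x" using w' nP by (auto simp: g_def c_def)
      ultimately have "linked r (g x) (a (h x)) x" using w' by (blast intro: linked_trans linked_edge)
      moreover have "linked r (- (P - {x})) (a (h x)) x"
        by (rule linked_mono[OF ah(3)]) (auto simp: c_def)
      ultimately show ?thesis using nP by blast
    qed simp
    moreover have "a (h x) \<in> g x"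
      using alink ah by (auto simp: g_def)
    ultimately show "\<exists>a\<in>A \<inter> g x. linked r (g x) a x" using ah(1) by (metis IntI linked_refl)
    fix w assume w: "w \<in> g x"
    show "w \<notin> P \<and> (\<exists>a\<in>A. a \<notin> P \<and> linked r (- P) a w)" if "w \<noteq> x"
    proof -
      have *: "w \<in> c x" "a (h x) \<notin> P" "linked r (c x - {x}) (a (h x)) w" using w that by (auto simp: g_def)
      then have "linked r (- P) (a (h x)) w" using cP by (blast intro: linked_mono)
      with * ah(1) show ?thesis using cP that by blast
    qed
    show "x \<in> A \<or> (\<exists>a\<in>A. a \<notin> P \<and> linked r (- (P - {x})) a w)" if "w = x"
      using alink ah(1) that by metis
  qed
qed

text \<open>Passing from \<open>r'\<close> to \<open>r\<close> adds only edges that leave \<open>x\<close>. A path of \<open>r\<close> from \<open>A\<close> to \<open>B\<close> that avoids \<open>x\<close>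
  is a path of \<open>r'\<close>, so it meets \<open>S\<close>; hence every such path reaches \<open>insert x S\<close> within \<open>r'\<close>.\<close>

lemma separates_via:
  assumes S: "separates r' A B S" and r: "\<And>a b. (a, b) \<in> r \<Longrightarrow> (a, b) \<in> r' \<or> a = x"
    and X: "separates r' A (insert x S) X"
  shows "separates r A B X"
  unfolding separates_def
proof (intro ballI notI)
  let ?P = "insert x S"
  fix a b assume a: "a \<in> A - X" and b: "b \<in> B - X" and l: "linked r (- X) a b"
  have "a \<in> - X" using a by simp
  with l show False
  proof (rule linked_first_hit[where B = ?P])
    assume l: "linked r (- X - ?P) a b" "b \<notin> ?P" "a \<notin> ?P"
    have "linked r' (- S) a b"
      using l(1)
    proof (induction rule: linked_induct)
      case (step u v)
      then have "(u, v) \<in> r'" using r[OF step(4)] by auto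
      then have "linked r' (- S) u v" using step by (intro linked_edge) auto
      with step show ?case by (blast intro: linked_trans)
    qed simp
    with S show False using a b l by (auto simp: separates_def)
  next
    fix p assume p: "p \<in> ?P" "p \<in> - X" "linked r (- X - ?P \<union> {p}) a p" "a \<in> - X - ?P \<union> {p}"
    have "linked r (- X - ?P \<union> {p}) a v \<Longrightarrow> linked r' (- X) a v \<or> linked r' (- X) a p" for v
    proof (induction rule: linked_induct)
      case (step u v)
      show ?case
      proof (cases "u = p")
        case False
        with step have "(u, v) \<in> r'" using r[OF step(4)] p by auto
        with step False p have "linked r' (- X) u v" by (intro linked_edge) auto
        with step show ?thesis by (blast intro: linked_trans)
      qed (use step in auto)
    qed simp
    then have "linked r' (- X) a p" using p by blast
    then show False using X a p by (auto simp: separates_def)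
  qed
qed

text \<open>Induction on the number of arcs, after Goering. Remove an arc \<open>(x, y)\<close>. If
  the rest has a separator \<open>S\<close> with fewer than \<open>k\<close> elements, then
  \<open>insert x S\<close> and \<open>insert y S\<close> both separate in \<open>r\<close>, so they
  have exactly \<open>k\<close> elements. The induction hypothesis gives connectors from
  \<open>A\<close> to \<open>insert x S\<close> and from \<open>insert y S\<close> to
  \<open>B\<close> in the rest, and these are glued at the vertices of \<open>S\<close> and across
  the arc.\<close>

theorem menger:
  fixes r :: "('v \<times> 'v) set"
  assumes "finite r" "finite A" "finite B"
    and "\<And>X. finite X \<Longrightarrow> separates r A B X \<Longrightarrow> k \<le> card X"
  shows "\<exists>f. connectors r A B {..<k} f"
  using assms
proof (induction "card r" arbitrary: r A B)
  case 0
  then have "separates r A B (A \<inter> B)"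
    unfolding separates_def linked_def by (auto elim: rtranclp.cases)
  then have "k \<le> card (A \<inter> B)" using 0 by blast
  then obtain T where T: "T \<subseteq> A \<inter> B" "card T = k" "finite T"
    by (rule obtain_subset_with_card_n)
  then obtain f where f: "bij_betw f {..<k} T" using ex_bij_betw_nat_finite by (metis atLeast0LessThan)
  have "connectors r A B {..<k} (\<lambda>i. {f i})"
    using f T unfolding connectors_def disjoint_family_on_def bij_betw_def inj_on_def by (auto 4 3)
  then show ?case by blast
next
  case (Suc m)
  from Suc(2) obtain x y where xy: "(x, y) \<in> r" by (metis card.empty ex_in_conv surj_pair nat.distinct(1))
  define r' where "r' = r - {(x, y)}"
  have r': "finite r'" "card r' = m" "r' \<subseteq> r" using Suc xy by (auto simp: r'_def)
  have r_cases: "(a, b) \<in> r' \<or> (a = x \<and> b = y)" if "(a, b) \<in> r" for a b using that by (auto simp: r'_def)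
  show ?case
  proof (cases "\<forall>X. finite X \<longrightarrow> separates r' A B X \<longrightarrow> k \<le> card X")
    case True
    then obtain f where "connectors r' A B {..<k} f" using Suc(1)[of r' A B] r' Suc by blast
    then have "connectors r A B {..<k} f"
      using linked_mono[OF _ order_refl r'(3)] unfolding connectors_def by meson
    then show ?thesis by blast
  next
    case False
    then obtain S where S: "finite S" "separates r' A B S" "card S < k" by auto
    have avoid: "linked r' W a b" if "linked r W a b" "x \<notin> W \<or> y \<notin> W" for W a b
      using that(1)
    proof (induction rule: linked_induct)
      case (step u v)
      then have "(u, v) \<in> r'" using that r_cases by blast
      with step show ?case by (blast intro: linked_trans linked_edge)
    qed simp
    have "separates r A B (insert x S)" "separates r A B (insert y S)"
      using S(2) avoid linked_mono[of r' _ _ _ "- S" r'] unfolding separates_def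
      by (metis Diff_iff insert_iff Compl_iff subset_insertI Compl_subset_Compl_iff order_refl)+
    then have "k \<le> card (insert x S)" "k \<le> card (insert y S)" using Suc(6) S by auto
    then have cards: "x \<notin> S" "y \<notin> S" "card (insert x S) = k" "card (insert y S) = k"
      using S by (auto simp: card_insert_if split: if_splits)
    let ?P = "insert x S" and ?Q = "insert y S"
    have sep1: "separates r A B X" if X: "separates r' A ?P X" for X
      by (rule separates_via[OF S(2) _ X]) (use r_cases in blast)
    have sep2: "separates r A B X" if X: "separates r' ?Q B X" for X
    proof -
      have conv: "separates (r'\<inverse>) B A S" "separates (r'\<inverse>) B ?Q X"
        using S(2) X by (simp_all add: separates_converse)
      have "separates (r\<inverse>) B A X"
        by (rule separates_via[OF conv(1) _ conv(2)]) (use r_cases in blast)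
      then show ?thesis by (simp add: separates_converse)
    qed
    have "\<exists>f. connectors r' A ?P {..<k} f"
      using Suc(1)[of r' A ?P] r' Suc(4) S sep1 Suc(6) by auto
    then obtain f1 where f1: "connectors r' A ?P {..<k} f1" by blast
    have "\<exists>f. connectors r' ?Q B {..<k} f"
      using Suc(1)[of r' ?Q B] r' Suc(5) S sep2 Suc(6) by auto
    then obtain f2 where f2: "connectors r' ?Q B {..<k} f2" by blast
    then have f2': "connectors (r'\<inverse>) B ?Q {..<k} f2" by (simp add: connectors_converse)
    have fin: "finite ?P" "finite ?Q" using S by auto
    obtain g1 where g1: "disjoint_family_on g1 ?P" "\<And>s. s \<in> ?P \<Longrightarrow> s \<in> g1 s"
      "\<And>s. s \<in> ?P \<Longrightarrow> \<exists>a\<in>A \<inter> g1 s. linked r' (g1 s) a s"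
      "\<And>s w. s \<in> ?P \<Longrightarrow> w \<in> g1 s \<Longrightarrow> w \<noteq> s \<Longrightarrow> w \<notin> ?P \<and> (\<exists>a\<in>A. a \<notin> ?P \<and> linked r' (- ?P) a w)"
      "\<And>s w. s \<in> ?P \<Longrightarrow> w \<in> g1 s \<Longrightarrow> w = s \<Longrightarrow> s \<in> A \<or> (\<exists>a\<in>A. a \<notin> ?P \<and> linked r' (- (?P - {s})) a w)"
      using connectors_indexed[OF f1 fin(1) cards(3)] by blast
    obtain g2 where g2: "disjoint_family_on g2 ?Q" "\<And>s. s \<in> ?Q \<Longrightarrow> s \<in> g2 s"
      "\<And>s. s \<in> ?Q \<Longrightarrow> \<exists>a\<in>B \<inter> g2 s. linked (r'\<inverse>) (g2 s) a s"
      "\<And>s w. s \<in> ?Q \<Longrightarrow> w \<in> g2 s \<Longrightarrow> w \<noteq> s \<Longrightarrow> w \<notin> ?Q \<and> (\<exists>a\<in>B. a \<notin> ?Q \<and> linked (r'\<inverse>) (- ?Q) a w)"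
      "\<And>s w. s \<in> ?Q \<Longrightarrow> w \<in> g2 s \<Longrightarrow> w = s \<Longrightarrow> s \<in> B \<or> (\<exists>a\<in>B. a \<notin> ?Q \<and> linked (r'\<inverse>) (- (?Q - {s})) a w)"
      using connectors_indexed[OF f2' fin(2) cards(4)] by blast
    have reach1: "\<exists>a\<in>A - S. linked r' (- S) a w" if "s \<in> ?P" "w \<in> g1 s" "w \<notin> S" for s w
    proof (cases "w = s")
      case True
      then have "s = x" using that by auto
      have "- (?P - {s}) \<subseteq> - S" using \<open>s = x\<close> cards by auto
      then show ?thesis using g1(5)[OF that(1,2) True] True \<open>s = x\<close> cards(1)
        by (metis Diff_iff insertCI linked_mono linked_refl order_refl)
    next
      case False
      then show ?thesis using g1(4)[OF that(1,2) False] by (blast intro: linked_mono)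
    qed
    have reach2: "\<exists>b\<in>B - S. linked r' (- S) w b" if "s \<in> ?Q" "w \<in> g2 s" "w \<notin> S" for s w
    proof -
      have "\<exists>b\<in>B - S. linked (r'\<inverse>) (- S) b w"
      proof (cases "w = s")
        case True
        then have "s = y" using that by auto
        have "- (?Q - {s}) \<subseteq> - S" using \<open>s = y\<close> cards by auto
        then show ?thesis using g2(5)[OF that(1,2) True] True \<open>s = y\<close> cards(2)
          by (metis Diff_iff insertCI linked_mono linked_refl order_refl)
      next
        case False
        then show ?thesis using g2(4)[OF that(1,2) False] by (blast intro: linked_mono)
      qed
      then show ?thesis by (simp add: linked_converse)
    qed
    \<comment> \<open>A vertex outside \<open>S\<close> common to a front part and a back part would
      link \<open>A\<close> to \<open>B\<close> off \<open>S\<close> without the removed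
      arc.\<close>
    have meet: "w \<in> S \<and> w = s \<and> w = q" if "s \<in> ?P" "q \<in> ?Q" "w \<in> g1 s" "w \<in> g2 q" for s q w
    proof -
      note mem = that
      have "w \<in> S"
      proof (rule ccontr)
        assume "w \<notin> S"
        obtain a where a: "a \<in> A - S" "linked r' (- S) a w" using reach1[OF mem(1,3) \<open>w \<notin> S\<close>] by blast
        obtain b where "b \<in> B - S" "linked r' (- S) w b" using reach2[OF mem(2,4) \<open>w \<notin> S\<close>] by blast
        with a show False using S(2) unfolding separates_def by (blast intro: linked_trans)
      qed
      then show ?thesis using g1(4)[OF that(1,3)] g2(4)[OF that(2,4)] by auto
    qed
    \<comment> \<open>The connector that ends in \<open>x\<close> continues across the arc to
      \<open>y\<close>, every other one at its own vertex of \<open>S\<close>.\<close>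
    define q where "q = (\<lambda>s. if s = x then y else s)"
    have q: "q s \<in> ?Q" "s = q s \<or> (s = x \<and> q s = y)" if "s \<in> ?P" for s using that by (auto simp: q_def)
    have q_inj: "s = t" if "s \<in> ?P" "t \<in> ?P" "q s = q t" for s t
      using that cards by (auto simp: q_def split: if_splits)
    define g where "g = (\<lambda>s. g1 s \<union> g2 (q s))"
    have dj: "g s \<inter> g t = {}" if st: "s \<in> ?P" "t \<in> ?P" "s \<noteq> t" for s t
    proof -
      have "g1 s \<inter> g1 t = {}" using disjoint_family_onD[OF g1(1) st] .
      moreover have "g2 (q s) \<inter> g2 (q t) = {}"
        using disjoint_family_onD[OF g2(1) q(1)[OF st(1)] q(1)[OF st(2)]] q_inj[OF st(1,2)] st(3) by blast
      moreover have "g1 u \<inter> g2 (q v) = {}" if uv: "u \<in> ?P" "v \<in> ?P" "u \<noteq> v" for u v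
      proof (rule equals0I)
        fix w assume "w \<in> g1 u \<inter> g2 (q v)"
        then have "w \<in> S" "w = u" "w = q v" using meet[OF uv(1) q(1)[OF uv(2)]] by auto
        with q(2)[OF uv(2)] uv(3) cards(2) show False by auto
      qed
      from this[OF st] this[OF st(2,1)] st(3) have "g1 s \<inter> g2 (q t) = {}" "g1 t \<inter> g2 (q s) = {}"
        by auto
      ultimately show ?thesis unfolding g_def by blast
    qed
    have link: "\<exists>a\<in>A \<inter> g s. \<exists>b\<in>B \<inter> g s. linked r (g s) a b" if s: "s \<in> ?P" for s
    proof -
      obtain a where a: "a \<in> A" "a \<in> g1 s" "linked r' (g1 s) a s" using g1(3)[OF s] by auto
      obtain b where b: "b \<in> B" "b \<in> g2 (q s)" "linked r' (g2 (q s)) (q s) b"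
        using g2(3)[OF q(1)[OF s]] by (auto simp: linked_converse)
      have 1: "linked r (g s) a s" using a r' by (auto simp: g_def intro: linked_mono)
      have 3: "linked r (g s) (q s) b" using b r' by (auto simp: g_def intro: linked_mono)
      have "linked r (g s) s (q s)"
        using q(2)[OF s]
      proof
        assume "s = x \<and> q s = y"
        then show ?thesis using xy g1(2)[OF s] g2(2)[OF q(1)[OF s]] by (intro linked_edge) (auto simp: g_def)
      qed (metis linked_refl)
      with 1 3 have "linked r (g s) a b" by (blast intro: linked_trans)
      with a b show ?thesis by (auto simp: g_def)
    qed
    obtain e where e: "bij_betw e {..<k} ?P"
      using ex_bij_betw_nat_finite[OF fin(1)] cards(3) by (metis atLeast0LessThan)
    have "connectors r A B {..<k} (g \<circ> e)"
      unfolding connectors_def disjoint_family_on_def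
    proof (intro conjI ballI impI)
      fix i j assume "i \<in> {..<k}" "j \<in> {..<k}" "i \<noteq> j"
      then show "(g \<circ> e) i \<inter> (g \<circ> e) j = {}"
        using e dj[of "e i" "e j"] unfolding bij_betw_def inj_on_def by auto
    next
      fix i assume "i \<in> {..<k}"
      then show "\<exists>a\<in>A \<inter> (g \<circ> e) i. \<exists>b\<in>B \<inter> (g \<circ> e) i. linked r ((g \<circ> e) i) a b"
        using e link[of "e i"] unfolding bij_betw_def by auto
    qed
    then show ?thesis by blast
  qed
qed

subsection \<open>Separating an end\<close>

lemma linked_finite_support:
  assumes "linked (\<Union>n. r n) W a b" "a \<in> W" "mono (r :: nat \<Rightarrow> _)"
  obtains n U where "finite U" "U \<subseteq> W" "a \<in> U" "b \<in> U" "linked (r n) U a b"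
proof -
  have "\<exists>n U. finite U \<and> U \<subseteq> W \<and> a \<in> U \<and> b \<in> U \<and> linked (r n) U a b"
    using assms(1)
  proof (induction rule: linked_induct)
    case refl
    show ?case using assms(2) by (intro exI[of _ "{a}"] exI) auto
  next
    case (step y z)
    then obtain n U where U: "finite U" "U \<subseteq> W" "a \<in> U" "y \<in> U" "linked (r n) U a y" by auto
    obtain m where m: "(y, z) \<in> r m" using step by auto
    have le: "r n \<subseteq> r (max m n)" "r m \<subseteq> r (max m n)" using assms(3) by (auto simp: mono_def)
    have "linked (r (max m n)) (insert z U) a y" by (rule linked_mono[OF U(5) subset_insertI le(1)])
    moreover have "linked (r (max m n)) (insert z U) y z" using m le U by (intro linked_edge) auto
    ultimately have "linked (r (max m n)) (insert z U) a z" by (rule linked_trans)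
    with U step(3) show ?case
      by (intro exI[of _ "max m n"] exI[of _ "insert z U"]) auto
  qed
  with that show thesis by auto
qed

text \<open>A compactness argument. If every finite stage \<open>rn n\<close> has a separator
  \<open>X n\<close> with fewer than \<open>k\<close> elements, take \<open>Y\<close> of largest
  size among the sets contained in infinitely many \<open>X n\<close>. A walk off \<open>Y\<close>
  spans a finite set \<open>U\<close>, and by maximality each of its vertices lies in only finitely
  many of the \<open>X n\<close> that contain \<open>Y\<close>. Some late \<open>X n\<close>
  therefore misses the walk, although it separates a stage containing all its arcs. Hence
  \<open>Y\<close> itself separates.\<close>

theorem menger_countable:
  fixes r :: "('v \<times> 'v) set"
  assumes "countable r" "finite A" "finite B"
    and sep: "\<And>X. finite X \<Longrightarrow> separates r A B X \<Longrightarrow> k \<le> card X"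
  shows "\<exists>f. connectors r A B {..<k} f"
proof (rule ccontr)
  assume none: "\<nexists>f. connectors r A B {..<k} f"
  \<comment> \<open>The intersection with \<open>r\<close> covers the empty relation, for which
    \<open>from_nat_into\<close> returns an arbitrary value.\<close>
  define rn where "rn = (\<lambda>n. (from_nat_into r ` {..<n}) \<inter> r)"
  have rn: "finite (rn n)" "rn n \<subseteq> r" for n by (auto simp: rn_def)
  have mono: "mono rn" by (auto simp: rn_def mono_def)
  have Un: "(\<Union>n. rn n) = r"
  proof
    show "r \<subseteq> (\<Union>n. rn n)"
    proof
      fix e assume e: "e \<in> r"
      then obtain i where "from_nat_into r i = e" using assms(1) from_nat_into_surj by metis
      then have "e \<in> rn (Suc i)" using e by (auto simp: rn_def)
      then show "e \<in> (\<Union>n. rn n)" by blast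
    qed
  qed (auto simp: rn_def)
  have "\<exists>X. finite X \<and> separates (rn n) A B X \<and> card X < k" for n
  proof (rule ccontr)
    assume "\<not> ?thesis"
    then have "\<And>X. finite X \<Longrightarrow> separates (rn n) A B X \<Longrightarrow> k \<le> card X" by (meson not_le)
    then obtain f where f: "connectors (rn n) A B {..<k} f" using menger[OF rn(1) assms(2,3)] by metis
    have "connectors r A B {..<k} f"
      using f linked_mono[OF _ order_refl rn(2)] unfolding connectors_def by meson
    with none show False by blast
  qed
  then obtain X where X: "\<And>n. finite (X n)" "\<And>n. separates (rn n) A B (X n)" "\<And>n. card (X n) < k"
    by metis
  let ?P = "\<lambda>Y. finite Y \<and> infinite {n. Y \<subseteq> X n}"
  have bound: "card Y < k" if "?P Y" for Y
  proof -
    obtain n where "Y \<subseteq> X n" using \<open>?P Y\<close> by (metis (mono_tags) empty_Collect_eq finite.emptyI)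
    then show ?thesis using card_mono[OF X(1)] X(3) by (metis le_less_trans)
  qed
  have "?P {}" by simp
  then obtain Y where Y: "?P Y" and max: "\<And>Z. ?P Z \<Longrightarrow> card Z \<le> card Y"
    using ex_has_greatest_nat[of ?P "{}" card k] bound by (metis less_imp_le)
  have "separates r A B Y"
    unfolding separates_def
  proof (intro ballI notI)
    fix a b assume ab: "a \<in> A - Y" "b \<in> B - Y" "linked r (- Y) a b"
    then have "linked (\<Union>n. rn n) (- Y) a b" "a \<in> - Y" using Un by auto
    then obtain m U where U: "finite U" "U \<subseteq> - Y" "a \<in> U" "b \<in> U" "linked (rn m) U a b"
      using mono by (rule linked_finite_support)
    have "finite {n. insert u Y \<subseteq> X n}" if "u \<in> U" for u
    proof (rule ccontr)
      assume "infinite {n. insert u Y \<subseteq> X n}"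
      then have "?P (insert u Y)" using Y by blast
      then have "card (insert u Y) \<le> card Y" by (rule max)
      then show False using Y U that by (auto simp: card_insert_if)
    qed
    then have "finite ({..<m} \<union> (\<Union>u\<in>U. {n. insert u Y \<subseteq> X n}))" using U(1) by blast
    then have "\<exists>n. n \<in> {n. Y \<subseteq> X n} \<and> n \<notin> {..<m} \<union> (\<Union>u\<in>U. {n. insert u Y \<subseteq> X n})"
      using Y by (metis (no_types, lifting) finite_subset subsetI)
    then obtain n where n: "m \<le> n" "X n \<inter> U = {}" by (auto simp: not_less)
    have "linked (rn n) (- X n) a b"
      using U(5) by (rule linked_mono) (use n mono in \<open>auto simp: mono_def\<close>)
    moreover have "a \<in> A - X n" "b \<in> B - X n" using ab U n by auto
    ultimately show False using X(2) unfolding separates_def by blast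
  qed
  then show False using sep bound[OF Y] Y by (meson not_le)
qed

section \<open>Nested minimal separators of an end and disjoint rays through them\<close>

context lfgraph
begin

lemma conn_linked:
  assumes "conn E (D - X) x y"
  shows "linked {(x, y). x \<in> D \<and> y \<in> D \<and> {x, y} \<in> E} (- X) x y"
  using assms unfolding conn_def linked_def
  by (rule rtranclp_mono[THEN predicate2D, rotated]) auto

lemma linked_conn:
  assumes "linked {(x, y). x \<in> D \<and> y \<in> D \<and> {x, y} \<in> E} W x y"
  shows "conn E (W \<inter> D) x y"
  using assms unfolding conn_def linked_def
  by (rule rtranclp_mono[THEN predicate2D, rotated]) auto

definition end_sep :: "(nat \<Rightarrow> 'v) set \<Rightarrow> 'v set \<Rightarrow> 'v set \<Rightarrow> bool" where
  "end_sep \<alpha> A T \<longleftrightarrow> finite T \<and> T \<subseteq> V \<and> A \<inter> end_comp V E T \<alpha> = {}"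

definition min_end_sep :: "(nat \<Rightarrow> 'v) set \<Rightarrow> 'v set \<Rightarrow> 'v set \<Rightarrow> bool" where
  "min_end_sep \<alpha> A T \<longleftrightarrow> end_sep \<alpha> A T \<and> (\<forall>T'. end_sep \<alpha> A T' \<longrightarrow> card T \<le> card T')"

lemma min_end_sep_exists:
  assumes "\<alpha> \<in> ends V E" "finite A" "A \<subseteq> V"
  shows "\<exists>T. min_end_sep \<alpha> A T"
proof -
  have "end_sep \<alpha> A A" using assms end_comp_sub[OF assms] by (auto simp: end_sep_def)
  then show ?thesis unfolding min_end_sep_def using ex_has_least_nat by metis
qed

text \<open>If \<open>t\<close> had no neighbour in the component of the end, dropping
  \<open>t\<close> from \<open>T\<close> would leave that component as it is and give a smaller
  separator. Consequently a minimal separator of the neighbourhood of a set avoids the set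
  itself.\<close>

lemma min_end_sep_nbr:
  assumes \<alpha>: "\<alpha> \<in> ends V E" and T: "min_end_sep \<alpha> A T" and t: "t \<in> T"
  shows "\<exists>c\<in>end_comp V E T \<alpha>. {t, c} \<in> E"
proof (rule ccontr)
  assume none: "\<not> ?thesis"
  have fT: "finite T" "T \<subseteq> V" "A \<inter> end_comp V E T \<alpha> = {}"
    using T by (auto simp: min_end_sep_def end_sep_def)
  let ?T = "T - {t}"
  have fT': "finite ?T" "?T \<subseteq> V" using fT by auto
  have "card ?T < card T" using fT(1) t by (rule card_Diff1_less)
  then have "\<not> end_sep \<alpha> A ?T" using T by (auto simp: min_end_sep_def)
  then obtain a where a: "a \<in> A" "a \<in> end_comp V E ?T \<alpha>" using fT' by (auto simp: end_sep_def)
  obtain R where R: "R \<in> \<alpha>" using end_nonempty[OF \<alpha>] by blast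
  obtain n where n: "R n \<in> end_comp V E T \<alpha>" "R n \<in> end_comp V E ?T \<alpha>"
    using tail_common[OF end_comp_tail[OF \<alpha> fT(1,2) R] end_comp_tail[OF \<alpha> fT' R]] by blast
  have "conn E (end_comp V E ?T \<alpha>) (R n) a"
    using components_conn[OF end_comp_component[OF \<alpha> fT'] n(2) a(2)] .
  then have "a \<in> end_comp V E T \<alpha>"
  proof (induction rule: conn_induct)
    case (step y z)
    have "z \<noteq> t" using none step by (metis insert_commute)
    then have "z \<notin> T" using end_comp_sub[OF \<alpha> fT'] step by auto
    then show ?case using components_step[OF end_comp_component[OF \<alpha> fT(1,2)]] step by blast
  qed (rule n)
  with a fT show False by blast
qed

text \<open>\<open>D\<close> is the slab between the separators \<open>T\<close> and
  \<open>T'\<close>. A set separating \<open>T\<close> from \<open>T'\<close> in the slab also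
  separates \<open>A\<close> from the end, so by minimality it has at least \<open>card T\<close>
  elements, and Menger's theorem gives \<open>card T\<close> disjoint connectors. Each starts in a
  vertex of its own in \<open>T\<close>, which serves as its index, and is cut at its first vertex
  in \<open>T'\<close>.\<close>

lemma end_connectors:
  assumes \<alpha>: "\<alpha> \<in> ends V E" and cV: "countable V"
    and T: "min_end_sep \<alpha> A T" and T': "finite T'" "T' \<subseteq> end_comp V E T \<alpha>"
    and nest: "end_comp V E T' \<alpha> \<subseteq> end_comp V E T \<alpha>"
  defines "D \<equiv> end_comp V E T \<alpha> \<union> T - end_comp V E T' \<alpha>"
  shows "\<exists>Q nxt. \<forall>t\<in>T. finite (Q t) \<and> Q t \<subseteq> D \<and> t \<in> Q t \<and> nxt t \<in> T' \<and> Q t \<inter> T' = {nxt t} \<and>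
      (\<forall>x\<in>Q t. \<forall>y\<in>Q t. conn E (Q t) x y) \<and> (\<forall>s\<in>T. s \<noteq> t \<longrightarrow> Q s \<inter> Q t = {})"
proof -
  let ?C = "end_comp V E T \<alpha>" and ?C' = "end_comp V E T' \<alpha>"
  have fT: "finite T" "T \<subseteq> V" "A \<inter> ?C = {}"
    using T by (auto simp: min_end_sep_def end_sep_def)
  have comp: "?C \<in> components V E T" and CV: "?C \<subseteq> V - T"
    using end_comp_component[OF \<alpha> fT(1,2)] end_comp_sub[OF \<alpha> fT(1,2)] by auto
  have T'V: "T' \<subseteq> V" using T' CV by auto
  have comp': "?C' \<in> components V E T'" and CV': "?C' \<subseteq> V - T'"
    using end_comp_component[OF \<alpha> T'(1) T'V] end_comp_sub[OF \<alpha> T'(1) T'V] by auto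
  have TD: "T \<subseteq> D" "T' \<subseteq> D" "D \<subseteq> V" using CV CV' nest T'(2) fT(2) by (auto simp: D_def)
  let ?r = "{(x, y). x \<in> D \<and> y \<in> D \<and> {x, y} \<in> E}"
  have cr: "countable ?r"
    by (rule countable_subset[of _ "V \<times> V"]) (use TD cV in auto)
  have "card T \<le> card X" if X: "finite X" "separates ?r T T' X" for X
  proof -
    let ?X = "X \<inter> V"
    have fX: "finite ?X" "?X \<subseteq> V" using X by auto
    have False if a: "a \<in> A" "a \<in> end_comp V E ?X \<alpha>" for a
    proof -
      obtain R where R: "R \<in> \<alpha>" using end_nonempty[OF \<alpha>] by blast
      obtain n where n: "R n \<in> ?C'" "R n \<in> end_comp V E ?X \<alpha>"
        using tail_common[OF end_comp_tail[OF \<alpha> T'(1) T'V R] end_comp_tail[OF \<alpha> fX R]] by blast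
      let ?good = "\<exists>s\<in>T - X. \<exists>b\<in>T' - X. conn E (D - X) b s"
      have XV: "end_comp V E ?X \<alpha> \<subseteq> V - X" using end_comp_sub[OF \<alpha> fX] by auto
      have "conn E (end_comp V E ?X \<alpha>) (R n) a"
        using components_conn[OF end_comp_component[OF \<alpha> fX] n(2) a(2)] .
      \<comment> \<open>Invariant along a path from the end to \<open>a\<close> off
        \<open>X\<close>: the path is still beyond \<open>T'\<close>, or it is in the slab and
        joined there to \<open>T'\<close>, or it has already produced a forbidden connection from
        \<open>T'\<close> to \<open>T\<close>.\<close>
      then have "a \<in> ?C' \<or> (a \<in> D - X \<and> (\<exists>b\<in>T' - X. conn E (D - X) b a)) \<or> ?good"
      proof (induction rule: conn_induct)
        case refl
        show ?case using n by blast
      next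
        case (step y z)
        have yz: "y \<notin> X" "z \<notin> X" "z \<in> V" using XV step by auto
        consider "y \<in> ?C'" | b where "y \<in> D - X" "b \<in> T' - X" "conn E (D - X) b y" | ?good
          using step(5) by blast
        then show ?case
        proof cases
          case 1
          show ?thesis
          proof (cases "z \<in> T'")
            case True
            then have z: "z \<in> D - X" "z \<in> T' - X" using TD yz by auto
            then have "\<exists>b\<in>T' - X. conn E (D - X) b z" by (intro bexI[of _ z]) auto
            with z(1) show ?thesis by simp
          next
            case False
            then show ?thesis using components_step[OF comp' 1 step(4)] by blast
          qed
        next
          case 2
          show ?thesis
          proof (cases "y \<in> T")
            case True
            then show ?thesis using 2 yz by blast
          next
            case False
            then have "y \<in> ?C" using 2 by (auto simp: D_def)
            then have "z \<in> ?C \<union> T" using components_step[OF comp _ step(4)] by blast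
            then have "z \<in> ?C' \<or> z \<in> D - X" using yz by (auto simp: D_def)
            moreover have "conn E (D - X) b z" if "z \<in> D - X"
              by (rule conn_trans[OF 2(3) conn_edge[OF 2(1) that step(4)]])
            ultimately show ?thesis using 2(2) by blast
          qed
        qed blast
      qed
      moreover have "a \<notin> ?C'" "a \<in> D \<longrightarrow> a \<in> T" using a fT(3) nest by (auto simp: D_def)
      ultimately have ?good by blast
      then obtain s b where "s \<in> T - X" "b \<in> T' - X" "conn E (D - X) b s" by blast
      then show False using X(2) conn_linked[OF conn_sym, of D X b s] unfolding separates_def by blast
    qed
    then have "end_sep \<alpha> A ?X" using fX by (auto simp: end_sep_def)
    then have "card T \<le> card ?X" using T by (auto simp: min_end_sep_def)
    also have "\<dots> \<le> card X" using X by (intro card_mono) auto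
    finally show ?thesis .
  qed
  then obtain f where f: "connectors ?r T T' {..<card T} f"
    using menger_countable[OF cr fT(1) T'(1), of "card T"] by blast
  have dj: "f i \<inter> f j = {}" if "i < card T" "j < card T" "i \<noteq> j" for i j
    using f that by (auto simp: connectors_def disjoint_family_on_def)
  have "\<exists>Q a b. finite Q \<and> Q \<subseteq> D \<inter> f i \<and> a \<in> T \<and> a \<in> Q \<and> b \<in> T' \<and> Q \<inter> T' = {b} \<and> (\<forall>x\<in>Q. \<forall>y\<in>Q. conn E Q x y)"
    if "i < card T" for i
  proof -
    have "\<exists>a\<in>T \<inter> f i. \<exists>b\<in>T' \<inter> f i. linked ?r (f i) a b" using f that by (simp add: connectors_def)
    then obtain a b where ab: "a \<in> T" "a \<in> f i" "b \<in> T'" "b \<in> f i" "linked ?r (f i) a b"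
      by (elim bexE IntE)
    obtain b' where b': "b' \<in> T'" "b' \<in> f i" "linked ?r (f i - T' \<union> {b'}) a b'" "a \<in> f i - T' \<union> {b'}"
      using ab(5,2) by (rule linked_first_hit[where B = T']) (use ab in auto)
    let ?W = "(f i - T' \<union> {b'}) \<inter> D"
    have "conn E ?W a b'" "a \<in> ?W" using linked_conn[OF b'(3)] b'(4) ab(1) TD by auto
    then obtain Q where Q: "finite Q" "Q \<subseteq> ?W" "a \<in> Q" "b' \<in> Q" "\<And>u v. u \<in> Q \<Longrightarrow> v \<in> Q \<Longrightarrow> conn E Q u v"
      by (rule conn_finite_support) blast
    have "Q \<inter> T' = {b'}" "Q \<subseteq> D \<inter> f i" using Q b' by auto
    with Q ab b' show ?thesis by blast
  qed
  then obtain Q a b where Q: "\<And>i. i < card T \<Longrightarrow> finite (Q i) \<and> Q i \<subseteq> D \<inter> f i \<and> a i \<in> T \<and> a i \<in> Q i \<and>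
      b i \<in> T' \<and> Q i \<inter> T' = {b i} \<and> (\<forall>x\<in>Q i. \<forall>y\<in>Q i. conn E (Q i) x y)"
    by metis
  have Qdj: "Q i \<inter> Q j = {}" if "i < card T" "j < card T" "i \<noteq> j" for i j
    using dj[OF that] Q[OF that(1)] Q[OF that(2)] by blast
  have inj: "inj_on a {..<card T}"
    using Q Qdj by (intro inj_onI) (metis disjoint_iff lessThan_iff)
  have img: "a ` {..<card T} = T"
    using Q fT inj by (intro card_subset_eq) (auto simp: card_image)
  define h where "h = the_inv_into {..<card T} a"
  have h: "h t < card T" "a (h t) = t" if "t \<in> T" for t
    using that inj img the_inv_into_into[OF inj, of t "{..<card T}"] f_the_inv_into_f[OF inj, of t]
    by (auto simp: h_def)
  show ?thesis
  proof (intro exI ballI)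
    fix t assume t: "t \<in> T"
    have "Q (h s) \<inter> Q (h t) = {}" if "s \<in> T" "s \<noteq> t" for s
      using Qdj[OF h(1)[OF that(1)] h(1)[OF t]] h(2)[OF that(1)] h(2)[OF t] that(2) by metis
    then show "finite ((Q \<circ> h) t) \<and> (Q \<circ> h) t \<subseteq> D \<and> t \<in> (Q \<circ> h) t \<and> (b \<circ> h) t \<in> T' \<and> (Q \<circ> h) t \<inter> T' = {(b \<circ> h) t} \<and>
      (\<forall>x\<in>(Q \<circ> h) t. \<forall>y\<in>(Q \<circ> h) t. conn E ((Q \<circ> h) t) x y) \<and> (\<forall>s\<in>T. s \<noteq> t \<longrightarrow> (Q \<circ> h) s \<inter> (Q \<circ> h) t = {})"
      using Q[OF h(1)[OF t]] h(2)[OF t] by auto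
  qed
qed

text \<open>Starting from a minimal separator \<open>T0\<close>, each next one separates the
  neighbourhood of its predecessor from the end. Connectors of consecutive slabs are concatenated to
  disjoint connected sets, one for each vertex of \<open>T0\<close>, and each contains a ray of the
  end by Koenig's lemma. So \<open>card T0\<close> is at most the degree. Later separators may be
  larger; only the chains that begin in \<open>T0\<close> are followed.\<close>

theorem end_menger:
  assumes \<alpha>: "\<alpha> \<in> ends V E" and cV: "countable V" and V0: "V \<noteq> {}"
    and deg: "end_degree V E \<alpha> < enat k" and S: "finite S" "S \<subseteq> V"
  obtains T where "finite T" "T \<subseteq> V" "card T < k" "T \<inter> S = {}" "S \<inter> end_comp V E T \<alpha> = {}"
proof -
  let ?C = "\<lambda>T. end_comp V E T \<alpha>"
  define v where "v = from_nat_into V"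
  have v: "v n \<in> V" for n using V0 by (simp add: v_def from_nat_into)
  \<comment> \<open>With the neighbourhood of the old separator, the new one is disjoint from the
    old. With \<open>v n\<close>, every vertex eventually leaves the components, so a ray that runs
    through all the slabs belongs to the end.\<close>
  define A where "A = (\<lambda>n T. nbhd (insert (v n) T))"
  have sepD: "finite T \<and> T \<subseteq> V \<and> B \<inter> ?C T = {}" if "min_end_sep \<alpha> B T" for B T
    using that by (auto simp: min_end_sep_def end_sep_def)
  \<comment> \<open>Separating the neighbourhood of \<open>S\<close>, and not just \<open>S\<close>,
    makes \<open>T0\<close> disjoint from \<open>S\<close>.\<close>
  obtain T0 where T0: "min_end_sep \<alpha> (nbhd S) T0"
    using min_end_sep_exists[OF \<alpha> nbhd_finite nbhd_sub] S by blast
  have step: "\<exists>T'. (\<exists>B. min_end_sep \<alpha> B T') \<and> min_end_sep \<alpha> (A n T) T'" if "\<exists>B. min_end_sep \<alpha> B T" for n T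
    using min_end_sep_exists[OF \<alpha> nbhd_finite nbhd_sub, of "insert (v n) T"] sepD that v
    unfolding A_def by blast
  have "\<exists>T. T 0 = T0 \<and> (\<forall>n. min_end_sep \<alpha> (A n (T n)) (T (Suc n)))"
  proof -
    define T where "T = rec_nat T0 (\<lambda>n T. SOME T'. min_end_sep \<alpha> (A n T) T')"
    have "\<exists>B. min_end_sep \<alpha> B (T n)" for n
    proof (induction n)
      case (Suc n)
      then have "min_end_sep \<alpha> (A n (T n)) (SOME T'. min_end_sep \<alpha> (A n (T n)) T')"
        using step by (meson someI_ex)
      then show ?case by (auto simp: T_def)
    qed (use T0 in \<open>auto simp: T_def\<close>)
    then have "min_end_sep \<alpha> (A n (T n)) (T (Suc n))" for n
      using step[of "T n" n] someI_ex[of "\<lambda>T'. min_end_sep \<alpha> (A n (T n)) T'"] by (auto simp: T_def)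
    moreover have "T 0 = T0" by (simp add: T_def)
    ultimately show ?thesis by blast
  qed
  then obtain T where T: "T 0 = T0" "\<And>n. min_end_sep \<alpha> (A n (T n)) (T (Suc n))" by blast
  have ms: "\<exists>B. min_end_sep \<alpha> B (T n)" for n using T0 T by (cases n) auto
  have fT: "finite (T n)" "T n \<subseteq> V" for n using ms[of n] sepD by auto
  have avoid: "A n (T n) \<inter> ?C (T (Suc n)) = {}" for n using sepD[OF T(2)] by blast
  have sub: "?C (T (Suc n)) \<subseteq> ?C (T n)" for n
    using avoid[of n] by (intro end_comp_nest[OF \<alpha> fT fT]) (auto simp: A_def nbhd_def)
  have Tsub: "T (Suc n) \<subseteq> ?C (T n)" for n
  proof
    fix t assume t: "t \<in> T (Suc n)"
    obtain c where c: "c \<in> ?C (T (Suc n))" "{t, c} \<in> E" using min_end_sep_nbr[OF \<alpha> T(2) t] by blast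
    have "t \<notin> T n" using c avoid[of n] by (auto simp: A_def nbhd_def)
    moreover have "{c, t} \<in> E" using c by (simp add: insert_commute)
    ultimately show "t \<in> ?C (T n)"
      using components_step[OF end_comp_component[OF \<alpha> fT]] c sub by blast
  qed
  have sub_le: "?C (T n) \<subseteq> ?C (T m)" if "m \<le> n" for m n
    using that by (induction rule: dec_induct) (use sub in auto)
  have Tsub_less: "T n \<subseteq> ?C (T m)" if "m < n" for m n
    using that Tsub[of "n - 1"] sub_le[of m "n - 1"] by (cases n) auto
  define D where "D = (\<lambda>n. ?C (T n) \<union> T n - ?C (T (Suc n)))"
  have "\<forall>n. \<exists>Q nxt. \<forall>t\<in>T n. finite (Q t) \<and> Q t \<subseteq> D n \<and> t \<in> Q t \<and> nxt t \<in> T (Suc n) \<and> Q t \<inter> T (Suc n) = {nxt t} \<and>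
      (\<forall>x\<in>Q t. \<forall>y\<in>Q t. conn E (Q t) x y) \<and> (\<forall>s\<in>T n. s \<noteq> t \<longrightarrow> Q s \<inter> Q t = {})"
  proof
    fix n
    obtain B where B: "min_end_sep \<alpha> B (T n)" using ms by blast
    show "\<exists>Q nxt. \<forall>t\<in>T n. finite (Q t) \<and> Q t \<subseteq> D n \<and> t \<in> Q t \<and> nxt t \<in> T (Suc n) \<and> Q t \<inter> T (Suc n) = {nxt t} \<and>
      (\<forall>x\<in>Q t. \<forall>y\<in>Q t. conn E (Q t) x y) \<and> (\<forall>s\<in>T n. s \<noteq> t \<longrightarrow> Q s \<inter> Q t = {})"
      unfolding D_def by (rule end_connectors[OF \<alpha> cV B fT(1) Tsub sub])
  qed
  then obtain Q nxt where Q: "\<And>n t. t \<in> T n \<Longrightarrow> finite (Q n t) \<and> Q n t \<subseteq> D n \<and> t \<in> Q n t \<and> nxt n t \<in> T (Suc n) \<and>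
      Q n t \<inter> T (Suc n) = {nxt n t} \<and> (\<forall>x\<in>Q n t. \<forall>y\<in>Q n t. conn E (Q n t) x y) \<and> (\<forall>s\<in>T n. s \<noteq> t \<longrightarrow> Q n s \<inter> Q n t = {})"
    by metis
  define c where "c = (\<lambda>t. rec_nat t nxt)"
  have c0: "c t 0 = t" and cS: "c t (Suc n) = nxt n (c t n)" for t n by (auto simp: c_def)
  have cT: "c t n \<in> T n" if "t \<in> T0" for t n
    by (induction n) (use that T(1) Q in \<open>auto simp: c0 cS\<close>)
  have cneq: "c s n \<noteq> c t n" if "s \<in> T0" "t \<in> T0" "s \<noteq> t" for s t n
  proof (induction n)
    case (Suc n)
    have "Q n (c s n) \<inter> Q n (c t n) = {}" using Q[OF cT[OF that(2)]] cT[OF that(1)] Suc by blast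
    moreover have "nxt n (c s n) \<in> Q n (c s n)" "nxt n (c t n) \<in> Q n (c t n)"
      using Q[OF cT[OF that(1)]] Q[OF cT[OF that(2)]] by blast+
    ultimately show ?case unfolding cS by auto
  qed (use that c0 in auto)
  define W where "W = (\<lambda>t. \<Union>n. Q n (c t n))"
  have Qn: "Q n (c t n) \<subseteq> D n" "c t n \<in> Q n (c t n)" "finite (Q n (c t n))"
    "Q n (c t n) \<inter> T (Suc n) = {c t (Suc n)}" if "t \<in> T0" for t n
    using Q[OF cT[OF that]] by (auto simp: cS)
  have Qconn: "conn E (Q n (c t n)) x y" if "t \<in> T0" "x \<in> Q n (c t n)" "y \<in> Q n (c t n)" for t n x y
    using Q[OF cT[OF that(1)]] that(2,3) by blast
  have Qd: "Q n (c s n) \<inter> Q n (c t n) = {}" if "s \<in> T0" "t \<in> T0" "s \<noteq> t" for s t n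
    using Q[OF cT[OF that(2)]] cT[OF that(1)] cneq[OF that] by blast
  have QT: "Q n (c t n) \<inter> T n = {c t n}" if "t \<in> T0" for t n
  proof -
    have "x = c t n" if x: "x \<in> Q n (c t n)" "x \<in> T n" for x
    proof (rule ccontr)
      assume "x \<noteq> c t n"
      then have "Q n x \<inter> Q n (c t n) = {}" using Q[OF cT[OF \<open>t \<in> T0\<close>]] x(2) by blast
      then show False using Q[OF x(2)] x(1) by blast
    qed
    then show ?thesis using Qn(2)[OF that] cT[OF that] by blast
  qed
  \<comment> \<open>Slabs overlap only if they are consecutive, and then only in the separator
    between them, which each chain meets in a single vertex.\<close>
  have DD: "D m \<inter> D n \<subseteq> (if n = Suc m then T n else {})" if "m < n" for m n
  proof (cases "n = Suc m")
    case True
    then show ?thesis by (auto simp: D_def)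
  next
    case False
    with that have "Suc m < n" by simp
    then have "D n \<subseteq> ?C (T (Suc m))" using sub_le[of "Suc m" n] Tsub_less[of "Suc m" n] by (auto simp: D_def)
    then show ?thesis by (auto simp: D_def)
  qed
  have Qdj: "Q m (c s m) \<inter> Q n (c t n) = {}" if st: "s \<in> T0" "t \<in> T0" "s \<noteq> t" and mn: "m < n" for s t m n
  proof (cases "n = Suc m")
    case True
    have "Q m (c s m) \<inter> Q n (c t n) \<subseteq> T n"
      using DD[OF mn] Qn(1)[OF st(1), of m] Qn(1)[OF st(2), of n] True by auto
    then have "Q m (c s m) \<inter> Q n (c t n) \<subseteq> {c s n} \<inter> {c t n}"
      using Qn(4)[OF st(1), of m] QT[OF st(2), of n] True by auto
    then show ?thesis using cneq[OF st, of n] by auto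
  next
    case False
    then show ?thesis using DD[OF mn] Qn(1)[OF st(1), of m] Qn(1)[OF st(2), of n] by auto
  qed
  have Wdj: "W s \<inter> W t = {}" if st: "s \<in> T0" "t \<in> T0" "s \<noteq> t" for s t
  proof -
    have "Q m (c s m) \<inter> Q n (c t n) = {}" for m n
      using Qdj[OF st, of m n] Qdj[OF st(2,1), of n m] Qd[OF st, of m] st(3) by (cases m n rule: linorder_cases) auto
    then show ?thesis unfolding W_def by blast
  qed
  have TDj: "T m \<inter> T n = {}" if "m < n" for m n
    using Tsub_less[OF that] end_comp_sub[OF \<alpha> fT[of m]] by blast
  have ray: "\<exists>R. R \<in> \<alpha> \<and> range R \<subseteq> W t" if t: "t \<in> T0" for t
  proof -
    have WV: "W t \<subseteq> V" using Qn(1)[OF t] end_comp_sub[OF \<alpha> fT] fT(2) by (fastforce simp: W_def D_def)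
    have QW: "Q n (c t n) \<subseteq> W t" for n by (auto simp: W_def)
    have to_n: "conn E (W t) t (c t n)" for n
    proof (induction n)
      case (Suc n)
      have "conn E (Q n (c t n)) (c t n) (c t (Suc n))"
        using Qconn[OF t Qn(2)[OF t]] Qn(4)[OF t, of n] by blast
      then have "conn E (W t) (c t n) (c t (Suc n))" using QW by (rule conn_mono) simp
      with Suc show ?case by (rule conn_trans)
    qed (simp add: c0)
    have to_x: "conn E (W t) t x" if x: "x \<in> W t" for x
    proof -
      obtain n where "x \<in> Q n (c t n)" using x by (auto simp: W_def)
      then have "conn E (Q n (c t n)) (c t n) x" using Qconn[OF t Qn(2)[OF t]] by blast
      then have "conn E (W t) (c t n) x" using QW by (rule conn_mono) simp
      with to_n show ?thesis by (rule conn_trans)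
    qed
    have inf: "infinite (W t)"
    proof -
      have "inj (c t)"
      proof (rule injI)
        fix m n assume "c t m = c t n"
        then show "m = n" using cT[OF t, of m] cT[OF t, of n] TDj[of m n] TDj[of n m]
          by (cases m n rule: linorder_cases) auto
      qed
      then have "infinite (range (c t))" by (simp add: finite_image_iff)
      moreover have "range (c t) \<subseteq> W t" using Qn(2)[OF t] QW by blast
      ultimately show ?thesis using finite_subset by blast
    qed
    have "conn E (W t) x y" if "x \<in> W t" "y \<in> W t" for x y
      using to_x[OF that(1)] to_x[OF that(2)] by (blast intro: conn_trans conn_sym)
    then obtain R where R: "is_ray V E R" "range R \<subseteq> W t" using ray_exists[OF WV inf] by blast
    have "R \<in> \<alpha>"
    proof (rule mem_endI[OF \<alpha> R(1)])
      fix X assume X: "finite X" "X \<subseteq> V"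
      have "\<exists>n. \<forall>x\<in>X. x \<notin> ?C (T n)"
        using X
      proof (induction rule: finite_induct)
        case (insert x X)
        then obtain n where n: "\<forall>x\<in>X. x \<notin> ?C (T n)" by auto
        obtain m where m: "v m = x" unfolding v_def using cV insert from_nat_into_surj by (metis insert_subset)
        have "x \<notin> ?C (T (Suc m))" using avoid[of m] m by (auto simp: A_def nbhd_def)
        then have "\<forall>x\<in>insert x X. x \<notin> ?C (T (max n (Suc m)))"
          using n sub_le[of n "max n (Suc m)"] sub_le[of "Suc m" "max n (Suc m)"] by auto
        then show ?case by blast
      qed simp
      then obtain n where "?C (T n) \<inter> X = {}" by blast
      then have CX: "?C (T n) \<subseteq> ?C X" by (rule end_comp_nest[OF \<alpha> X fT])
      have "finite (\<Union>m\<le>n. Q m (c t m))" using Qn(3)[OF t] by blast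
      then obtain k where k: "\<And>i. i \<ge> k \<Longrightarrow> R i \<notin> (\<Union>m\<le>n. Q m (c t m))"
        using ray_tail_avoids_finite R(1) unfolding is_ray_def by meson
      have "R i \<in> ?C X" if i: "i \<ge> k" for i
      proof -
        obtain m where m: "R i \<in> Q m (c t m)" using R(2) by (auto simp: W_def)
        then have "n < m" using k[OF i] by (meson UN_I atMost_iff not_le)
        then have "R i \<in> ?C (T n)"
          using m Qn(1)[OF t, of m] sub_le[of n m] Tsub_less[of n m] by (auto simp: D_def)
        with CX show ?thesis by blast
      qed
      then show "has_tail_in R (?C X)" by (auto simp: has_tail_in_def)
    qed
    with R show ?thesis by blast
  qed
  then obtain R where R: "\<And>t. t \<in> T0 \<Longrightarrow> R t \<in> \<alpha> \<and> range (R t) \<subseteq> W t" by metis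
  have Rdj: "range (R s) \<inter> range (R t) = {}" if "s \<in> T0" "t \<in> T0" "s \<noteq> t" for s t
    using Wdj[OF that] R[OF that(1)] R[OF that(2)] by blast
  have fT0: "finite T0" using fT(1)[of 0] T by simp
  have inj: "inj_on R T0"
  proof (rule inj_onI, rule ccontr)
    fix s t assume "s \<in> T0" "t \<in> T0" "R s = R t" "s \<noteq> t"
    then show False using Rdj[of s t] by auto
  qed
  have "enat (card (R ` T0)) \<le> end_degree V E \<alpha>"
  proof (rule end_degree_ge)
    show "pairwise (\<lambda>R1 R2. range R1 \<inter> range R2 = {}) (R ` T0)"
      unfolding pairwise_def using Rdj by (metis imageE)
  qed (use fT0 R in auto)
  then have "card T0 < k" using deg inj by (metis card_image enat_ord_simps(2) le_less_trans)
  moreover have "T0 \<inter> S = {}"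
  proof (rule ccontr)
    assume "T0 \<inter> S \<noteq> {}"
    then obtain t where t: "t \<in> T0" "t \<in> S" by blast
    then obtain c where "c \<in> ?C T0" "{t, c} \<in> E" using min_end_sep_nbr[OF \<alpha> T0] by blast
    then have "c \<in> nbhd S \<inter> ?C T0" using t by (auto simp: nbhd_def)
    then show False using sepD[OF T0] by blast
  qed
  moreover have "S \<inter> ?C T0 = {}" using sepD[OF T0] by (auto simp: nbhd_def)
  ultimately show thesis using that sepD[OF T0] by blast
qed

end

subsection \<open>The Freudenthal compactification\<close>

text \<open>Ends get coordinate 0 everywhere. Every coordinate is then continuous on the whole
  compactification, and ends are recognised by the vanishing of all coordinates.\<close>

fun bary :: "'v fpoint \<Rightarrow> 'v \<Rightarrow> real" where
  "bary (Pt f) v = f v"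
| "bary (EndPt \<beta>) v = 0"

declare bary.simps(1) [simp del]

lemma vtx_eq_iff [simp]: "vtx v = vtx w \<longleftrightarrow> v = w"
  by (metis vtx_def zero_neq_one)

lemma bary_vtx [simp]: "bary (Pt (vtx v)) w = (if w = v then 1 else 0)"
  by (simp add: vtx_def bary.simps)

lemma bary_seg: "bary (Pt (seg u v t)) w = (if w = u then 1 - t else if w = v then t else 0)"
  by (simp add: seg_def bary.simps)

lemma seg_swap: "u \<noteq> v \<Longrightarrow> seg u v t = seg v u (1 - t)"
  by (auto simp: seg_def fun_eq_iff)

lemma continuous_map_realI:
  fixes f :: "'a \<Rightarrow> real"
  assumes "\<And>x e. x \<in> topspace X \<Longrightarrow> e > 0 \<Longrightarrow> \<exists>U. openin X U \<and> x \<in> U \<and> (\<forall>y\<in>U. \<bar>f y - f x\<bar> < e)"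
  shows "continuous_map X euclideanreal f"
  unfolding continuous_map_def
proof (intro conjI allI impI)
  fix W :: "real set" assume "openin euclideanreal W"
  then have W: "open W" by simp
  show "openin X {x \<in> topspace X. f x \<in> W}"
    unfolding openin_subopen[of X "{x \<in> topspace X. f x \<in> W}"]
  proof
    fix x assume x: "x \<in> {x \<in> topspace X. f x \<in> W}"
    then obtain e where e: "e > 0" "\<And>y. dist y (f x) < e \<Longrightarrow> y \<in> W" using W unfolding open_dist by blast
    obtain U where U: "openin X U" "x \<in> U" "\<forall>y\<in>U. \<bar>f y - f x\<bar> < e" using assms[of x e] x e by blast
    moreover have "U \<subseteq> {x \<in> topspace X. f x \<in> W}"
      using U e(2) openin_subset[OF U(1)] by (auto simp: dist_real_def)
    ultimately show "\<exists>T. openin X T \<and> x \<in> T \<and> T \<subseteq> {x \<in> topspace X. f x \<in> W}" by blast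
  qed
qed simp

context lfgraph
begin

abbreviation "FX \<equiv> freudenthal V E"

lemma FX_basis:
  "S \<in> edge_open_sets E \<union> vertex_open_sets V E \<union> end_open_sets V E \<Longrightarrow> openin FX S"
  unfolding freudenthal_def by (rule topology_generated_by_Basis)

lemma openin_edge: "{u, v} \<in> E \<Longrightarrow> 0 \<le> a \<Longrightarrow> a < b \<Longrightarrow> b \<le> 1 \<Longrightarrow> openin FX {Pt (seg u v t) | t. a < t \<and> t < b}"
  by (intro FX_basis) (auto simp: edge_open_sets_def)

lemma openin_star: "v \<in> V \<Longrightarrow> 0 < e \<Longrightarrow> e \<le> 1 \<Longrightarrow>
    openin FX (insert (Pt (vtx v)) {Pt (seg v w t) | w t. {v, w} \<in> E \<and> 0 < t \<and> t < e})"
  by (intro FX_basis) (auto simp: vertex_open_sets_def)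

lemma openin_end_nbhd: "finite S \<Longrightarrow> S \<subseteq> V \<Longrightarrow> \<alpha> \<in> ends V E \<Longrightarrow> openin FX (end_nbhd V E S \<alpha>)"
  by (intro FX_basis) (auto simp: end_open_sets_def)

lemma topspace_cases:
  assumes "x \<in> topspace FX"
  obtains (vtx) v where "v \<in> V" "x = Pt (vtx v)"
    | (seg) u v t where "{u, v} \<in> E" "u \<noteq> v" "0 < t" "t < 1" "x = Pt (seg u v t)"
    | (End) \<beta> where "\<beta> \<in> ends V E" "x = EndPt \<beta>"
proof -
  have "x \<in> \<Union>(edge_open_sets E \<union> vertex_open_sets V E \<union> end_open_sets V E)"
    using assms by (simp add: freudenthal_def)
  then consider "x \<in> \<Union>(edge_open_sets E)" | "x \<in> \<Union>(vertex_open_sets V E)" | "x \<in> \<Union>(end_open_sets V E)"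
    by blast
  then show thesis
  proof cases
    case 1
    then obtain B where "B \<in> edge_open_sets E" "x \<in> B" by blast
    then obtain u v a b t where uv: "{u, v} \<in> E" "0 \<le> a" "b \<le> 1" "a < t" "t < b" "x = Pt (seg u v t)"
      unfolding edge_open_sets_def by blast
    show ?thesis by (rule seg[of u v t]) (use uv edgeD[OF uv(1)] in auto)
  next
    case 2
    then obtain B where "B \<in> vertex_open_sets V E" "x \<in> B" by blast
    then obtain v e where ve: "v \<in> V" "e \<le> 1"
      "x = Pt (vtx v) \<or> (\<exists>w t. x = Pt (seg v w t) \<and> {v, w} \<in> E \<and> 0 < t \<and> t < e)"
      unfolding vertex_open_sets_def by blast
    from ve(3) show ?thesis
    proof
      assume "\<exists>w t. x = Pt (seg v w t) \<and> {v, w} \<in> E \<and> 0 < t \<and> t < e"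
      then obtain w t where wt: "x = Pt (seg v w t)" "{v, w} \<in> E" "0 < t" "t < e" by blast
      show ?thesis by (rule seg[of v w t]) (use wt edgeD[OF wt(2)] ve(2) in auto)
    qed (rule vtx[OF ve(1)])
  next
    case 3
    then obtain S \<alpha> where S: "finite S" "S \<subseteq> V" "\<alpha> \<in> ends V E" "x \<in> end_nbhd V E S \<alpha>"
      by (auto simp: end_open_sets_def)
    then consider v where "v \<in> end_comp V E S \<alpha>" "x = Pt (vtx v)"
      | u v t where "{u, v} \<in> E" "0 < t" "t < 1" "x = Pt (seg u v t)"
      | \<beta> where "\<beta> \<in> ends V E" "x = EndPt \<beta>"
      unfolding end_nbhd_def Let_def by blast
    then show ?thesis
    proof cases
      case (1 v)
      then show ?thesis using end_comp_sub[OF S(3,1,2)] by (intro vtx[of v]) auto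
    next
      case (2 u v t)
      show ?thesis by (rule seg[of u v t]) (use 2 edgeD[OF 2(1)] in auto)
    next
      case (3 \<beta>)
      then show ?thesis by (rule End)
    qed
  qed
qed

lemma vtx_topspace: "v \<in> V \<Longrightarrow> Pt (vtx v) \<in> topspace FX"
  using openin_subset[OF openin_star[of v 1]] by auto

lemma seg_topspace: "{u, v} \<in> E \<Longrightarrow> 0 < t \<Longrightarrow> t < 1 \<Longrightarrow> Pt (seg u v t) \<in> topspace FX"
  using openin_subset[OF openin_edge[of u v 0 1]] by auto

lemma end_nbhd_self:
  assumes "finite S" "S \<subseteq> V" "\<alpha> \<in> ends V E" shows "EndPt \<alpha> \<in> end_nbhd V E S \<alpha>"
proof -
  obtain R where "R \<in> \<alpha>" using end_nonempty assms by blast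
  then have "\<exists>R\<in>\<alpha>. has_tail_in R (end_comp V E S \<alpha>)" using end_comp_tail[OF assms(3,1,2)] by blast
  then show ?thesis using assms by (auto simp: end_nbhd_def Let_def)
qed

lemma End_topspace: "\<alpha> \<in> ends V E \<Longrightarrow> EndPt \<alpha> \<in> topspace FX"
  using openin_subset[OF openin_end_nbhd[of "{}" \<alpha>]] end_nbhd_self[of "{}" \<alpha>] by auto

lemma bary_bounds:
  assumes "x \<in> topspace FX" shows "0 \<le> bary x v" "bary x v \<le> 1"
  using assms by (cases rule: topspace_cases; simp add: bary_seg)+

lemma bary_pos_V: "x \<in> topspace FX \<Longrightarrow> bary x v > 0 \<Longrightarrow> v \<in> V"
  by (erule topspace_cases) (auto simp: bary_seg dest: edgeD split: if_splits)

lemma bary_1_iff: "x \<in> topspace FX \<Longrightarrow> bary x v = 1 \<longleftrightarrow> x = Pt (vtx v)"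
proof (erule topspace_cases)
  fix u w t assume *: "{u, w} \<in> E" "u \<noteq> w" "0 < t" "t < 1" "x = Pt (seg u w t)"
  have "bary x u < 1" using * by (simp add: bary_seg)
  moreover have "bary x w < 1" using * by (simp add: bary_seg)
  moreover have "bary x v = 1 \<longrightarrow> v = u \<or> v = w" using * by (simp add: bary_seg)
  moreover have "bary (Pt (vtx v)) v = 1" by simp
  ultimately show ?thesis by (metis less_irrefl)
qed auto

lemma bary_two:
  assumes x: "x \<in> topspace FX" and pos: "bary x u > 0" "bary x v > 0" and uv: "u \<noteq> v"
  shows "{u, v} \<in> E" "x = Pt (seg u v (bary x v))" "bary x u + bary x v = 1"
    "w \<noteq> u \<Longrightarrow> w \<noteq> v \<Longrightarrow> bary x w = 0"
proof -
  have "{u, v} \<in> E \<and> x = Pt (seg u v (bary x v)) \<and> bary x u + bary x v = 1 \<and>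
    (w \<noteq> u \<longrightarrow> w \<noteq> v \<longrightarrow> bary x w = 0)"
    using x
  proof (cases rule: topspace_cases)
    case (seg a b t)
    then have "a = u \<and> b = v \<or> a = v \<and> b = u"
      using pos uv by (auto simp: bary_seg split: if_splits)
    then show ?thesis
    proof
      assume "a = u \<and> b = v"
      then show ?thesis using seg by (auto simp: bary_seg)
    next
      assume "a = v \<and> b = u"
      then show ?thesis using seg seg_swap[of u v]
        by (auto simp: bary_seg insert_commute)
    qed
  qed (use pos uv in \<open>auto split: if_splits\<close>)
  then show "{u, v} \<in> E" "x = Pt (seg u v (bary x v))" "bary x u + bary x v = 1"
    "w \<noteq> u \<Longrightarrow> w \<noteq> v \<Longrightarrow> bary x w = 0" by auto
qed

lemma bary_pos_cases:
  assumes x: "x \<in> topspace FX" and pos: "bary x v > 0"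
  obtains (vtx) "x = Pt (vtx v)" | (seg) w where "w \<noteq> v" "{v, w} \<in> E" "bary x w > 0" "x = Pt (seg v w (bary x w))"
proof (cases "x = Pt (vtx v)")
  case False
  have "\<exists>w. w \<noteq> v \<and> bary x w > 0"
    using x
  proof (cases rule: topspace_cases)
    case (seg a b t)
    then have "v = a \<or> v = b" using pos by (auto simp: bary_seg split: if_splits)
    then show ?thesis using seg
      by (metis bary_seg diff_gt_0_iff_gt)
  qed (use pos False in \<open>auto split: if_splits\<close>)
  then obtain w where "w \<noteq> v" "bary x w > 0" by blast
  then show thesis using seg bary_two[OF x pos, of w] by metis
qed (rule vtx)

lemma bary_end_iff: "x \<in> topspace FX \<Longrightarrow> (\<forall>v\<in>V. bary x v = 0) \<longleftrightarrow> (\<exists>\<beta>\<in>ends V E. x = EndPt \<beta>)"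
proof (erule topspace_cases)
  fix u w t assume *: "{u, w} \<in> E" "u \<noteq> w" "0 < t" "t < 1" "x = Pt (seg u w t)"
  then have "w \<in> V" "bary x w \<noteq> 0" using edgeD by (auto simp: bary_seg)
  then show ?thesis using * by auto
next
  fix v assume "v \<in> V" "x = Pt (vtx v)"
  moreover have "bary (Pt (vtx v)) v \<noteq> 0" by simp
  ultimately show ?thesis by blast
qed auto

lemma point_eqI:
  assumes x: "x \<in> topspace FX" and y: "y \<in> topspace FX" and pos: "bary x v > 0"
    and eq: "\<And>w. bary x w = bary y w"
  shows "x = y"
  using x pos
proof (cases rule: bary_pos_cases)
  case vtx
  then show ?thesis using bary_1_iff[OF x, of v] bary_1_iff[OF y, of v] eq[of v] by metis
next
  case (seg w)
  then show ?thesis using bary_two(2)[OF y, of v w] eq pos by simp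
qed

text \<open>Vertices and inner points of edges are treated alike: both belong to the neighbourhood
  iff some vertex of the component has a positive coordinate, which is an open condition.\<close>

lemma end_nbhd_iff:
  assumes S: "finite S" "S \<subseteq> V" and \<alpha>: "\<alpha> \<in> ends V E"
  shows "x \<in> end_nbhd V E S \<alpha> \<longleftrightarrow> x \<in> topspace FX \<and>
    ((\<exists>v\<in>end_comp V E S \<alpha>. bary x v > 0) \<or>
     (\<exists>\<beta>\<in>ends V E. x = EndPt \<beta> \<and> (\<exists>R\<in>\<beta>. has_tail_in R (end_comp V E S \<alpha>))))"
proof -
  let ?C = "end_comp V E S \<alpha>"
  have CV: "?C \<subseteq> V" using end_comp_sub[OF \<alpha> S] by blast
  show ?thesis
  proof
    assume x: "x \<in> end_nbhd V E S \<alpha>"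
    then have t: "x \<in> topspace FX" using openin_subset[OF openin_end_nbhd[OF S \<alpha>]] by blast
    from x consider v where "v \<in> ?C" "x = Pt (vtx v)"
      | u v t where "{u, v} \<in> E" "u \<in> ?C" "0 < t" "t < 1" "x = Pt (seg u v t)"
      | \<beta> where "\<beta> \<in> ends V E" "\<exists>R\<in>\<beta>. has_tail_in R ?C" "x = EndPt \<beta>"
      unfolding end_nbhd_def Let_def by blast
    then show "x \<in> topspace FX \<and> ((\<exists>v\<in>?C. bary x v > 0) \<or>
      (\<exists>\<beta>\<in>ends V E. x = EndPt \<beta> \<and> (\<exists>R\<in>\<beta>. has_tail_in R ?C)))"
    proof cases
      case 1
      then have "bary x v > 0" by simp
      with 1 t show ?thesis by blast
    next
      case 2
      then have "bary x u > 0" by (simp add: bary_seg)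
      with 2 t show ?thesis by blast
    qed (use t in blast)
  next
    assume *: "x \<in> topspace FX \<and> ((\<exists>v\<in>?C. bary x v > 0) \<or>
      (\<exists>\<beta>\<in>ends V E. x = EndPt \<beta> \<and> (\<exists>R\<in>\<beta>. has_tail_in R ?C)))"
    then consider v where "v \<in> ?C" "bary x v > 0" | \<beta> where "\<beta> \<in> ends V E" "\<exists>R\<in>\<beta>. has_tail_in R ?C" "x = EndPt \<beta>"
      by blast
    then show "x \<in> end_nbhd V E S \<alpha>"
    proof cases
      case 1
      have xt: "x \<in> topspace FX" using * by blast
      show ?thesis using xt 1(2)
      proof (cases rule: bary_pos_cases)
        case vtx
        then show ?thesis using 1 by (auto simp: end_nbhd_def Let_def)
      next
        case (seg w)
        then have "bary x w < 1" using bary_two(3)[OF xt 1(2) seg(3)] 1(2) by auto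
        then show ?thesis unfolding end_nbhd_def Let_def using seg 1(1) by blast
      qed
    qed (auto simp: end_nbhd_def Let_def)
  qed
qed

section \<open>Coordinates, continuity criterion and Hausdorff property\<close>

lemma bary_continuous:
  assumes v: "v \<in> V"
  shows "continuous_map FX euclideanreal (\<lambda>x. bary x v)"
proof (rule continuous_map_realI)
  fix x and e :: real assume x: "x \<in> topspace FX" and e: "e > 0"
  let ?e = "min e 1"
  have e': "0 < ?e" "?e \<le> 1" "?e \<le> e" using e by auto
  from x show "\<exists>U. openin FX U \<and> x \<in> U \<and> (\<forall>y\<in>U. \<bar>bary y v - bary x v\<bar> < e)"
  proof (cases rule: topspace_cases)
    case (vtx w)
    let ?U = "insert (Pt (vtx w)) {Pt (seg w z t) | z t. {w, z} \<in> E \<and> 0 < t \<and> t < ?e}"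
    have "\<bar>bary y v - bary x v\<bar> < e" if "y \<in> ?U" for y
    proof -
      from that consider "y = x" | z t where "y = Pt (seg w z t)" "{w, z} \<in> E" "0 < t" "t < ?e" using vtx by blast
      then show ?thesis
      proof cases
        case 2
        then show ?thesis using vtx e' edgeD[of w z] by (auto simp: bary_seg)
      qed (use e in simp)
    qed
    then show ?thesis using openin_star[OF vtx(1) e'(1,2)] vtx by blast
  next
    case (seg u w t)
    let ?a = "max 0 (t - e)" and ?b = "min 1 (t + e)"
    let ?U = "{Pt (seg u w s) | s. ?a < s \<and> s < ?b}"
    have "x \<in> ?U" using seg e by auto
    moreover have "openin FX ?U" using seg e by (intro openin_edge) auto
    moreover have "\<bar>bary y v - bary x v\<bar> < e" if "y \<in> ?U" for y
      using that seg e by (auto simp: bary_seg)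
    ultimately show ?thesis by blast
  next
    case (End \<beta>)
    \<comment> \<open>Removing \<open>v\<close> alone is not enough: inner points of edges from
      \<open>v\<close> into the component would lie in the neighbourhood and have a positive
      coordinate at \<open>v\<close>.\<close>
    have S: "finite (nbhd {v})" "nbhd {v} \<subseteq> V" using v nbhd_finite nbhd_sub by auto
    let ?U = "end_nbhd V E (nbhd {v}) \<beta>"
    have "bary y v = 0" if y: "y \<in> ?U" for y
    proof (rule ccontr)
      assume nz: "bary y v \<noteq> 0"
      have yt: "y \<in> topspace FX" using y end_nbhd_iff[OF S End(1)] by blast
      have pos: "bary y v > 0" using nz bary_bounds(1)[OF yt, of v] by simp
      then obtain u where u: "u \<in> end_comp V E (nbhd {v}) \<beta>" "bary y u > 0"
        using y end_nbhd_iff[OF S End(1)] by auto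
      have "u \<notin> nbhd {v}" using u end_comp_sub[OF End(1) S] by blast
      moreover have "u = v \<or> {v, u} \<in> E" using bary_two(1)[OF yt pos u(2)] by blast
      ultimately show False by (auto simp: nbhd_def)
    qed
    then show ?thesis using openin_end_nbhd[OF S End(1)] end_nbhd_self[OF S End(1)] End(2) e
      by (intro exI[of _ ?U]) auto
  qed
qed

text \<open>Basic open sets at edges and vertices are conditions on coordinates, so only points
  mapped to ends need extra care. There it suffices to test neighbourhoods of the end
  \<open>\<beta>\<close> itself: if \<open>\<beta>\<close> lies in the neighbourhood of another end
  for \<open>S\<close>, both ends have the same component and hence the same neighbourhood for
  \<open>S\<close>.\<close>

lemma continuous_map_freudenthalI:
  assumes into: "\<And>x. x \<in> topspace X \<Longrightarrow> f x \<in> topspace FX"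
    and bary: "\<And>v. v \<in> V \<Longrightarrow> continuous_map X euclideanreal (\<lambda>x. bary (f x) v)"
    and ends: "\<And>x \<beta> S. x \<in> topspace X \<Longrightarrow> f x = EndPt \<beta> \<Longrightarrow> finite S \<Longrightarrow> S \<subseteq> V \<Longrightarrow>
      \<exists>U. openin X U \<and> x \<in> U \<and> f ` U \<subseteq> end_nbhd V E S \<beta>"
  shows "continuous_map X FX f"
  unfolding freudenthal_def continuous_on_generated_topo_iff
proof (intro conjI allI impI)
  have op: "openin X {x \<in> topspace X. bary (f x) v \<in> W}" if "v \<in> V" "open W" for v and W :: "real set"
    using bary[OF that(1)] that(2) by (auto simp: continuous_map_def)
  fix B assume "B \<in> edge_open_sets E \<union> vertex_open_sets V E \<union> end_open_sets V E"
  then consider u v a b where "{u, v} \<in> E" "0 \<le> a" "a < b" "b \<le> 1" "B = {Pt (seg u v t) | t. a < t \<and> t < b}"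
    | v e where "v \<in> V" "0 < e" "e \<le> 1" "B = insert (Pt (vtx v)) {Pt (seg v w t) | w t. {v, w} \<in> E \<and> 0 < t \<and> t < e}"
    | S \<alpha> where "finite S" "S \<subseteq> V" "\<alpha> \<in> ends V E" "B = end_nbhd V E S \<alpha>"
    unfolding edge_open_sets_def vertex_open_sets_def end_open_sets_def by blast
  then show "openin X (f -` B \<inter> topspace X)"
  proof cases
    case (1 u v a b)
    have uv: "u \<in> V" "v \<in> V" "u \<noteq> v" using edgeD 1 by auto
    have "f -` B \<inter> topspace X = {x \<in> topspace X. bary (f x) u \<in> {0<..}} \<inter> {x \<in> topspace X. bary (f x) v \<in> {a<..<b}}"
    proof (intro equalityI subsetI)
      fix x assume "x \<in> f -` B \<inter> topspace X"
      then obtain t where "x \<in> topspace X" "f x = Pt (seg u v t)" "a < t" "t < b" using 1 by auto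
      then show "x \<in> {x \<in> topspace X. bary (f x) u \<in> {0<..}} \<inter> {x \<in> topspace X. bary (f x) v \<in> {a<..<b}}"
        using 1 uv by (simp add: bary_seg)
    next
      fix x assume x: "x \<in> {x \<in> topspace X. bary (f x) u \<in> {0<..}} \<inter> {x \<in> topspace X. bary (f x) v \<in> {a<..<b}}"
      then obtain t where t: "t = bary (f x) v" "a < t" "t < b" by auto
      have "f x = Pt (seg u v t)"
        unfolding t(1) using x 1(2) uv by (intro bary_two(2)[OF into]) auto
      then have "f x \<in> B" unfolding 1(5) using t(2,3) by blast
      then show "x \<in> f -` B \<inter> topspace X" using x by auto
    qed
    then show ?thesis using op[OF uv(1), of "{0<..}"] op[OF uv(2), of "{a<..<b}"] by auto
  next
    case (2 v e)
    have "f -` B \<inter> topspace X = {x \<in> topspace X. bary (f x) v \<in> {1-e<..}}"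
    proof (intro equalityI subsetI)
      fix x assume "x \<in> f -` B \<inter> topspace X"
      then consider "x \<in> topspace X" "f x = Pt (vtx v)" | w t where "x \<in> topspace X" "f x = Pt (seg v w t)" "t < e" using 2 by auto
      then show "x \<in> {x \<in> topspace X. bary (f x) v \<in> {1-e<..}}"
        by cases (use 2 in \<open>auto simp: bary_seg\<close>)
    next
      fix x assume x: "x \<in> {x \<in> topspace X. bary (f x) v \<in> {1-e<..}}"
      then have xt: "f x \<in> topspace FX" and pos: "bary (f x) v > 0" using into 2 by auto
      then show "x \<in> f -` B \<inter> topspace X"
      proof (cases rule: bary_pos_cases)
        case (seg w)
        have "bary (f x) v + bary (f x) w = 1" using bary_two(3)[OF xt pos seg(3)] seg(1) by blast
        moreover have "1 - e < bary (f x) v" using x by simp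
        ultimately have "bary (f x) w < e" by linarith
        then have "f x \<in> B" unfolding 2(4) using seg(2-4) by blast
        then show ?thesis using x by blast
      qed (use 2 x in auto)
    qed
    then show ?thesis using op[OF 2(1), of "{1-e<..}"] by auto
  next
    case (3 S \<alpha>)
    show ?thesis
      unfolding openin_subopen[of X "f -` B \<inter> topspace X"]
    proof
      fix x assume x: "x \<in> f -` B \<inter> topspace X"
      then have "f x \<in> end_nbhd V E S \<alpha>" using 3 by auto
      then consider v where "v \<in> end_comp V E S \<alpha>" "bary (f x) v > 0" 
        | \<beta> R where "\<beta> \<in> ends V E" "f x = EndPt \<beta>" "R \<in> \<beta>" "has_tail_in R (end_comp V E S \<alpha>)"
        unfolding end_nbhd_iff[OF 3(1-3)] by blast
      then show "\<exists>T. openin X T \<and> x \<in> T \<and> T \<subseteq> f -` B \<inter> topspace X"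
      proof cases
        case (1 v)
        have "v \<in> V" using end_comp_sub[OF 3(3,1,2)] 1 by blast
        then have "openin X {x \<in> topspace X. bary (f x) v \<in> {0<..}}" by (rule op) simp
        moreover have "{x \<in> topspace X. bary (f x) v \<in> {0<..}} \<subseteq> f -` B \<inter> topspace X"
          using 1(1) into unfolding 3(4) by (auto simp: end_nbhd_iff[OF 3(1-3)])
        ultimately show ?thesis using 1 x by blast
      next
        case (2 \<beta> R)
        have "end_comp V E S \<beta> = end_comp V E S \<alpha>" using end_comp_eq[OF 3(3) 2(1) 3(1,2) 2(3,4)] .
        then have "end_nbhd V E S \<beta> = B" unfolding 3(4) end_nbhd_def by simp
        then obtain U where U: "openin X U" "x \<in> U" "f ` U \<subseteq> B" using ends[OF _ 2(2) 3(1,2)] x by blast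
        then show ?thesis using openin_subset[OF U(1)] by blast
      qed
    qed
  qed
next
  show "f ` topspace X \<subseteq> \<Union> (edge_open_sets E \<union> vertex_open_sets V E \<union> end_open_sets V E)"
    using into by (simp add: freudenthal_def image_subset_iff)
qed

text \<open>For one and the same \<open>S\<close> these are different components, and no edge joins
  them, so inner points of edges cannot lie in both neighbourhoods either.\<close>

lemma end_nbhd_disjoint:
  assumes "\<alpha> \<in> ends V E" "\<beta> \<in> ends V E"
    and S: "finite S" "S \<subseteq> V" "end_comp V E S \<alpha> \<inter> end_comp V E S \<beta> = {}"
  shows "end_nbhd V E S \<alpha> \<inter> end_nbhd V E S \<beta> = {}"
proof (rule equals0I)
  fix x assume "x \<in> end_nbhd V E S \<alpha> \<inter> end_nbhd V E S \<beta>"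
    then have x: "x \<in> end_nbhd V E S \<alpha>" "x \<in> end_nbhd V E S \<beta>" by auto
    have xt: "x \<in> topspace FX" using x end_nbhd_iff[OF S(1,2) assms(1)] by blast
    show False
    proof (cases "\<exists>\<gamma>. x = EndPt \<gamma>")
      case True
      then obtain \<gamma> R R' where "\<gamma> \<in> ends V E" "R \<in> \<gamma>" "has_tail_in R (end_comp V E S \<alpha>)" "R' \<in> \<gamma>" "has_tail_in R' (end_comp V E S \<beta>)"
        using x unfolding end_nbhd_iff[OF S(1,2) assms(1)] end_nbhd_iff[OF S(1,2) assms(2)] by auto
      then have "end_comp V E S \<alpha> = end_comp V E S \<beta>"
        using end_comp_eq[OF assms(1) _ S(1,2)] end_comp_eq[OF assms(2) _ S(1,2)] by metis
      moreover have "end_comp V E S \<alpha> \<noteq> {}"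
        using end_comp_component[OF assms(1) S(1,2)] comp_of_self by (fastforce simp: components_def)
      ultimately show False using S by blast
    next
      case False
      then obtain u v where uv: "u \<in> end_comp V E S \<alpha>" "bary x u > 0" "v \<in> end_comp V E S \<beta>" "bary x v > 0"
        using x unfolding end_nbhd_iff[OF S(1,2) assms(1)] end_nbhd_iff[OF S(1,2) assms(2)] by blast
      then have "u \<noteq> v" using S by blast
      then have "{u, v} \<in> E" using bary_two(1)[OF xt uv(2,4)] by blast
      moreover have "v \<notin> S" using uv end_comp_sub[OF assms(2) S(1,2)] by blast
      ultimately have "v \<in> end_comp V E S \<alpha>"
        using components_step[OF end_comp_component[OF assms(1) S(1,2)] uv(1)] by blast
      then show False using uv S by blast
    qed
  qed

lemma ends_separate_nbhd:
  assumes "\<alpha> \<in> ends V E" "\<beta> \<in> ends V E" "\<alpha> \<noteq> \<beta>"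
  obtains S where "finite S" "S \<subseteq> V" "end_comp V E S \<alpha> \<inter> end_comp V E S \<beta> = {}"
    "end_nbhd V E S \<alpha> \<inter> end_nbhd V E S \<beta> = {}"
  using ends_separate[OF assms] end_nbhd_disjoint[OF assms(1,2)] by metis

lemma bary_separated:
  assumes x: "x \<in> topspace FX" and y: "y \<in> topspace FX" and "\<not> (\<exists>\<alpha>. x = EndPt \<alpha>)" "x \<noteq> y"
  obtains v where "v \<in> V" "bary x v \<noteq> bary y v"
proof -
  obtain v where v: "v \<in> V" "bary x v \<noteq> 0" using assms(3) bary_end_iff[OF x] by blast
  then have pos: "bary x v > 0" using bary_bounds(1)[OF x, of v] by simp
  then obtain w where w: "bary x w \<noteq> bary y w" using point_eqI[OF x y pos] assms(4) by blast
  have "w \<in> V"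
  proof (rule ccontr)
    assume "w \<notin> V"
    then have "bary x w = 0" "bary y w = 0"
      using bary_pos_V[OF x] bary_pos_V[OF y] bary_bounds(1)[OF x, of w] bary_bounds(1)[OF y, of w]
      by (auto simp: order_le_less)
    with w show False by simp
  qed
  with w that show thesis by blast
qed

text \<open>Two ends are separated by a finite vertex set; in any other pair of points some
  coordinate differs. Together with compactness of the circle this turns continuous injections into
  embeddings.\<close>

lemma Hausdorff_freudenthal: "Hausdorff_space FX"
  unfolding Hausdorff_space_def
proof (intro allI impI)
  fix x y assume xy: "x \<in> topspace FX \<and> y \<in> topspace FX \<and> x \<noteq> y"
  show "\<exists>U W. openin FX U \<and> openin FX W \<and> x \<in> U \<and> y \<in> W \<and> disjnt U W"
  proof (cases "\<exists>\<alpha> \<beta>. x = EndPt \<alpha> \<and> y = EndPt \<beta>")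
    case True
    then obtain \<alpha> \<beta> where ab: "x = EndPt \<alpha>" "y = EndPt \<beta>" "\<alpha> \<in> ends V E" "\<beta> \<in> ends V E" "\<alpha> \<noteq> \<beta>"
      using xy bary_end_iff[of x] bary_end_iff[of y] by auto
    obtain S where S: "finite S" "S \<subseteq> V" "end_nbhd V E S \<alpha> \<inter> end_nbhd V E S \<beta> = {}"
      using ends_separate_nbhd[OF ab(3-5)] by metis
    show ?thesis
      by (intro exI[of _ "end_nbhd V E S \<alpha>"] exI[of _ "end_nbhd V E S \<beta>"])
        (simp add: openin_end_nbhd end_nbhd_self S ab disjnt_def)
  next
    case False
    then obtain v where v: "v \<in> V" "bary x v \<noteq> bary y v"
      using bary_separated[of x y] bary_separated[of y x] xy by metis
    obtain A B where AB: "open A" "open B" "bary x v \<in> A" "bary y v \<in> B" "A \<inter> B = {}"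
      using hausdorff[OF v(2)] by blast
    have "openin FX {z \<in> topspace FX. bary z v \<in> A}" "openin FX {z \<in> topspace FX. bary z v \<in> B}"
      using bary_continuous[OF v(1)] AB by (auto simp: continuous_map_def)
    then show ?thesis
      by (intro exI[of _ "{z \<in> topspace FX. bary z v \<in> A}"] exI[of _ "{z \<in> topspace FX. bary z v \<in> B}"])
        (use xy AB in \<open>auto simp: disjnt_def\<close>)
  qed
qed

end

subsection \<open>Hamiltonian loops\<close>

lemma connectedin_split:
  assumes "openin X A" "openin X B" "A \<inter> B = {}" "x \<in> A" "y \<in> B" "S \<subseteq> A \<union> B" "connectedin X S" "x \<in> S" "y \<in> S"
  shows False
proof -
  have "A \<inter> B \<inter> S = {}" "A \<inter> S \<noteq> {}" "B \<inter> S \<noteq> {}" using assms by blast+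
  with assms(1,2,6,7) show False unfolding connectedin by blast
qed

text \<open>A Hamiltonian curve cut open at \<open>v0\<close>. Any other vertex has the single time
  \<open>tm v\<close>, whereas \<open>v0\<close> is met at both 0 and 1; hence the recurring
  condition \<open>v \<noteq> v0\<close>.\<close>

locale ham_loop = lfgraph V E for V :: "'v set" and E +
  fixes \<gamma> :: "real \<Rightarrow> 'v fpoint" and v0 :: 'v and tm :: "'v \<Rightarrow> real"
  assumes infV: "infinite V"
    and cont: "continuous_map (top_of_set {0..1}) (freudenthal V E) \<gamma>"
    and v0: "v0 \<in> V" and \<gamma>0: "\<gamma> 0 = Pt (vtx v0)" and \<gamma>1: "\<gamma> 1 = Pt (vtx v0)"
    and tm: "\<And>v. v \<in> V \<Longrightarrow> v \<noteq> v0 \<Longrightarrow> 0 < tm v \<and> tm v < 1 \<and> \<gamma> (tm v) = Pt (vtx v)"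
    and tm_unique: "\<And>t v. t \<in> {0..1} \<Longrightarrow> \<gamma> t = Pt (vtx v) \<Longrightarrow> v \<noteq> v0 \<Longrightarrow> t = tm v"
    and v0_unique: "\<And>t. t \<in> {0..1} \<Longrightarrow> \<gamma> t = Pt (vtx v0) \<Longrightarrow> t = 0 \<or> t = 1"
begin

definition b :: "'v \<Rightarrow> real \<Rightarrow> real" where "b v t = bary (\<gamma> t) v"

definition Tm :: "real set" where "Tm = {t \<in> {0..1}. \<exists>v\<in>V. \<gamma> t = Pt (vtx v)}"

lemma \<gamma>_top: "t \<in> {0..1} \<Longrightarrow> \<gamma> t \<in> topspace FX"
  using cont by (auto simp: continuous_map_def Pi_iff)

lemma b_bounds: "t \<in> {0..1} \<Longrightarrow> 0 \<le> b v t" "t \<in> {0..1} \<Longrightarrow> b v t \<le> 1"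
  unfolding b_def using bary_bounds[OF \<gamma>_top] by auto

lemma b_cont: "v \<in> V \<Longrightarrow> continuous_on {0..1} (b v)"
  using continuous_map_compose[OF cont bary_continuous] by (simp add: b_def[abs_def] o_def)

lemma b_V: "t \<in> {0..1} \<Longrightarrow> b v t > 0 \<Longrightarrow> v \<in> V"
  unfolding b_def using bary_pos_V[OF \<gamma>_top] by blast

lemma b_two:
  assumes "t \<in> {0..1}" "b x t > 0" "b y t > 0" "x \<noteq> y"
  shows "{x, y} \<in> E" "\<gamma> t = Pt (seg x y (b y t))" "b x t + b y t = 1" "w \<noteq> x \<Longrightarrow> w \<noteq> y \<Longrightarrow> b w t = 0"
  using bary_two[OF \<gamma>_top[OF assms(1)]] assms unfolding b_def by blast+

lemma b_1: "t \<in> {0..1} \<Longrightarrow> b v t = 1 \<longleftrightarrow> \<gamma> t = Pt (vtx v)"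
  unfolding b_def by (rule bary_1_iff[OF \<gamma>_top])

lemma b_open:
  assumes "v \<in> V" "t \<in> {0..1}" "b v t > c"
  obtains d where "d > 0" "\<And>s. s \<in> {0..1} \<Longrightarrow> \<bar>s - t\<bar> < d \<Longrightarrow> b v s > c"
proof -
  obtain d where d: "d > 0" "\<And>s. s \<in> {0..1} \<Longrightarrow> dist s t < d \<Longrightarrow> dist (b v s) (b v t) < b v t - c"
    using b_cont[OF assms(1)] assms(2,3) unfolding continuous_on_iff by (metis diff_gt_0_iff_gt)
  have "b v s > c" if "s \<in> {0..1}" "\<bar>s - t\<bar> < d" for s
    using d(2)[OF that(1)] that(2) by (auto simp: dist_real_def abs_if split: if_splits)
  with d(1) that show thesis by blast
qed

lemma vertex_b: "\<gamma> t = Pt (vtx v) \<Longrightarrow> b w t = (if w = v then 1 else 0)"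
  by (simp add: b_def)

lemma vertex_single: "\<gamma> t = Pt (vtx v) \<Longrightarrow> b x t > 0 \<Longrightarrow> x = v"
  by (simp add: b_def split: if_splits)

lemma Tm_single: "t \<in> Tm \<Longrightarrow> b x t > 0 \<Longrightarrow> b y t > 0 \<Longrightarrow> x = y"
  unfolding Tm_def using vertex_single by blast

lemma Tm_01: "t \<in> Tm \<Longrightarrow> 0 \<le> t" "t \<in> Tm \<Longrightarrow> t \<le> 1" "0 \<in> Tm" "1 \<in> Tm"
  using \<gamma>0 \<gamma>1 v0 by (auto simp: Tm_def)

lemma tm_Tm: "v \<in> V \<Longrightarrow> v \<noteq> v0 \<Longrightarrow> tm v \<in> Tm"
  using tm[of v] by (auto simp: Tm_def)

lemma Tm_cases:
  assumes "t \<in> Tm" obtains "t = 0" | "t = 1" | v where "v \<in> V" "v \<noteq> v0" "t = tm v"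
  using assms tm_unique v0_unique unfolding Tm_def by blast

lemma other_vertex:
  assumes "finite X" obtains w where "w \<in> V" "w \<notin> X" "w \<noteq> v0"
proof -
  have "infinite (V - insert v0 X)" using infV assms by simp
  then obtain w where "w \<in> V - insert v0 X" by (metis finite.emptyI ex_in_conv)
  with that show thesis by blast
qed

text \<open>One traversal of the edge, from \<open>x\<close> at time \<open>l\<close> to
  \<open>y\<close> at time \<open>r\<close>. In between the loop may turn back and forth, but it
  meets no vertex.\<close>

definition edge_int :: "'v \<Rightarrow> 'v \<Rightarrow> real \<Rightarrow> real \<Rightarrow> bool" where
  "edge_int x y l r \<longleftrightarrow> 0 \<le> l \<and> l < r \<and> r \<le> 1 \<and> x \<noteq> y \<and> \<gamma> l = Pt (vtx x) \<and> \<gamma> r = Pt (vtx y) \<and>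
    x \<in> V \<and> y \<in> V \<and> {x, y} \<in> E \<and> (\<forall>s\<in>{l<..<r}. b x s > 0 \<and> b y s > 0)"

text \<open>The traversal is the maximal open interval around \<open>t\<close> on which both
  coordinates are positive. Their sum is 1 on its closure, so at both boundary times the loop is at
  \<open>x\<close> or \<open>y\<close>. It is not at the same vertex twice: only \<open>v0\<close>
  has two times, 0 and 1, and then a third vertex would be met inside the edge.\<close>

lemma edge_interval:
  assumes t: "t \<in> {0..1}" and xy: "x \<noteq> y" and pos: "b x t > 0" "b y t > 0"
  obtains l r where "l < t" "t < r" "edge_int x y l r \<or> edge_int y x l r"
proof -
  have V: "x \<in> V" "y \<in> V" using b_V t pos by auto
  have E: "{x, y} \<in> E" using b_two(1)[OF t pos xy] .
  let ?K = "{s \<in> {0..1}. b x s \<le> 0 \<or> b y s \<le> 0}"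
  have cl: "closed {s \<in> {0..1}. b x s \<le> 0}" "closed {s \<in> {0..1}. b y s \<le> 0}"
    by (intro continuous_on_closed_Collect_le b_cont V continuous_on_const closed_atLeastAtMost)+
  have K_eq: "?K = {s \<in> {0..1}. b x s \<le> 0} \<union> {s \<in> {0..1}. b y s \<le> 0}" by blast
  have cK: "closed ?K" unfolding K_eq by (rule closed_Un[OF cl])
  have cp: "compact (?K \<inter> A)" if "closed A" for A
  proof -
    have eq: "?K \<inter> A = {0..1} \<inter> (?K \<inter> A)" by blast
    show ?thesis
      by (subst eq) (rule compact_Int_closed[OF compact_Icc closed_Int[OF cK that]])
  qed
  have tK: "t \<notin> ?K" using pos by auto
  have K01: "0 \<in> ?K" "1 \<in> ?K" using vertex_b[OF \<gamma>0] vertex_b[OF \<gamma>1] xy by auto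
  have ne: "?K \<inter> {..t} \<noteq> {}" "?K \<inter> {t..} \<noteq> {}"
    unfolding ex_in_conv[symmetric] using IntI[OF K01(1), of "{..t}"] IntI[OF K01(2), of "{t..}"] t
    by (metis atLeastAtMost_iff atLeast_iff atMost_iff)+
  have "compact (?K \<inter> {..t})" "?K \<inter> {..t} \<noteq> {}"
    using cp[OF closed_atMost] ne(1) by (blast, blast)
  then obtain l where l: "l \<in> ?K" "l \<le> t" and lmax: "\<And>s. s \<in> ?K \<Longrightarrow> s \<le> t \<Longrightarrow> s \<le> l"
    using compact_attains_sup[of "?K \<inter> {..t}"] by auto
  have "compact (?K \<inter> {t..})" "?K \<inter> {t..} \<noteq> {}"
    using cp[OF closed_atLeast] ne(2) by (blast, blast)
  then obtain r where r: "r \<in> ?K" "t \<le> r" and rmin: "\<And>s. s \<in> ?K \<Longrightarrow> t \<le> s \<Longrightarrow> r \<le> s"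
    using compact_attains_inf[of "?K \<inter> {t..}"] by auto
  have lt: "l < t" "t < r" using l r tK by (auto simp: order_le_less)
  have lr01: "0 \<le> l" "r \<le> 1" using l r by auto
  have inside: "b x s > 0 \<and> b y s > 0" if s: "s \<in> {l<..<r}" for s
  proof -
    have "s \<notin> ?K"
    proof
      assume "s \<in> ?K"
      then have "s \<le> l \<or> r \<le> s" using lmax[of s] rmin[of s] by linarith
      with s show False by simp
    qed
    with s lr01 show ?thesis by (simp add: not_le)
  qed
  have sum1: "b x s + b y s = 1" if "s \<in> {l..r}" for s
  proof (rule continuous_constant_on_closure[of "{l<..<r}" "\<lambda>s. b x s + b y s"])
    have "continuous_on {l..r} (b x)" "continuous_on {l..r} (b y)"
      using lr01 by (auto intro: continuous_on_subset[OF b_cont] V)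
    then show "continuous_on (closure {l<..<r}) (\<lambda>s. b x s + b y s)"
      using lt by (simp add: continuous_on_add)
    show "b x s + b y s = 1" if "s \<in> {l<..<r}" for s
      using b_two(3)[of s x y] inside[OF that] xy that lr01 by auto
    show "s \<in> closure {l<..<r}" using that lt by simp
  qed
  have ends: "\<gamma> s = Pt (vtx x) \<or> \<gamma> s = Pt (vtx y)" if "s \<in> ?K" "s \<in> {l..r}" for s
    using sum1[OF that(2)] b_1[of s x] b_1[of s y] b_bounds[of s x] b_bounds[of s y] that by fastforce
  have le: "\<gamma> l = Pt (vtx x) \<or> \<gamma> l = Pt (vtx y)" "\<gamma> r = Pt (vtx x) \<or> \<gamma> r = Pt (vtx y)"
    using ends[OF l(1)] ends[OF r(1)] lt by auto
  have "\<gamma> l \<noteq> \<gamma> r"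
  proof
    assume eq: "\<gamma> l = \<gamma> r"
    then obtain z where z: "\<gamma> l = Pt (vtx z)" "\<gamma> r = Pt (vtx z)" using le by metis
    show False
    proof (cases "z = v0")
      case True
      then have "l = 0" "r = 1" using v0_unique[of l] v0_unique[of r] z lt lr01 by auto
      obtain w where w: "w \<in> V" "w \<notin> {x, y}" "w \<noteq> v0" using other_vertex[of "{x, y}"] by blast
      then have "tm w \<in> {l<..<r}" "\<gamma> (tm w) = Pt (vtx w)" using tm[of w] \<open>l = 0\<close> \<open>r = 1\<close> by auto
      then show False using inside[of "tm w"] vertex_single[of "tm w" w x] w by auto
    next
      case False
      then show False using tm_unique[OF _ z(1)] tm_unique[OF _ z(2)] lt lr01 by auto
    qed
  qed
  then have "edge_int x y l r \<or> edge_int y x l r"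
    unfolding edge_int_def using le inside lt lr01 xy V E by (auto simp: insert_commute)
  with lt that show thesis by blast
qed

lemma edge_int_Tm: "edge_int x y l r \<Longrightarrow> l \<in> Tm \<and> r \<in> Tm"
  by (auto simp: edge_int_def Tm_def)

lemma edge_int_no_Tm: "edge_int x y l r \<Longrightarrow> s \<in> Tm \<Longrightarrow> s \<le> l \<or> r \<le> s"
  unfolding edge_int_def using Tm_single[of s x y] by (metis greaterThanLessThan_iff not_le)

lemma edge_int_pos:
  assumes "edge_int x y l r" "s \<in> {l..r}" "b w s > 0"
  shows "w = x \<or> w = y"
proof -
  have s: "s \<in> {0..1}" using assms by (auto simp: edge_int_def)
  consider "s = l" | "s = r" | "s \<in> {l<..<r}" using assms(2) by force
  then show ?thesis
  proof cases
    case 1 then show ?thesis using assms vertex_single[of l x w] by (auto simp: edge_int_def)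
  next
    case 2 then show ?thesis using assms vertex_single[of r y w] by (auto simp: edge_int_def)
  next
    case 3 then show ?thesis using assms b_two(4)[OF s, of x y w] by (auto simp: edge_int_def)
  qed
qed

lemma edge_int_sum:
  assumes "edge_int x y l r" "s \<in> {l..r}"
  shows "b x s + b y s = 1"
proof -
  have s: "s \<in> {0..1}" using assms by (auto simp: edge_int_def)
  consider "s = l" | "s = r" | "s \<in> {l<..<r}" using assms(2) by force
  then show ?thesis
    by cases (use assms b_two(3)[OF s, of x y] vertex_b in \<open>auto simp: edge_int_def\<close>)
qed

lemma end_iff: "t \<in> {0..1} \<Longrightarrow> (\<forall>v\<in>V. b v t = 0) \<longleftrightarrow> (\<exists>\<beta>\<in>ends V E. \<gamma> t = EndPt \<beta>)"
  unfolding b_def by (rule bary_end_iff[OF \<gamma>_top])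

lemma not_end_pos: "t \<in> {0..1} \<Longrightarrow> \<not> (\<exists>\<beta>\<in>ends V E. \<gamma> t = EndPt \<beta>) \<Longrightarrow> \<exists>v\<in>V. b v t > 0"
  using end_iff[of t] b_bounds(1)[of t] by (metis order_le_less)

lemma pos_cases:
  assumes "t \<in> {0..1}" "b v t > 0"
  obtains "\<gamma> t = Pt (vtx v)" "t \<in> Tm" | w l r where "w \<noteq> v" "b w t > 0" "l < t" "t < r" "edge_int v w l r \<or> edge_int w v l r"
proof -
  from \<gamma>_top[OF assms(1)] assms(2)[unfolded b_def] show thesis
  proof (cases rule: bary_pos_cases)
    case vtx
    then show thesis using that(1) assms b_V by (auto simp: Tm_def)
  next
    case (seg w)
    then have "w \<noteq> v" "b w t > 0" by (auto simp: b_def)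
    moreover obtain l r where "l < t" "t < r" "edge_int v w l r \<or> edge_int w v l r"
      using edge_interval[OF assms(1) _ assms(2) \<open>b w t > 0\<close>] \<open>w \<noteq> v\<close> by metis
    ultimately show thesis using that(2) by blast
  qed
qed

lemma end_nbhd_near:
  assumes "t \<in> {0..1}" "\<gamma> t = EndPt \<alpha>" "finite S" "S \<subseteq> V" "\<alpha> \<in> ends V E"
  obtains d where "d > 0" "\<And>s. s \<in> {0..1} \<Longrightarrow> \<bar>s - t\<bar> < d \<Longrightarrow> \<gamma> s \<in> end_nbhd V E S \<alpha>"
proof -
  have "openin (top_of_set {0..1}) {s \<in> {0..1}. \<gamma> s \<in> end_nbhd V E S \<alpha>}"
    using cont openin_end_nbhd[OF assms(3-5)] by (auto simp: continuous_map_def)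
  moreover have "t \<in> {s \<in> {0..1}. \<gamma> s \<in> end_nbhd V E S \<alpha>}" using assms end_nbhd_self by auto
  ultimately obtain d where "d > 0" "ball t d \<inter> {0..1} \<subseteq> {s \<in> {0..1}. \<gamma> s \<in> end_nbhd V E S \<alpha>}"
    unfolding openin_contains_ball by blast
  then show thesis by (intro that[of d]) (auto simp: ball_def dist_real_def abs_minus_commute)
qed

lemma \<gamma>_end: "t \<in> {0..1} \<Longrightarrow> \<gamma> t = EndPt \<alpha> \<Longrightarrow> \<alpha> \<in> ends V E"
  using \<gamma>_top[of t] by (auto elim: topspace_cases)

text \<open>A positive coordinate inside the interval puts it into an edge traversal, whose boundary
  times are vertex times. Otherwise all coordinates vanish and the loop runs through ends only. Two
  different ends are separated by a finite \<open>S\<close>, and the ends in the component of the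
  first and those in other components lie in disjoint open sets, so connectedness leaves a single
  end.\<close>

lemma no_vertex:
  assumes st: "0 \<le> s" "s < t" "t \<le> 1" and none: "\<forall>q\<in>Tm. q \<le> s \<or> t \<le> q"
  obtains (const) \<alpha> where "\<alpha> \<in> ends V E" "\<And>q. q \<in> {s..t} \<Longrightarrow> \<gamma> q = EndPt \<alpha>"
    | (edge) x y l r where "edge_int x y l r" "l \<le> s" "t \<le> r"
proof (cases "\<exists>q\<in>{s<..<t}. \<exists>v\<in>V. b v q > 0")
  case True
  then obtain q v where q: "q \<in> {s<..<t}" "b v q > 0" by blast
  have q01: "q \<in> {0..1}" using q st by auto
  from q01 q(2) show thesis
  proof (cases rule: pos_cases)
    case 1
    then show thesis using bspec[OF none, of q] q by auto
  next
    case (2 w l r)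
    then have "l \<in> Tm" "r \<in> Tm" using edge_int_Tm by blast+
    then have "l \<le> s" "t \<le> r" using bspec[OF none, of l] bspec[OF none, of r] 2 q by auto
    with 2 show thesis using edge by blast
  qed
next
  case False
  have zero: "b v q = 0" if v: "v \<in> V" and q: "q \<in> {s..t}" for v q
  proof (rule ccontr)
    assume "b v q \<noteq> 0"
    have q01: "q \<in> {0..1}" using q st by auto
    then have "b v q > 0" using b_bounds(1)[of q v] \<open>b v q \<noteq> 0\<close> by simp
    then obtain d where d: "d > 0" "\<And>q'. q' \<in> {0..1} \<Longrightarrow> \<bar>q' - q\<bar> < d \<Longrightarrow> b v q' > 0"
      using b_open[OF v q01] by metis
    \<comment> \<open>A time inside the open interval at distance less than \<open>d\<close> from
      \<open>q\<close>, on a side with room for it.\<close>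
    define q' where "q' = (if q < t then q + min (d/2) ((t - q)/2) else q - min (d/2) ((t - s)/2))"
    have "q' \<in> {s<..<t}" "\<bar>q' - q\<bar> < d"
      using q d(1) st by (auto simp: q'_def min_def field_simps)
    then show False using d(2)[of q'] False v st by auto
  qed
  have isend: "\<exists>\<beta>\<in>ends V E. \<gamma> q = EndPt \<beta>" if "q \<in> {s..t}" for q
    using end_iff[of q] zero that st by auto
  then obtain \<alpha> where \<alpha>: "\<alpha> \<in> ends V E" "\<gamma> s = EndPt \<alpha>" using st by fastforce
  have "\<gamma> q = EndPt \<alpha>" if q: "q \<in> {s..t}" for q
  proof (rule ccontr)
    assume neq: "\<gamma> q \<noteq> EndPt \<alpha>"
    obtain \<beta> where \<beta>: "\<beta> \<in> ends V E" "\<gamma> q = EndPt \<beta>" using isend[OF q] by blast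
    obtain S where S: "finite S" "S \<subseteq> V" "end_comp V E S \<alpha> \<inter> end_comp V E S \<beta> = {}"
      using ends_separate[OF \<alpha>(1) \<beta>(1)] neq \<beta> by blast
    let ?A = "end_nbhd V E S \<alpha>"
    let ?D = "{\<delta> \<in> ends V E. end_comp V E S \<alpha> \<inter> end_comp V E S \<delta> = {}}"
    let ?B = "\<Union>\<delta>\<in>?D. end_nbhd V E S \<delta>"
    have "openin FX ?A" "openin FX ?B" using openin_end_nbhd[OF S(1,2)] \<alpha> by auto
    moreover have "?A \<inter> ?B = {}" using end_nbhd_disjoint[OF \<alpha>(1) _ S(1,2)] by blast
    moreover have "\<gamma> s \<in> ?A" using end_nbhd_self[OF S(1,2) \<alpha>(1)] \<alpha>(2) by simp
    moreover have "\<gamma> q \<in> ?B" using end_nbhd_self[OF S(1,2) \<beta>(1)] \<beta> S(3) by auto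
    moreover have "\<gamma> ` {s..t} \<subseteq> ?A \<union> ?B"
    proof
      fix x assume "x \<in> \<gamma> ` {s..t}"
      then obtain q' where q': "q' \<in> {s..t}" "x = \<gamma> q'" by blast
      then obtain \<delta> where d: "\<delta> \<in> ends V E" "x = EndPt \<delta>" using isend[OF q'(1)] by auto
      show "x \<in> ?A \<union> ?B"
      proof (cases "end_comp V E S \<alpha> = end_comp V E S \<delta>")
        case True
        then have "end_nbhd V E S \<alpha> = end_nbhd V E S \<delta>" by (simp add: end_nbhd_def)
        then show ?thesis using end_nbhd_self[OF S(1,2) d(1)] d(2) by simp
      next
        case False
        then have "\<delta> \<in> ?D"
          using d components_eq[OF end_comp_component[OF \<alpha>(1) S(1,2)] end_comp_component[OF d(1) S(1,2)]] by blast
        then show ?thesis using end_nbhd_self[OF S(1,2) d(1)] d(2) by blast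
      qed
    qed
    moreover have "connectedin FX (\<gamma> ` {s..t})"
      by (rule connectedin_continuous_map_image[OF cont])
        (use st in \<open>auto simp: connectedin_subtopology\<close>)
    moreover have "\<gamma> s \<in> \<gamma> ` {s..t}" "\<gamma> q \<in> \<gamma> ` {s..t}" using q st by auto
    ultimately show False by (rule connectedin_split)
  qed
  with \<alpha>(1) show thesis by (rule const)
qed

text \<open>The coordinate of a vertex exceeds 1/2 on a nonempty open set of times, which contains a
  rational; two coordinates cannot both exceed 1/2 at one time.\<close>

lemma countable_V: "countable V"
proof -
  have "\<exists>q\<in>\<rat>. q \<in> {0..1} \<and> b v q > 1/2" if v: "v \<in> V - {v0}" for v
  proof -
    have t: "tm v \<in> {0..1}" "0 < tm v" "tm v < 1" "b v (tm v) > 1/2" using tm[of v] v by (auto simp: vertex_b)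
    then obtain d where d: "d > 0" "\<And>s. s \<in> {0..1} \<Longrightarrow> \<bar>s - tm v\<bar> < d \<Longrightarrow> b v s > 1/2"
      using b_open[of v "tm v" "1/2"] v by blast
    obtain q where "q \<in> \<rat>" "tm v < q" "q < min 1 (tm v + d)"
      using Rats_dense_in_real[of "tm v" "min 1 (tm v + d)"] d t by auto
    then show ?thesis using d t by (intro bexI[of _ q] conjI d(2)) auto
  qed
  then obtain q where q: "\<And>v. v \<in> V - {v0} \<Longrightarrow> q v \<in> \<rat> \<and> q v \<in> {0..1} \<and> b v (q v) > 1/2" by metis
  have "inj_on q (V - {v0})"
  proof (rule inj_onI, rule ccontr)
    fix v w assume vw: "v \<in> V - {v0}" "w \<in> V - {v0}" "q v = q w" "v \<noteq> w"
    then have "b v (q v) > 1/2" "b w (q v) > 1/2" "q v \<in> {0..1}" using q by metis+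
    then show False using b_two(3)[of "q v" v w] vw by auto
  qed
  moreover have "countable (q ` (V - {v0}))"
    by (rule countable_subset[OF _ countable_rat]) (use q in blast)
  ultimately have "countable (V - {v0})" by (rule countable_image_inj_on[rotated])
  then show ?thesis by (metis countable_insert insert_Diff v0)
qed

end

subsection \<open>Hamiltonian circles from loops visiting each end once\<close>

lemma cis_eq_pi:
  fixes p q :: real
  assumes "0 \<le> p" "p \<le> 2" "0 \<le> q" "q \<le> 2" "cis (pi * p) = cis (pi * q)"
  shows "p = q \<or> {p, q} = {0, 2}"
proof -
  have "sin (pi * p) = sin (pi * q) \<and> cos (pi * p) = cos (pi * q)"
    using assms(5) by (metis cis.sel)
  then obtain n :: int where "pi * p = pi * q + 2 * pi * n" unfolding sin_cos_eq_iff by blast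
  then have "pi * p = pi * (q + 2 * n)" by (simp add: algebra_simps)
  then have n: "p = q + 2 * real_of_int n" by simp
  then have "-1 \<le> real_of_int n" "real_of_int n \<le> 1" using assms(1-4) by linarith+
  then have "n = -1 \<or> n = 0 \<or> n = 1" by linarith
  then show ?thesis using n assms(1-4) by (elim disjE) (auto simp: doubleton_eq_iff)
qed

lemma cis_pi_2 [simp]: "cis (pi * 2) = 1"
  using cis_2pi by (simp add: mult.commute)

lemma circle_point:
  assumes "z \<in> sphere (0::complex) 1"
  obtains t where "0 \<le> t" "t < 1" "z = cis (2 * pi * t)"
proof
  show "0 \<le> Arg2pi z / (2 * pi)" "Arg2pi z / (2 * pi) < 1" using Arg2pi[of z] by auto
  have "z = exp (\<i> * of_real (Arg2pi z))" using assms complex_norm_eq_1_exp[of z] by simp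
  then show "z = cis (2 * pi * (Arg2pi z / (2 * pi)))" by (simp add: cis_conv_exp)
qed

text \<open>A continuous map from a compact space onto a Hausdorff space is a quotient map, so
  \<open>g\<close> factors through the circle as soon as it is constant on the fibres of
  \<open>p\<close>. Monotonicity of \<open>p\<close> is not assumed. The range from 0 to 2 fits the
  geometric series with ratio 1/2, the sum of the weights in \<open>ph\<close>.\<close>

lemma circle_lift:
  fixes p :: "real \<Rightarrow> real"
  assumes p: "continuous_on {0..1} p" "p 0 = 0" "p 1 = 2" "\<And>t. t \<in> {0..1} \<Longrightarrow> 0 \<le> p t \<and> p t \<le> 2"
    and g: "continuous_map (top_of_set {0..1}) Y g" "g 0 = g 1"
    and fib: "\<And>s t. s \<in> {0..1} \<Longrightarrow> t \<in> {0..1} \<Longrightarrow> p s = p t \<Longrightarrow> g s = g t"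
  obtains f where "continuous_map circle_top Y f" "\<And>t. t \<in> {0..1} \<Longrightarrow> f (cis (pi * p t)) = g t"
    "\<And>z. z \<in> sphere 0 1 \<Longrightarrow> \<exists>t\<in>{0..1}. z = cis (pi * p t)"
proof -
  let ?c = "\<lambda>t. cis (pi * p t)"
  have onto: "\<exists>t\<in>{0..1}. z = ?c t" if z: "z \<in> sphere 0 1" for z
  proof -
    obtain s where s: "0 \<le> s" "s < 1" "z = cis (2 * pi * s)" using circle_point[OF z] by blast
    have "\<exists>t\<ge>0. t \<le> 1 \<and> p t = 2 * s" by (rule IVT') (use p s in auto)
    then obtain t where t: "t \<in> {0..1}" "p t = 2 * s" by auto
    then have "pi * p t = 2 * pi * s" by simp
    with t s show ?thesis by metis
  qed
  have c: "continuous_on {0..1} ?c" using p(1) by (intro continuous_intros)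
  have img: "?c ` {0..1} = sphere 0 1"
  proof
    show "?c ` {0..1} \<subseteq> sphere 0 1" by auto
    show "sphere 0 1 \<subseteq> ?c ` {0..1}" using onto by blast
  qed
  have qm: "quotient_map (top_of_set {0..1}) circle_top ?c"
    using c img
    by (intro continuous_imp_quotient_map) (auto simp: Hausdorff_space_subtopology compact_space_subtopology)
  have fibc: "g s = g t" if st: "s \<in> {0..1}" "t \<in> {0..1}" "?c s = ?c t" for s t
  proof -
    consider "p s = p t" | "p s = p 0" "p t = p 1" | "p s = p 1" "p t = p 0"
      using cis_eq_pi[of "p s" "p t"] p(2,3) p(4)[OF st(1)] p(4)[OF st(2)] st(3)
      by (auto simp: doubleton_eq_iff)
    then show ?thesis
    proof cases
      case 1 then show ?thesis using fib st by blast
    next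
      case 2 then show ?thesis using fib[of s 0] fib[of t 1] st g(2) by auto
    next
      case 3 then show ?thesis using fib[of s 1] fib[of t 0] st g(2) by auto
    qed
  qed
  show thesis
  proof (rule quotient_map_lift_exists[OF qm g(1)])
    show "g s = g t" if "s \<in> topspace (top_of_set {0..1})" "t \<in> topspace (top_of_set {0..1})" "?c s = ?c t" for s t
      using fibc[of s t] that by simp
    fix f assume f: "continuous_map circle_top Y f" "f ` topspace circle_top = g ` topspace (top_of_set {0..1})"
      "\<And>x. x \<in> topspace (top_of_set {0..1}) \<Longrightarrow> f (?c x) = g x"
    show thesis by (rule that[OF f(1)]) (use f(3) onto in auto)
  qed
qed

context ham_loop
begin

text \<open>The function \<open>h v\<close> passes continuously from 0 to 1 around the time \<open>tm v\<close>. The weighted sum \<open>ph\<close> of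
  these steps need not be monotone, since the loop may move back and forth inside an edge, but it has
  the same fibres as the loop when no end is left and visited again.\<close>

definition h :: "'v \<Rightarrow> real \<Rightarrow> real" where
  "h v t = (if t \<le> tm v then b v t / 2 else 1 - b v t / 2)"

definition ph :: "real \<Rightarrow> real" where
  "ph t = (\<Sum>n. (1/2) ^ n * h (from_nat_into (V - {v0}) n) t)"

lemma h_bounds: "t \<in> {0..1} \<Longrightarrow> 0 \<le> h v t" "t \<in> {0..1} \<Longrightarrow> h v t \<le> 1"
  using b_bounds[of t v] by (auto simp: h_def)

lemma h_cont:
  assumes v: "v \<in> V" "v \<noteq> v0" shows "continuous_on {0..1} (h v)"
  unfolding h_def[abs_def]
proof (rule continuous_on_cases_le[where h = "\<lambda>t. t"])
  show "continuous_on {x \<in> {0..1}. x \<le> tm v} (\<lambda>t. b v t / 2)"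
    by (intro continuous_intros continuous_on_subset[OF b_cont[OF v(1)]]) auto
  show "continuous_on {x \<in> {0..1}. tm v \<le> x} (\<lambda>t. 1 - b v t / 2)"
    by (intro continuous_intros continuous_on_subset[OF b_cont[OF v(1)]]) auto
qed (use tm[OF v] in \<open>auto simp: vertex_b\<close>)

abbreviation "en \<equiv> from_nat_into (V - {v0})"

lemma en: "en n \<in> V" "en n \<noteq> v0"
proof -
  have "V - {v0} \<noteq> {}" using other_vertex[of "{}"] by blast
  then have "en n \<in> V - {v0}" by (rule from_nat_into)
  then show "en n \<in> V" "en n \<noteq> v0" by auto
qed

lemma en_onto: assumes "v \<in> V" "v \<noteq> v0" obtains n where "en n = v"
  using from_nat_into_surj[of "V - {v0}" v] assms countable_V by auto

lemma sum_half: "summable (\<lambda>n. (1/2 :: real) ^ n)" "(\<Sum>n. (1/2 :: real) ^ n) = 2"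
  by (auto simp: summable_geometric suminf_geometric)

lemma ph_summable:
  assumes "t \<in> {0..1}" shows "summable (\<lambda>n. (1/2) ^ n * h (en n) t)"
proof (rule summable_comparison_test'[OF sum_half(1)])
  show "norm ((1/2) ^ n * h (en n) t) \<le> (1/2) ^ n" for n
    using h_bounds[OF assms, of "en n"] mult_left_le[of "h (en n) t" "(1/2)^n"] by simp
qed

lemma ph_cont: "continuous_on {0..1} ph"
proof -
  have "uniform_limit {0..1} (\<lambda>n t. \<Sum>i<n. (1/2) ^ i * h (en i) t) ph sequentially"
    unfolding ph_def[abs_def]
  proof (rule Weierstrass_m_test[OF _ sum_half(1)])
    show "norm ((1/2) ^ n * h (en n) t) \<le> (1/2) ^ n" if "t \<in> {0..1}" for n t
      using h_bounds[OF that, of "en n"] mult_left_le[of "h (en n) t" "(1/2)^n"] by simp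
  qed
  then show ?thesis
    by (rule uniform_limit_theorem[rotated])
      (auto intro!: always_eventually continuous_intros h_cont en)
qed

lemma ph_less:
  assumes st: "s \<in> {0..1}" "t \<in> {0..1}"
    and le: "\<And>v. v \<in> V \<Longrightarrow> v \<noteq> v0 \<Longrightarrow> h v s \<le> h v t"
    and less: "v \<in> V" "v \<noteq> v0" "h v s < h v t"
  shows "ph s < ph t"
proof -
  obtain n where n: "en n = v" using en_onto less by blast
  have "0 < (\<Sum>n. (1/2) ^ n * h (en n) t - (1/2) ^ n * h (en n) s)"
  proof (rule suminf_pos2[of _ n])
    show "summable (\<lambda>n. (1/2) ^ n * h (en n) t - (1/2) ^ n * h (en n) s)"
      using ph_summable st by (intro summable_diff)
    show "0 \<le> (1/2) ^ n * h (en n) t - (1/2) ^ n * h (en n) s" for n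
      using le[OF en] by simp
    show "0 < (1/2) ^ n * h (en n) t - (1/2) ^ n * h (en n) s" using n less by simp
  qed
  also have "\<dots> = ph t - ph s" unfolding ph_def using ph_summable st by (intro suminf_diff[symmetric])
  finally show ?thesis by simp
qed

lemma ph_eq: "(\<And>v. v \<in> V \<Longrightarrow> v \<noteq> v0 \<Longrightarrow> h v s = h v t) \<Longrightarrow> ph s = ph t"
  unfolding ph_def using en by simp

lemma ph_0: "ph 0 = 0"
proof -
  have "h (en n) 0 = 0" for n using tm[OF en, of n] en[of n] by (simp add: h_def vertex_b[OF \<gamma>0])
  then show ?thesis by (simp add: ph_def)
qed

lemma ph_1: "ph 1 = 2"
proof -
  have "h (en n) 1 = 1" for n using tm[OF en, of n] en[of n] by (simp add: h_def vertex_b[OF \<gamma>1])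
  then show ?thesis using sum_half by (simp add: ph_def)
qed

lemma ph_bounds:
  assumes t: "t \<in> {0..1}" shows "0 \<le> ph t \<and> ph t \<le> 2"
proof
  show "0 \<le> ph t" unfolding ph_def
    by (rule suminf_nonneg[OF ph_summable[OF t]]) (use h_bounds[OF t] in simp)
  have "ph t \<le> (\<Sum>n. (1/2) ^ n)" unfolding ph_def
  proof (rule suminf_le[OF _ ph_summable[OF t] sum_half(1)])
    show "(1/2) ^ n * h (en n) t \<le> (1/2) ^ n" for n
      using h_bounds[OF t, of "en n"] mult_left_le[of "h (en n) t" "(1/2)^n"] by simp
  qed
  then show "ph t \<le> 2" using sum_half by simp
qed

text \<open>Either \<open>t\<close> is \<open>tm v\<close>, or it lies in a traversal of an edge at
  \<open>v\<close>. One boundary time of that traversal is \<open>tm v\<close>, and no vertex time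
  lies inside it.\<close>

lemma no_vertex_between:
  assumes v: "v \<in> V" "v \<noteq> v0" and t: "t \<in> {0..1}" "b v t > 0" and s: "s \<in> Tm"
  shows "\<not> (tm v < s \<and> s \<le> t)" "\<not> (t \<le> s \<and> s < tm v)"
proof -
  have "\<not> (tm v < s \<and> s \<le> t) \<and> \<not> (t \<le> s \<and> s < tm v)"
    using t
  proof (cases rule: pos_cases)
    case 1
    then have "t = tm v" using tm_unique t(1) v by blast
    then show ?thesis by auto
  next
    case (2 w l r)
    then obtain x y where xy: "edge_int x y l r" "v = x \<or> v = y" by blast
    then have "tm v = l \<or> tm v = r"
      using tm_unique[of l v] tm_unique[of r v] v(2) by (auto simp: edge_int_def)
    then show ?thesis using edge_int_no_Tm[OF xy(1) s] 2 by auto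
  qed
  then show "\<not> (tm v < s \<and> s \<le> t)" "\<not> (t \<le> s \<and> s < tm v)" by auto
qed

text \<open>A monotonicity relative to vertex times: while the loop turns back inside an edge,
  \<open>h v\<close> may fall.\<close>

lemma h_mono:
  assumes v: "v \<in> V" "v \<noteq> v0" and t: "t \<in> {0..1}" and s: "s \<in> Tm"
  shows "t \<le> s \<Longrightarrow> h v t \<le> h v s" "s \<le> t \<Longrightarrow> h v s \<le> h v t"
proof -
  have s01: "s \<in> {0..1}" using Tm_01(1)[OF s] Tm_01(2)[OF s] by auto
  have bs: "b v s = (if s = tm v then 1 else 0)"
  proof -
    obtain w where "\<gamma> s = Pt (vtx w)" using s by (auto simp: Tm_def)
    then show ?thesis using tm[OF v] tm_unique[OF s01 _ v(2)] by (auto simp: vertex_b)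
  qed
  have z: "b v t = 0" if "tm v < s \<and> s \<le> t \<or> t \<le> s \<and> s < tm v"
    using no_vertex_between[OF v t _ s] that b_bounds(1)[OF t, of v] by (metis order_le_less)
  have at: "t = tm v \<Longrightarrow> b v t = 1" using tm[OF v] by (simp add: vertex_b)
  note bd = b_bounds[OF t, of v] at
  show "h v t \<le> h v s" if "t \<le> s"
    using that bd z unfolding h_def bs by auto
  show "h v s \<le> h v t" if "s \<le> t"
    using that bd z unfolding h_def bs by (auto split: if_splits)
qed

lemma ph_mono_strict:
  assumes v: "v \<in> V" "v \<noteq> v0" and t: "t \<in> {0..1}"
  shows "t < tm v \<Longrightarrow> ph t < ph (tm v)" "tm v < t \<Longrightarrow> ph (tm v) < ph t"
proof -
  have s: "tm v \<in> Tm" "tm v \<in> {0..1}" using tm_Tm v tm[OF v] by auto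
  have hs: "h v (tm v) = 1/2" using tm[OF v] by (simp add: h_def vertex_b)
  have lt1: "b v t < 1" if "t \<noteq> tm v"
    using b_1[OF t, of v] b_bounds(2)[OF t, of v] tm_unique[OF t _ v(2)] that by fastforce
  show "ph t < ph (tm v)" if "t < tm v"
    by (rule ph_less[OF t s(2) h_mono(1)[OF _ _ t s(1)] v]) (use that lt1 hs in \<open>auto simp: h_def\<close>)
  show "ph (tm v) < ph t" if "tm v < t"
    by (rule ph_less[OF s(2) t h_mono(2)[OF _ _ t s(1)] v]) (use that lt1 hs in \<open>auto simp: h_def\<close>)
qed

text \<open>During a traversal all steps are nondecreasing functions of the position
  \<open>b y q\<close> alone, and those of \<open>x\<close> and \<open>y\<close> are strictly
  increasing. As at most one of \<open>x\<close> and \<open>y\<close> is \<open>v0\<close>, the sum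
  \<open>ph\<close> determines the position.\<close>

lemma h_edge:
  assumes e: "edge_int x y l r" and q: "q \<in> {l..r}" and v: "v \<in> V" "v \<noteq> v0"
  shows "h v q = (if v = y then b y q / 2 else if v = x then 1 - (1 - b y q) / 2 else if tm v \<le> l then 1 else 0)"
proof -
  have e': "0 \<le> l" "l < r" "r \<le> 1" "x \<noteq> y" "\<gamma> l = Pt (vtx x)" "\<gamma> r = Pt (vtx y)" using e by (auto simp: edge_int_def)
  have sum: "b x q + b y q = 1" by (rule edge_int_sum[OF e q])
  consider "v = y" | "v = x" | "v \<noteq> x" "v \<noteq> y" by blast
  then show ?thesis
  proof cases
    case 1
    then have "tm v = r" using tm_unique[of r y] e' v by auto
    then show ?thesis using 1 q by (simp add: h_def)
  next
    case 2
    then have t: "tm v = l" using tm_unique[of l x] e' v by auto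
    show ?thesis
    proof (cases "q = l")
      case True
      then have "b x q = 1" "b y q = 0" using e' by (auto simp: vertex_b)
      then show ?thesis using 2 True t e' by (simp add: h_def)
    next
      case False
      then show ?thesis using 2 t q e' sum by (simp add: h_def field_simps)
    qed
  next
    case 3
    have "\<not> b v q > 0" using edge_int_pos[OF e q] 3 by blast
    then have z: "b v q = 0" using b_bounds(1)[of q v] q e' by auto
    have neq: "tm v \<noteq> l" "tm v \<noteq> r" using tm[OF v] e' 3 by auto
    have "tm v \<le> l \<or> r \<le> tm v" using edge_int_no_Tm[OF e tm_Tm[OF v]] .
    then show ?thesis using 3 z neq q e' by (auto simp: h_def)
  qed
qed

lemma ph_edge_less:
  assumes e: "edge_int x y l r" and q: "q \<in> {l..r}" "q' \<in> {l..r}" and less: "b y q < b y q'"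
  shows "ph q < ph q'"
proof -
  have e': "0 \<le> l" "r \<le> 1" "x \<noteq> y" "x \<in> V" "y \<in> V" using e by (auto simp: edge_int_def)
  have 01: "q \<in> {0..1}" "q' \<in> {0..1}" using q e' by auto
  have le: "h v q \<le> h v q'" if "v \<in> V" "v \<noteq> v0" for v
    unfolding h_edge[OF e q(1) that] h_edge[OF e q(2) that] using less by auto
  define z where "z = (if y = v0 then x else y)"
  have z: "z \<in> V" "z \<noteq> v0" using e' by (auto simp: z_def)
  have "h z q < h z q'"
    unfolding h_edge[OF e q(1) z] h_edge[OF e q(2) z] using less e' by (auto simp: z_def)
  with ph_less[OF 01 le z] show ?thesis by blast
qed

lemma ph_edge_eq:
  assumes e: "edge_int x y l r" and q: "q \<in> {l..r}" "q' \<in> {l..r}" and eq: "b y q = b y q'"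
  shows "ph q = ph q'"
  by (rule ph_eq) (simp add: h_edge[OF e q(1)] h_edge[OF e q(2)] eq)

lemma edge_eq:
  assumes e: "edge_int x y l r" and q: "q \<in> {l..r}" "q' \<in> {l..r}" and eq: "b y q = b y q'"
  shows "\<gamma> q = \<gamma> q'"
proof -
  have e': "0 \<le> l" "r \<le> 1" using e by (auto simp: edge_int_def)
  have 01: "q \<in> {0..1}" "q' \<in> {0..1}" using q e' by auto
  have s: "b x q + b y q = 1" "b x q' + b y q' = 1" using edge_int_sum[OF e] q by auto
  have all: "b w q = b w q'" for w
  proof (cases "w = x \<or> w = y")
    case True then show ?thesis using s eq by auto
  next
    case False
    then have "b w q = 0" "b w q' = 0"
      using edge_int_pos[OF e q(1), of w] edge_int_pos[OF e q(2), of w] b_bounds(1)[OF 01(1), of w] b_bounds(1)[OF 01(2), of w]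
      by (auto simp: order_le_less)
    then show ?thesis by simp
  qed
  have "b x q > 0 \<or> b y q > 0" using s(1) by linarith
  then show ?thesis using point_eqI[OF \<gamma>_top[OF 01(1)] \<gamma>_top[OF 01(2)]] all unfolding b_def by blast
qed

text \<open>A vertex time strictly between \<open>s\<close> and \<open>t\<close> would make
  \<open>ph\<close> differ. So \<open>no_vertex\<close> applies: the loop rests at one end, or both
  times belong to one traversal, where equal values of \<open>ph\<close> mean equal
  positions.\<close>

lemma ph_fiber:
  assumes st: "s \<in> {0..1}" "t \<in> {0..1}" and eq: "ph s = ph t"
  shows "\<gamma> s = \<gamma> t"
  using st eq
proof (induction s t rule: linorder_wlog)
  case (le s t)
  show ?case
  proof (cases "s = t")
    case False
    then have lt: "s < t" using le by simp
    show ?thesis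
    proof (cases "\<exists>v. v \<in> V \<and> v \<noteq> v0 \<and> s < tm v \<and> tm v < t")
      case True
      then obtain v where "v \<in> V" "v \<noteq> v0" "s < tm v" "tm v < t" by blast
      then have "ph s < ph t" using ph_mono_strict[of v s] ph_mono_strict[of v t] le by simp
      then show ?thesis using le by simp
    next
      case False
      have "q \<le> s \<or> t \<le> q" if "q \<in> Tm" for q
        using that
      proof (cases rule: Tm_cases)
        case (3 v)
        then show ?thesis using False by force
      qed (use le in auto)
      then have none: "\<forall>q\<in>Tm. q \<le> s \<or> t \<le> q" by blast
      have 01: "0 \<le> s" "t \<le> 1" using le by auto
      from 01(1) lt 01(2) none show ?thesis
      proof (cases rule: no_vertex)
        case (const \<alpha>)
        then show ?thesis using lt by simp
      next
        case (edge x y l r)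
        then have q: "s \<in> {l..r}" "t \<in> {l..r}" using lt by auto
        have "b y s = b y t"
          using ph_edge_less[OF edge(1) q] ph_edge_less[OF edge(1) q(2,1)] le(4) by (metis less_irrefl linorder_neqE)
        then show ?thesis using edge_eq[OF edge(1) q] by blast
      qed
    qed
  qed simp
qed auto

text \<open>Two visits of the same inner point of an edge happen during the same traversal of this edge: a
  second traversal would start and end at the same two vertices and leave no time for a third one.\<close>

lemma edge_int_same:
  assumes e: "edge_int x y l r" "edge_int x' y' l' r'" and xy: "{x', y'} = {x, y}"
  shows "l' = l \<and> r' = r \<and> x' = x \<and> y' = y"
proof -
  have e1: "0 \<le> l" "l < r" "r \<le> 1" "x \<noteq> y" "\<gamma> l = Pt (vtx x)" "\<gamma> r = Pt (vtx y)" using e by (auto simp: edge_int_def)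
  have e2: "0 \<le> l'" "l' < r'" "r' \<le> 1" "x' \<noteq> y'" "\<gamma> l' = Pt (vtx x')" "\<gamma> r' = Pt (vtx y')" using e by (auto simp: edge_int_def)
  obtain w where w: "w \<in> V" "w \<notin> {x, y}" "w \<noteq> v0" using other_vertex[of "{x, y}"] by blast
  have tw: "tm w \<le> l \<or> r \<le> tm w" "tm w \<le> l' \<or> r' \<le> tm w" "0 < tm w" "tm w < 1"
    using edge_int_no_Tm[OF e(1) tm_Tm] edge_int_no_Tm[OF e(2) tm_Tm] w tm[of w] by auto
  have times: "\<And>z t. t \<in> {0..1} \<Longrightarrow> \<gamma> t = Pt (vtx z) \<Longrightarrow> (if z = v0 then t = 0 \<or> t = 1 else t = tm z)"
    using tm_unique v0_unique by auto
  have neq: "tm w \<noteq> l" "tm w \<noteq> r" "tm w \<noteq> l'" "tm w \<noteq> r'" using tm[of w] w e1 e2 xy by (auto simp: doubleton_eq_iff)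
  have T: "if x = v0 then l = 0 \<or> l = 1 else l = tm x" "if y = v0 then r = 0 \<or> r = 1 else r = tm y"
    "if x' = v0 then l' = 0 \<or> l' = 1 else l' = tm x'" "if y' = v0 then r' = 0 \<or> r' = 1 else r' = tm y'"
    using times[of l x] times[of r y] times[of l' x'] times[of r' y'] e1 e2 by auto
  consider "x' = x" "y' = y" | "x' = y" "y' = x" using xy by (auto simp: doubleton_eq_iff)
  then show ?thesis
  proof cases
    case 1
    then show ?thesis using T e1 e2 tw neq by (auto split: if_splits)
  next
    case 2
    then show ?thesis using T e1 e2 tw neq by (auto split: if_splits)
  qed
qed

text \<open>At an end all coordinates are 0, so only steps of vertices met between \<open>s\<close>
  and \<open>t\<close> could differ, and \<open>mono\<close> excludes those. A vertex is repeated
  only as \<open>v0\<close> at times 0 and 1. Inner points of an edge are settled by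
  \<open>edge_int_same\<close>.\<close>

lemma ph_fiber_conv:
  assumes st: "s \<in> {0..1}" "t \<in> {0..1}" and lt: "s < t" and eq: "\<gamma> s = \<gamma> t"
    and mono: "\<And>\<alpha> q. \<gamma> s = EndPt \<alpha> \<Longrightarrow> \<gamma> t = EndPt \<alpha> \<Longrightarrow> q \<in> Tm \<Longrightarrow> q \<le> s \<or> t \<le> q"
  shows "ph s = ph t \<or> (s = 0 \<and> t = 1)"
proof (cases "\<exists>\<beta>\<in>ends V E. \<gamma> s = EndPt \<beta>")
  case True
  then obtain \<alpha> where \<alpha>: "\<gamma> s = EndPt \<alpha>" "\<gamma> t = EndPt \<alpha>" using eq by auto
  have "h v s = h v t" if v: "v \<in> V" "v \<noteq> v0" for v
  proof -
    have "tm v \<le> s \<or> t \<le> tm v" using mono[OF \<alpha> tm_Tm[OF v]] .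
    moreover have "tm v \<noteq> s" "tm v \<noteq> t" using tm[OF v] \<alpha> by auto
    ultimately show ?thesis using \<alpha> lt by (auto simp: h_def b_def)
  qed
  then show ?thesis using ph_eq by blast
next
  case False
  then obtain v where v: "v \<in> V" "b v s > 0" using not_end_pos[OF st(1)] by blast
  have bt: "b w t = b w s" for w using eq by (simp add: b_def)
  from st(1) v(2) show ?thesis
  proof (cases rule: pos_cases)
    case 1
    then have "\<gamma> t = Pt (vtx v)" using eq by simp
    then show ?thesis using 1 lt st tm_unique[OF st(1), of v] tm_unique[OF st(2), of v] v0_unique[OF st(1)] v0_unique[OF st(2)]
      by (cases "v = v0") auto
  next
    case (2 w l r)
    have "b v t > 0" "b w t > 0" using bt v 2 by auto
    then obtain l' r' where 3: "l' < t" "t < r'" "edge_int v w l' r' \<or> edge_int w v l' r'"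
      using edge_interval[OF st(2), of v w] 2(1) by metis
    obtain x y where e: "edge_int x y l r" "{x, y} = {v, w}" using 2 by blast
    obtain x' y' where e': "edge_int x' y' l' r'" "{x', y'} = {v, w}" using 3 by blast
    have "l' = l \<and> r' = r" using edge_int_same[OF e(1) e'(1)] e(2) e'(2) by simp
    then have "s \<in> {l..r}" "t \<in> {l..r}" using 2 3 by auto
    then show ?thesis using ph_edge_eq[OF e(1)] bt by metis
  qed
qed

theorem circle_if_ends_monotone:
  assumes mono: "\<And>\<alpha> s t q. 0 \<le> s \<Longrightarrow> s < t \<Longrightarrow> t \<le> 1 \<Longrightarrow> \<gamma> s = EndPt \<alpha> \<Longrightarrow> \<gamma> t = EndPt \<alpha> \<Longrightarrow> q \<in> Tm \<Longrightarrow> q \<le> s \<or> t \<le> q"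
  shows "has_hamiltonian_circle V E"
proof -
  have "\<gamma> 0 = \<gamma> 1" using \<gamma>0 \<gamma>1 by simp
  from ph_cont ph_0 ph_1 ph_bounds cont this ph_fiber
  obtain f where f: "continuous_map circle_top FX f" "\<And>t. t \<in> {0..1} \<Longrightarrow> f (cis (pi * ph t)) = \<gamma> t"
    "\<And>z. z \<in> sphere 0 1 \<Longrightarrow> \<exists>t\<in>{0..1}. z = cis (pi * ph t)"
    by (rule circle_lift) blast+
  have aux: "cis (pi * ph s) = cis (pi * ph t)" if "s \<in> {0..1}" "t \<in> {0..1}" "s < t" "\<gamma> s = \<gamma> t" for s t
  proof -
    have "ph s = ph t \<or> (s = 0 \<and> t = 1)"
      using ph_fiber_conv[OF that] mono that by auto
    then show ?thesis using ph_0 ph_1 by auto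
  qed
  have "inj_on f (sphere 0 1)"
  proof (rule inj_onI)
    fix z z' assume z: "z \<in> sphere 0 1" "z' \<in> sphere 0 1" "f z = f z'"
    obtain s t where st: "s \<in> {0..1}" "z = cis (pi * ph s)" "t \<in> {0..1}" "z' = cis (pi * ph t)"
      using f(3)[OF z(1)] f(3)[OF z(2)] by blast
    then have eq: "\<gamma> s = \<gamma> t" using z(3) f(2) by metis
    show "z = z'"
    proof (cases s t rule: linorder_cases)
      case less
      show ?thesis unfolding st(2,4) by (rule aux[OF st(1,3) less eq])
    next
      case equal
      then show ?thesis unfolding st(2,4) by simp
    next
      case greater
      show ?thesis unfolding st(2,4) by (rule aux[OF st(3,1) greater eq[symmetric], symmetric])
    qed
  qed
  then have "embedding_map circle_top FX f"
    by (intro continuous_imp_embedding_map[OF f(1) _ Hausdorff_freudenthal])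
      (auto simp: compact_space_subtopology)
  moreover have "Pt (vtx v) \<in> f ` sphere 0 1" if v: "v \<in> V" for v
  proof -
    obtain t where t: "t \<in> {0..1}" "\<gamma> t = Pt (vtx v)"
    proof (cases "v = v0")
      case True then show ?thesis using that[of 0] \<gamma>0 by auto
    next
      case False then show ?thesis using that[of "tm v"] tm[OF v] by auto
    qed
    have "cis (pi * ph t) \<in> sphere 0 1" by simp
    then show ?thesis using f(2)[OF t(1)] t(2) by (metis imageI)
  qed
  ultimately show ?thesis unfolding has_hamiltonian_circle_def by blast
qed

theorem curve_if_loop: "has_hamiltonian_curve V E"
proof -
  have "continuous_on {0..1} (\<lambda>t :: real. 2 * t)" by (intro continuous_intros)
  moreover have "\<gamma> 0 = \<gamma> 1" using \<gamma>0 \<gamma>1 by simp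
  ultimately obtain f where f: "continuous_map circle_top FX f" "\<And>t. t \<in> {0..1} \<Longrightarrow> f (cis (pi * (2 * t))) = \<gamma> t"
    "\<And>z. z \<in> sphere 0 1 \<Longrightarrow> \<exists>t\<in>{0..1}. z = cis (pi * (2 * t))"
    using circle_lift[of "\<lambda>t. 2 * t" FX \<gamma>] cont by auto
  have "\<exists>!z. z \<in> sphere 0 1 \<and> f z = Pt (vtx v)" if v: "v \<in> V" for v
  proof -
    obtain t where t: "t \<in> {0..1}" "\<gamma> t = Pt (vtx v)"
      "\<And>s. s \<in> {0..1} \<Longrightarrow> \<gamma> s = Pt (vtx v) \<Longrightarrow> s = t \<or> (t = 0 \<and> s = 1)"
    proof (cases "v = v0")
      case True then show ?thesis using that[of 0] \<gamma>0 v0_unique by auto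
    next
      case False
      show ?thesis
      proof (rule that[of "tm v"])
        show "tm v \<in> {0..1}" "\<gamma> (tm v) = Pt (vtx v)" using tm[OF v False] by auto
        show "s = tm v \<or> (tm v = 0 \<and> s = 1)" if "s \<in> {0..1}" "\<gamma> s = Pt (vtx v)" for s
          using tm_unique[OF that False] ..
      qed
    qed
    show ?thesis
    proof (rule ex1I[of _ "cis (pi * (2 * t))"])
      show "cis (pi * (2 * t)) \<in> sphere 0 1 \<and> f (cis (pi * (2 * t))) = Pt (vtx v)" using f(2) t by simp
      fix z assume z: "z \<in> sphere 0 1 \<and> f z = Pt (vtx v)"
      then obtain s where s: "s \<in> {0..1}" "z = cis (pi * (2 * s))" using f(3) by blast
      then have "\<gamma> s = Pt (vtx v)" using z f(2) by metis
      then show "z = cis (pi * (2 * t))" using t(3)[OF s(1)] s(2) by auto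
    qed
  qed
  then show ?thesis unfolding has_hamiltonian_curve_def using f(1) by blast
qed

end

section \<open>Cutting a Hamiltonian curve open at a vertex\<close>

lemma (in lfgraph) loop_if_curve:
  assumes inf: "infinite V" and \<sigma>: "continuous_map circle_top FX \<sigma>"
    and once: "\<And>v. v \<in> V \<Longrightarrow> \<exists>!z. z \<in> sphere 0 1 \<and> \<sigma> z = Pt (vtx v)"
  obtains z0 v0 tm where "z0 \<in> sphere 0 1" "ham_loop V E (\<lambda>t. \<sigma> (z0 * cis (2 * pi * t))) v0 tm"
proof -
  obtain v0 where v0: "v0 \<in> V" using inf by (metis finite.emptyI ex_in_conv)
  define Z where "Z = (\<lambda>v. THE z. z \<in> sphere 0 1 \<and> \<sigma> z = Pt (vtx v))"
  have Z: "Z v \<in> sphere 0 1" "\<sigma> (Z v) = Pt (vtx v)" "\<And>z. z \<in> sphere 0 1 \<Longrightarrow> \<sigma> z = Pt (vtx v) \<Longrightarrow> z = Z v" if "v \<in> V" for v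
    using theI'[OF once[OF that]] once[OF that] unfolding Z_def by blast+
  let ?z0 = "Z v0"
  have z0: "?z0 \<in> sphere 0 1" "?z0 \<noteq> 0" using Z(1)[OF v0] by auto
  let ?c = "\<lambda>t :: real. ?z0 * cis (2 * pi * t)"
  let ?g = "\<lambda>t. \<sigma> (?c t)"
  have cS: "?c t \<in> sphere 0 1" for t using z0 by (simp add: norm_mult)
  have c_eq: "s = t \<or> {s, t} = {0, 1}" if "s \<in> {0..1}" "t \<in> {0..1}" "?c s = ?c t" for s t
  proof -
    have "cis (pi * (2 * s)) = cis (pi * (2 * t))" using that z0 by (simp add: mult_ac)
    then have "2 * s = 2 * t \<or> {2 * s, 2 * t} = {0, 2}" using that by (intro cis_eq_pi) auto
    then show ?thesis by (auto simp: doubleton_eq_iff)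
  qed
  have "\<exists>t. 0 \<le> t \<and> t < 1 \<and> ?c t = z" if z: "z \<in> sphere 0 1" for z
  proof -
    have "z / ?z0 \<in> sphere 0 1" using z z0 by (simp add: norm_divide)
    then obtain t where t: "0 \<le> t" "t < 1" "z / ?z0 = cis (2 * pi * t)" by (rule circle_point)
    then have "?c t = z" using z0 by (simp add: field_simps)
    with t show ?thesis by blast
  qed
  then have "\<exists>t. 0 \<le> t \<and> t < 1 \<and> ?c t = Z v" if "v \<in> V" for v using Z(1)[OF that] by blast
  then obtain tm where tm: "\<And>v. v \<in> V \<Longrightarrow> 0 \<le> tm v \<and> tm v < 1 \<and> ?c (tm v) = Z v" by metis
  have c01: "?c 0 = ?z0" "?c 1 = ?z0" by simp_all
  have Zneq: "Z v \<noteq> ?z0" if "v \<in> V" "v \<noteq> v0" for v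
    using Z(2)[OF that(1)] Z(2)[OF v0] that(2) by (metis fpoint.inject(1) vtx_eq_iff)
  have "ham_loop V E ?g v0 tm"
  proof
    have "continuous_map (top_of_set {0..1}) circle_top ?c"
      using cS by (auto intro!: continuous_intros)
    from continuous_map_compose[OF this \<sigma>] show "continuous_map (top_of_set {0..1}) FX ?g" by (simp add: o_def)
    show "?g 0 = Pt (vtx v0)" "?g 1 = Pt (vtx v0)" by (simp_all add: Z(2)[OF v0])
    fix v assume v: "v \<in> V" "v \<noteq> v0"
    have "tm v \<noteq> 0"
    proof
      assume "tm v = 0"
      then have "Z v = ?z0" using tm[OF v(1)] c01 by metis
      with Zneq[OF v] show False ..
    qed
    then show "0 < tm v \<and> tm v < 1 \<and> ?g (tm v) = Pt (vtx v)" using tm[OF v(1)] Z(2)[OF v(1)] by simp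
  next
    fix t :: real and v assume t: "t \<in> {0..1}" "?g t = Pt (vtx v)" "v \<noteq> v0"
    have "?g t \<in> topspace FX" using \<sigma> cS[of t] by (auto simp: continuous_map_def Pi_iff)
    moreover have "bary (?g t) v > 0" using t(2) by simp
    ultimately have v: "v \<in> V" by (rule bary_pos_V)
    have "?c t = Z v" using Z(3)[OF v cS t(2)] .
    then have "?c t = ?c (tm v)" using tm[OF v] by simp
    then have "t = tm v \<or> {t, tm v} = {0, 1}" using c_eq[OF t(1)] tm[OF v] by auto
    moreover have "tm v \<noteq> 1" "tm v = 0 \<Longrightarrow> False"
    proof -
      show "tm v \<noteq> 1" using tm[OF v] by auto
      assume "tm v = 0"
      then have "Z v = ?z0" using tm[OF v] c01 by metis
      with Zneq[OF v t(3)] show False ..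
    qed
    ultimately show "t = tm v" by (auto simp: doubleton_eq_iff)
  next
    fix t :: real assume t: "t \<in> {0..1}" "?g t = Pt (vtx v0)"
    have "?c t = ?c 0" unfolding c01 using Z(3)[OF v0 cS t(2)] .
    then show "t = 0 \<or> t = 1" using c_eq[OF t(1), of 0] by (auto simp: doubleton_eq_iff)
  qed (use inf v0 in auto)
  with z0 that show thesis by blast
qed

subsection \<open>Small end degrees\<close>

context ham_loop
begin

text \<open>Otherwise the image of \<open>{a..c}\<close> would be split by two disjoint open sets:
  the neighbourhood \<open>A\<close> of the end, and the union of \<open>B1\<close> (ends in other
  components), \<open>B2\<close> (points touching a vertex outside the component and outside
  \<open>T\<close>) and \<open>B3\<close> (inner points of edges with both endpoints in
  \<open>T\<close>). A vertex met strictly between \<open>a\<close> and \<open>c\<close> is not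
  \<open>v0\<close>, so its time is given by \<open>tm\<close>.\<close>

lemma crossing:
  assumes ac: "0 \<le> a" "a < c" "c \<le> 1" and \<beta>: "\<beta> \<in> ends V E" and T: "finite T" "T \<subseteq> V"
    and u: "u \<in> V" "u \<notin> T" "u \<notin> end_comp V E T \<beta>"
    and at: "(\<gamma> a = Pt (vtx u) \<and> \<gamma> c = EndPt \<beta>) \<or> (\<gamma> c = Pt (vtx u) \<and> \<gamma> a = EndPt \<beta>)"
  obtains w where "w \<in> T" "a < tm w" "tm w < c"
proof (rule ccontr)
  assume no: "\<not> thesis"
  have none: "\<gamma> r \<noteq> Pt (vtx w)" if "w \<in> T" "r \<in> {a..c}" for w r
  proof
    assume r: "\<gamma> r = Pt (vtx w)"
    then have "r \<noteq> a" "r \<noteq> c" using at u that by auto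
    then have r': "a < r" "r < c" "r \<in> {0..1}" using that ac by auto
    have "w \<noteq> v0" using v0_unique[OF r'(3)] r r' ac by auto
    then have "r = tm w" using tm_unique[OF r'(3) r] by blast
    then show False using no that(1) r' \<open>\<And>w. w \<in> T \<Longrightarrow> a < tm w \<Longrightarrow> tm w < c \<Longrightarrow> thesis\<close> by blast
  qed
  let ?C = "end_comp V E T \<beta>"
  define A where "A = end_nbhd V E T \<beta>"
  define B1 where "B1 = (\<Union>\<delta>\<in>{\<delta> \<in> ends V E. ?C \<inter> end_comp V E T \<delta> = {}}. end_nbhd V E T \<delta>)"
  define P where "P = (\<lambda>v. {x \<in> topspace FX. bary x v \<in> {0<..}})"
  define B2 where "B2 = (\<Union>v\<in>V - ?C - T. P v)"
  define B3 where "B3 = (\<Union>v\<in>T. \<Union>w\<in>T - {v}. P v \<inter> P w)"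
  have P: "openin FX (P v)" if "v \<in> V" for v
    using bary_continuous[OF that] unfolding P_def continuous_map_def
    by (metis open_greaterThan open_openin)
  have comp: "?C \<in> components V E T" by (rule end_comp_component[OF \<beta> T])
  have CV: "?C \<subseteq> V - T" by (rule end_comp_sub[OF \<beta> T])
  have Apos: "\<exists>z\<in>?C. bary x z > 0" if "x \<in> A" "bary x v > 0" for x v
    using that unfolding A_def end_nbhd_iff[OF T \<beta>] by auto
  have opA: "openin FX A" unfolding A_def by (rule openin_end_nbhd[OF T \<beta>])
  have op1: "openin FX B1" unfolding B1_def by (rule openin_Union) (use openin_end_nbhd[OF T] in blast)
  have op2: "openin FX B2" unfolding B2_def by (rule openin_Union) (use P in blast)
  have "openin FX (\<Union>w\<in>T - {v}. P v \<inter> P w)" if "v \<in> T" for v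
    by (rule openin_Union) (use P T(2) that in blast)
  then have op3: "openin FX B3" unfolding B3_def by blast
  have opB: "openin FX (B1 \<union> B2 \<union> B3)" using op1 op2 op3 by blast
  have d1: "A \<inter> B1 = {}"
    unfolding A_def B1_def using end_nbhd_disjoint[OF \<beta> _ T] by blast
  have d2: "x \<notin> B2" if x: "x \<in> A" for x
  proof
    assume "x \<in> B2"
    then obtain v where v: "v \<in> V" "v \<notin> ?C" "v \<notin> T" "x \<in> topspace FX" "bary x v > 0"
      by (auto simp: B2_def P_def)
    obtain z where z: "z \<in> ?C" "bary x z > 0" using Apos[OF x v(5)] by blast
    have "{z, v} \<in> E" using bary_two(1)[OF v(4) z(2) v(5)] z v by blast
    then show False using components_step[OF comp z(1)] v by blast
  qed
  have d3: "x \<notin> B3" if x: "x \<in> A" for x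
  proof
    assume "x \<in> B3"
    then obtain v w where v: "v \<in> T" "w \<in> T" "v \<noteq> w" "x \<in> topspace FX" "bary x v > 0" "bary x w > 0"
      by (auto simp: B3_def P_def)
    obtain z where z: "z \<in> ?C" "bary x z > 0" using Apos[OF x v(5)] by blast
    have "bary x z = 0" using bary_two(4)[OF v(4,5,6,3), of z] z v CV by blast
    with z show False by simp
  qed
  have cover: "\<gamma> ` {a..c} \<subseteq> A \<union> (B1 \<union> B2 \<union> B3)"
  proof
    fix x assume "x \<in> \<gamma> ` {a..c}"
    then obtain r where r: "r \<in> {a..c}" "x = \<gamma> r" by blast
    then have xt: "x \<in> topspace FX" using \<gamma>_top[of r] ac by auto
    have inA: "x \<in> A" if "v \<in> ?C" "bary x v > 0" for v
      using that xt unfolding A_def end_nbhd_iff[OF T \<beta>] by blast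
    have in2: "x \<in> B2" if "v \<in> V" "v \<notin> ?C" "v \<notin> T" "bary x v > 0" for v
      using that xt by (auto simp: B2_def P_def)
    from xt show "x \<in> A \<union> (B1 \<union> B2 \<union> B3)"
    proof (cases rule: topspace_cases)
      case (vtx v)
      then have "v \<notin> T" "bary x v > 0" using none r by auto
      then show ?thesis using inA[of v] in2[of v] vtx(1) by blast
    next
      case (seg v w t)
      then have pos: "bary x v > 0" "bary x w > 0" by (auto simp: bary_seg)
      have V: "v \<in> V" "w \<in> V" using edgeD seg by auto
      show ?thesis
      proof (cases "v \<in> T \<and> w \<in> T")
        case True
        then have "x \<in> B3" using pos xt seg(2) unfolding B3_def P_def by auto
        then show ?thesis by blast
      next
        case False
        then show ?thesis using inA[of v] inA[of w] in2[of v] in2[of w] pos V by blast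
      qed
    next
      case (End \<delta>)
      have xd: "x \<in> end_nbhd V E T \<delta>" using end_nbhd_self[OF T End(1)] End(2) by simp
      show ?thesis
      proof (cases "?C = end_comp V E T \<delta>")
        case True
        then have "end_nbhd V E T \<delta> = A" by (simp add: A_def end_nbhd_def)
        then show ?thesis using xd by blast
      next
        case False
        then have "?C \<inter> end_comp V E T \<delta> = {}"
          using components_eq[OF comp end_comp_component[OF End(1) T]] by blast
        then have "x \<in> B1" using xd End(1) unfolding B1_def by blast
        then show ?thesis by blast
      qed
    qed
  qed
  have uB: "Pt (vtx u) \<in> B1 \<union> B2 \<union> B3"
    using u vtx_topspace[OF u(1)] by (auto simp: B2_def P_def)
  have eA: "EndPt \<beta> \<in> A" unfolding A_def by (rule end_nbhd_self[OF T \<beta>])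
  have con: "connectedin FX (\<gamma> ` {a..c})"
    by (rule connectedin_continuous_map_image[OF cont]) (use ac in \<open>auto simp: connectedin_subtopology\<close>)
  have mem: "\<gamma> a \<in> \<gamma> ` {a..c}" "\<gamma> c \<in> \<gamma> ` {a..c}" using ac by auto
  have "A \<inter> (B1 \<union> B2 \<union> B3) = {}" using d1 d2 d3 by blast
  from connectedin_split[OF opA opB this eA uB cover con] at mem show False by metis
qed

end

section \<open>The map of compactifications induced by a faithful subgraph\<close>

locale faithful_subgraph = lfgraph V E for V :: "'v set" and E +
  fixes EF :: "'v set set"
  assumes sub: "EF \<subseteq> E" and faith: "faithful V EF V E"
begin

sublocale F: lfgraph V EF
  using sub by (rule subgraph_lfgraph)

lemma F_ray: "is_ray V EF R \<Longrightarrow> is_ray V E R"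
  using sub by (auto simp: is_ray_def)

lemma F_ray_equiv: "is_ray V EF R \<Longrightarrow> is_ray V EF R' \<Longrightarrow> ray_equiv V EF R R' \<longleftrightarrow> ray_equiv V E R R'"
  using faith unfolding faithful_def by blast

text \<open>The end of the graph that contains the rays of \<open>\<beta>\<close>. One direction of
  faithfulness makes it independent of the chosen ray, the other makes the map injective.\<close>

definition fe :: "(nat \<Rightarrow> 'v) set \<Rightarrow> (nat \<Rightarrow> 'v) set" where
  "fe \<beta> = end_of (SOME R. R \<in> \<beta>)"

lemma fe: assumes "\<beta> \<in> ends V EF" "R \<in> \<beta>" shows "fe \<beta> = end_of R" "fe \<beta> \<in> ends V E" "R \<in> fe \<beta>"
proof -
  have s: "(SOME R. R \<in> \<beta>) \<in> \<beta>" by (rule someI[of "\<lambda>R. R \<in> \<beta>", OF assms(2)])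
  note r = F.end_ray[OF assms(1) s] F.end_ray[OF assms]
  have "ray_equiv V EF (SOME R. R \<in> \<beta>) R"
    using F.end_eq[OF assms(1) s] assms(2) by (auto simp: F.end_of_def)
  then have "ray_equiv V E (SOME R. R \<in> \<beta>) R" using F_ray_equiv r by blast
  then show eq: "fe \<beta> = end_of R" unfolding fe_def using end_of_eq_iff F_ray r by blast
  show "fe \<beta> \<in> ends V E" "R \<in> fe \<beta>" unfolding eq using end_of_end end_of_self F_ray r by blast+
qed

lemma fe_end: "\<beta> \<in> ends V EF \<Longrightarrow> fe \<beta> \<in> ends V E"
  using fe(2) F.end_nonempty by blast

lemma fe_inj:
  assumes "\<beta> \<in> ends V EF" "\<delta> \<in> ends V EF" "fe \<beta> = fe \<delta>" shows "\<beta> = \<delta>"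
proof -
  obtain R R' where R: "R \<in> \<beta>" "R' \<in> \<delta>" using F.end_nonempty assms by blast
  note r = F.end_ray[OF assms(1) R(1)] F.end_ray[OF assms(2) R(2)]
  have "end_of R = end_of R'" using fe(1)[OF assms(1) R(1)] fe(1)[OF assms(2) R(2)] assms(3) by simp
  then have "ray_equiv V E R R'" using end_of_eq_iff F_ray r by blast
  then have "ray_equiv V EF R R'" using F_ray_equiv r by blast
  then show ?thesis
    using F.end_eq[OF assms(1) R(1)] F.end_eq[OF assms(2) R(2)] F.end_of_eq_iff r by blast
qed

text \<open>This yields continuity at ends: neighbourhoods of an end of the subgraph go into
  neighbourhoods of its image, with the same \<open>S\<close>.\<close>

lemma end_comp_F_sub:
  assumes \<beta>: "\<beta> \<in> ends V EF" and S: "finite S" "S \<subseteq> V"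
  shows "end_comp V EF S \<beta> \<subseteq> end_comp V E S (fe \<beta>)"
proof
  fix x assume x: "x \<in> end_comp V EF S \<beta>"
  obtain R where R: "R \<in> \<beta>" using F.end_nonempty \<beta> by blast
  obtain n where n: "R n \<in> end_comp V EF S \<beta>" "R n \<in> end_comp V E S (fe \<beta>)"
    using tail_common F.end_comp_tail[OF \<beta> S R] end_comp_tail[OF fe_end[OF \<beta>] S fe(3)[OF \<beta> R]] by blast
  have "conn EF (end_comp V EF S \<beta>) (R n) x"
    using F.components_conn[OF F.end_comp_component[OF \<beta> S] n(1) x] .
  then have "conn E (end_comp V EF S \<beta>) (R n) x" using sub by (blast intro: conn_mono)
  then show "x \<in> end_comp V E S (fe \<beta>)"
    by (rule components_closed[OF end_comp_component[OF fe_end[OF \<beta>] S] n(2)])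
      (use F.end_comp_sub[OF \<beta> S] in blast)
qed

fun \<phi> :: "'v fpoint \<Rightarrow> 'v fpoint" where
  "\<phi> (Pt f) = Pt f"
| "\<phi> (EndPt \<beta>) = EndPt (fe \<beta>)"

lemma bary_\<phi>: "bary (\<phi> x) v = bary x v"
  by (cases x) (auto simp: bary.simps)

lemma \<phi>_Pt: "\<phi> x = Pt f \<longleftrightarrow> x = Pt f"
  by (cases x) auto

lemma \<phi>_top: "x \<in> topspace F.FX \<Longrightarrow> \<phi> x \<in> topspace FX"
  by (erule F.topspace_cases) (use vtx_topspace seg_topspace End_topspace fe_end sub in auto)

lemma \<phi>_nbhd:
  assumes \<beta>: "\<beta> \<in> ends V EF" and S: "finite S" "S \<subseteq> V" and x: "x \<in> end_nbhd V EF S \<beta>"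
  shows "\<phi> x \<in> end_nbhd V E S (fe \<beta>)"
proof -
  have xt: "x \<in> topspace F.FX" using x F.end_nbhd_iff[OF S \<beta>] by blast
  from x consider v where "v \<in> end_comp V EF S \<beta>" "bary x v > 0"
    | \<delta> R where "\<delta> \<in> ends V EF" "x = EndPt \<delta>" "R \<in> \<delta>" "has_tail_in R (end_comp V EF S \<beta>)"
    unfolding F.end_nbhd_iff[OF S \<beta>] by blast
  then show ?thesis
  proof cases
    case 1
    then have "v \<in> end_comp V E S (fe \<beta>)" "bary (\<phi> x) v > 0" using end_comp_F_sub[OF \<beta> S] by (auto simp: bary_\<phi>)
    then show ?thesis using \<phi>_top[OF xt] unfolding end_nbhd_iff[OF S fe_end[OF \<beta>]] by blast
  next
    case 2
    then have "has_tail_in R (end_comp V E S (fe \<beta>))" using tail_mono end_comp_F_sub[OF \<beta> S] by blast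
    moreover have "R \<in> fe \<delta>" "fe \<delta> \<in> ends V E" "\<phi> x = EndPt (fe \<delta>)" using fe[OF 2(1,3)] 2(2) by auto
    ultimately show ?thesis using \<phi>_top[OF xt] unfolding end_nbhd_iff[OF S fe_end[OF \<beta>]] by blast
  qed
qed

lemma loop_\<phi>:
  assumes "ham_loop V EF \<gamma> v0 tm"
  shows "ham_loop V E (\<phi> \<circ> \<gamma>) v0 tm"
proof -
  interpret L: ham_loop V EF \<gamma> v0 tm by fact
  show ?thesis
  proof
    show "continuous_map (top_of_set {0..1}) FX (\<phi> \<circ> \<gamma>)"
    proof (rule continuous_map_freudenthalI)
      show "(\<phi> \<circ> \<gamma>) x \<in> topspace FX" if "x \<in> topspace (top_of_set {0..1})" for x
        using \<phi>_top[OF L.\<gamma>_top[of x]] that by simp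
      show "continuous_map (top_of_set {0..1}) euclideanreal (\<lambda>x. bary ((\<phi> \<circ> \<gamma>) x) v)" if "v \<in> V" for v
        using L.b_cont[OF that] by (simp add: bary_\<phi> L.b_def[abs_def])
      fix x \<alpha> S assume x: "x \<in> topspace (top_of_set {0..1})" "(\<phi> \<circ> \<gamma>) x = EndPt \<alpha>" and S: "finite S" "S \<subseteq> V"
      then obtain \<beta> where \<beta>: "\<gamma> x = EndPt \<beta>" "fe \<beta> = \<alpha>" by (cases "\<gamma> x") auto
      have \<beta>e: "\<beta> \<in> ends V EF" using L.\<gamma>_end \<beta> x by simp
      let ?U = "{s \<in> {0..1}. \<gamma> s \<in> end_nbhd V EF S \<beta>}"
      have "openin (top_of_set {0..1}) ?U"
        using L.cont F.openin_end_nbhd[OF S \<beta>e] by (auto simp: continuous_map_def)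
      moreover have "x \<in> ?U" using x \<beta> F.end_nbhd_self[OF S \<beta>e] by auto
      moreover have "(\<phi> \<circ> \<gamma>) ` ?U \<subseteq> end_nbhd V E S \<alpha>" using \<phi>_nbhd[OF \<beta>e S] \<beta> by auto
      ultimately show "\<exists>U. openin (top_of_set {0..1}) U \<and> x \<in> U \<and> (\<phi> \<circ> \<gamma>) ` U \<subseteq> end_nbhd V E S \<alpha>" by blast
    qed
    show "t = tm v" if "t \<in> {0..1}" "(\<phi> \<circ> \<gamma>) t = Pt (vtx v)" "v \<noteq> v0" for t v
      using L.tm_unique[of t v] that by (simp add: \<phi>_Pt)
    show "t = 0 \<or> t = 1" if "t \<in> {0..1}" "(\<phi> \<circ> \<gamma>) t = Pt (vtx v0)" for t
      using L.v0_unique[of t] that by (simp add: \<phi>_Pt)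
  qed (use L.infV L.v0 L.\<gamma>0 L.\<gamma>1 L.tm in auto)
qed

theorem circle_if_degrees_le_3:
  assumes inf: "infinite V" and curve: "has_hamiltonian_curve V EF"
    and deg: "\<And>\<beta>. \<beta> \<in> ends V EF \<Longrightarrow> end_degree V EF \<beta> \<le> 3"
  shows "has_hamiltonian_circle V E"
proof -
  obtain \<sigma> where \<sigma>: "continuous_map circle_top F.FX \<sigma>" "\<And>v. v \<in> V \<Longrightarrow> \<exists>!z. z \<in> sphere 0 1 \<and> \<sigma> z = Pt (vtx v)"
    using curve unfolding has_hamiltonian_curve_def by blast
  obtain z0 v0 tm where L0: "ham_loop V EF (\<lambda>t. \<sigma> (z0 * cis (2 * pi * t))) v0 tm"
    using F.loop_if_curve[OF inf \<sigma>] by metis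
  define \<gamma> where "\<gamma> = (\<lambda>t. \<sigma> (z0 * cis (2 * pi * t)))"
  interpret L: ham_loop V EF \<gamma> v0 tm using L0 by (simp add: \<gamma>_def)
  interpret G: ham_loop V E "\<phi> \<circ> \<gamma>" v0 tm by (rule loop_\<phi>) (rule L.ham_loop_axioms)
  show ?thesis
  proof (rule G.circle_if_ends_monotone, rule ccontr)
    fix \<alpha> s t q
    assume st: "0 \<le> s" "s < t" "t \<le> 1" and ends: "(\<phi> \<circ> \<gamma>) s = EndPt \<alpha>" "(\<phi> \<circ> \<gamma>) t = EndPt \<alpha>"
      and q: "q \<in> G.Tm" and no: "\<not> (q \<le> s \<or> t \<le> q)"
    obtain \<beta> \<delta> where bd: "\<gamma> s = EndPt \<beta>" "fe \<beta> = \<alpha>" "\<gamma> t = EndPt \<delta>" "fe \<delta> = \<alpha>"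
      using ends by (cases "\<gamma> s"; cases "\<gamma> t") auto
    have \<beta>: "\<beta> \<in> ends V EF" "\<delta> \<in> ends V EF" using L.\<gamma>_end[of s] L.\<gamma>_end[of t] bd st by auto
    then have eq: "\<gamma> t = EndPt \<beta>" using fe_inj[of \<beta> \<delta>] bd by simp
    from q obtain v where v: "v \<in> V" "v \<noteq> v0" "q = tm v"
      by (cases rule: G.Tm_cases) (use no st in auto)
    have "end_degree V EF \<beta> < enat 4"
      using deg[OF \<beta>(1)] by (rule order_le_less_trans) (simp flip: numeral_eq_enat)
    then obtain T where T: "finite T" "T \<subseteq> V" "card T < 4" "T \<inter> {v0, v} = {}" "{v0, v} \<inter> end_comp V EF T \<beta> = {}"
      using F.end_menger[OF \<beta>(1) L.countable_V, of 4 "{v0, v}"] v L.v0 by auto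
    have v0': "v0 \<in> V" "v0 \<notin> T" "v0 \<notin> end_comp V EF T \<beta>" using T L.v0 by auto
    have v': "v \<in> V" "v \<notin> T" "v \<notin> end_comp V EF T \<beta>" using T v by auto
    have tv: "0 < tm v" "tm v < 1" "\<gamma> (tm v) = Pt (vtx v)" using L.tm[OF v(1,2)] by auto
    have sq: "s < tm v" "tm v < t" using no v by auto
    have "s \<noteq> 0" "t \<noteq> 1" using bd L.\<gamma>0 L.\<gamma>1 by auto
    then have s0: "0 < s" "t < 1" using st by auto
    have 01: "(0::real) \<le> 0" "(1::real) \<le> 1" "s \<le> 1" "0 \<le> t" "0 \<le> tm v" "tm v \<le> 1" using st tv by auto
    \<comment> \<open>The loop starts and finishes at \<open>v0\<close>. The intervals between
      \<open>v0\<close>, the end, \<open>v\<close>, the end and \<open>v0\<close> have disjoint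
      interiors, so they yield four different vertices of \<open>T\<close>.\<close>
    obtain w1 where w1: "w1 \<in> T" "0 < tm w1" "tm w1 < s"
      using L.crossing[OF 01(1) s0(1) 01(3) \<beta>(1) T(1,2) v0'] bd(1) L.\<gamma>0 by metis
    obtain w2 where w2: "w2 \<in> T" "s < tm w2" "tm w2 < tm v"
      using L.crossing[OF st(1) sq(1) 01(6) \<beta>(1) T(1,2) v'] bd(1) tv(3) by metis
    obtain w3 where w3: "w3 \<in> T" "tm v < tm w3" "tm w3 < t"
      using L.crossing[OF 01(5) sq(2) st(3) \<beta>(1) T(1,2) v'] eq tv(3) by metis
    obtain w4 where w4: "w4 \<in> T" "t < tm w4" "tm w4 < 1"
      using L.crossing[OF 01(4) s0(2) 01(2) \<beta>(1) T(1,2) v0'] eq L.\<gamma>1 by metis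
    have "{w1, w2, w3, w4} \<subseteq> T" using w1 w2 w3 w4 by blast
    moreover have "card {w1, w2, w3, w4} = 4"
    proof -
      have "w1 \<noteq> w2" "w1 \<noteq> w3" "w1 \<noteq> w4" "w2 \<noteq> w3" "w2 \<noteq> w4" "w3 \<noteq> w4"
        using w1 w2 w3 w4 sq by auto
      then show ?thesis by simp
    qed
    ultimately show False using card_mono[OF T(1), of "{w1, w2, w3, w4}"] T(3) by simp
  qed
qed

end

subsection \<open>A sparse subgraph around a Hamiltonian circle\<close>

locale circle_loop = ham_loop +
  assumes inj: "\<And>s t. s \<in> {0..1} \<Longrightarrow> t \<in> {0..1} \<Longrightarrow> \<gamma> s = \<gamma> t \<Longrightarrow> s = t \<or> {s, t} = {0, 1}"
begin

text \<open>The vertices met during \<open>{c..d}\<close>. Stated through times of the loop and not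
  through \<open>tm\<close>, it treats both times of \<open>v0\<close> correctly.\<close>

definition VI :: "real \<Rightarrow> real \<Rightarrow> 'a set" where
  "VI c d = {v \<in> V. \<exists>t\<in>{c..d} \<inter> {0..1}. \<gamma> t = Pt (vtx v)}"

definition vert :: "real \<Rightarrow> 'a" where
  "vert t = (THE v. \<gamma> t = Pt (vtx v))"

lemma vert: assumes "t \<in> Tm" shows "vert t \<in> V" "\<gamma> t = Pt (vtx (vert t))"
proof -
  obtain v where v: "v \<in> V" "\<gamma> t = Pt (vtx v)" using assms by (auto simp: Tm_def)
  then have "vert t = v" unfolding vert_def by (intro the_equality) auto
  with v show "vert t \<in> V" "\<gamma> t = Pt (vtx (vert t))" by auto
qed

lemma vert_eq: "\<gamma> t = Pt (vtx v) \<Longrightarrow> vert t = v"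
  unfolding vert_def by (rule the_equality) auto

lemma VI_mono: "c' \<le> c \<Longrightarrow> d \<le> d' \<Longrightarrow> VI c d \<subseteq> VI c' d'"
  unfolding VI_def by fastforce

lemma VI_V: "VI c d \<subseteq> V"
  by (auto simp: VI_def)

lemma vert_VI: "t \<in> Tm \<Longrightarrow> c \<le> t \<Longrightarrow> t \<le> d \<Longrightarrow> vert t \<in> VI c d"
  using vert[of t] Tm_01(1)[of t] Tm_01(2)[of t] by (auto simp: VI_def)

lemma VI_E:
  assumes "x \<in> VI c d" obtains t where "t \<in> Tm" "c \<le> t" "t \<le> d" "x = vert t"
proof -
  obtain t where t: "t \<in> {c..d} \<inter> {0..1}" "\<gamma> t = Pt (vtx x)" "x \<in> V" using assms by (auto simp: VI_def)
  then have "t \<in> Tm" "vert t = x" using vert_eq by (auto simp: Tm_def)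
  with t that show thesis by auto
qed

lemma vert_tm: "v \<in> V \<Longrightarrow> v \<noteq> v0 \<Longrightarrow> vert (tm v) = v"
  using tm[of v] vert_eq by blast

lemma tm_vert: "t \<in> Tm \<Longrightarrow> 0 < t \<Longrightarrow> t < 1 \<Longrightarrow> vert t \<noteq> v0 \<and> tm (vert t) = t"
  using vert[of t] v0_unique[of t] tm_unique[of t "vert t"] by fastforce

lemma tm_VI: "v \<in> V \<Longrightarrow> v \<noteq> v0 \<Longrightarrow> c \<le> tm v \<Longrightarrow> tm v \<le> d \<Longrightarrow> v \<in> VI c d"
  using tm[of v] by (auto simp: VI_def)

lemma VI_tm: "v \<in> VI c d \<Longrightarrow> v \<noteq> v0 \<Longrightarrow> c \<le> tm v \<and> tm v \<le> d"
  using tm_unique by (fastforce simp: VI_def)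

lemma end_01: "z \<in> {0..1} \<Longrightarrow> \<gamma> z = EndPt \<alpha> \<Longrightarrow> 0 < z \<and> z < 1"
  using \<gamma>0 \<gamma>1 by (metis atLeastAtMost_iff fpoint.distinct(1) order_le_less)

lemma end_not_Tm: "\<gamma> z = EndPt \<alpha> \<Longrightarrow> z \<notin> Tm"
  by (auto simp: Tm_def)

lemma end_inj:
  assumes "s \<in> {0..1}" "t \<in> {0..1}" "\<gamma> s = EndPt \<alpha>" "\<gamma> t = EndPt \<alpha>" shows "s = t"
  using inj[OF assms(1,2)] end_01[OF assms(1,3)] end_01[OF assms(2,4)] assms(3,4)
  by (auto simp: doubleton_eq_iff)

text \<open>By \<open>no_vertex\<close>, an interval without vertex times would rest at an end,
  against injectivity, or lie in an edge traversal, where no end occurs. So vertex times accumulate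
  at every end time from both sides.\<close>

lemma vertex_times_between:
  assumes cd: "0 \<le> c" "c < d" "d \<le> 1" and e: "\<gamma> c = EndPt \<alpha> \<or> \<gamma> d = EndPt \<alpha>"
  obtains q where "q \<in> Tm" "c < q" "q < d"
proof (rule ccontr)
  assume no: "\<not> thesis"
  then have none: "\<forall>q\<in>Tm. q \<le> c \<or> d \<le> q" using that by (meson not_le)
  from cd none show False
  proof (cases rule: no_vertex)
    case (const \<beta>)
    then show ?thesis using end_inj[of c d \<beta>] cd by auto
  next
    case (edge x y l r)
    then have "b x c + b y c = 1" "b x d + b y d = 1" using edge_int_sum[OF edge(1)] cd by auto
    then show ?thesis using e by (auto simp: b_def)
  qed
qed

text \<open>The bounds are vertex times, so a traversal with an inner time in \<open>{c..d}\<close>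
  lies in it together with the visits of both its endpoints.\<close>

lemma touch:
  assumes cd: "c \<in> Tm" "d \<in> Tm" and s: "c \<le> s" "s \<le> d" and pos: "b x s > 0"
  shows "x \<in> VI c d"
proof -
  have s01: "s \<in> {0..1}" using s Tm_01(1)[OF cd(1)] Tm_01(2)[OF cd(2)] by auto
  have xV: "x \<in> V" using b_V[OF s01 pos] .
  from s01 pos show ?thesis
  proof (cases rule: pos_cases)
    case 1
    then show ?thesis using s s01 xV unfolding VI_def by auto
  next
    case (2 w l r)
    then obtain u v where e: "edge_int u v l r" "x = u \<or> x = v" by blast
    have "c \<le> l" "r \<le> d" using edge_int_no_Tm[OF e(1) cd(1)] edge_int_no_Tm[OF e(1) cd(2)] 2 s by auto
    then have "l \<in> {c..d} \<inter> {0..1}" "r \<in> {c..d} \<inter> {0..1}" using e(1) by (auto simp: edge_int_def)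
    then show ?thesis using e xV unfolding VI_def edge_int_def by blast
  qed
qed

lemma end_nbhd_vertex:
  assumes "finite S" "S \<subseteq> V" "\<alpha> \<in> ends V E" "Pt (vtx v) \<in> end_nbhd V E S \<alpha>"
  shows "v \<in> end_comp V E S \<alpha>"
  using assms(4) unfolding end_nbhd_iff[OF assms(1-3)] by (auto split: if_splits)

text \<open>Compactness of the interval, by Bolzano's bisection: sets \<open>S\<close> for adjacent
  pieces are united. Locally, another end is separated from \<open>\<alpha>\<close> by definition,
  and near any other time some coordinate \<open>b u\<close> stays positive, so that
  \<open>u\<close> is the only vertex met there and \<open>{u}\<close> suffices.\<close>

lemma separate_interval:
  assumes ab: "0 \<le> a" "a' \<le> 1" "a \<le> a'" and \<alpha>: "\<alpha> \<in> ends V E" and no: "\<And>t. t \<in> {a..a'} \<Longrightarrow> \<gamma> t \<noteq> EndPt \<alpha>"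
  obtains S where "finite S" "S \<subseteq> V" "\<And>t v. t \<in> {a..a'} \<Longrightarrow> \<gamma> t = Pt (vtx v) \<Longrightarrow> v \<notin> end_comp V E S \<alpha>"
proof -
  define P where "P = (\<lambda>c d. \<exists>S. finite S \<and> S \<subseteq> V \<and> (\<forall>t v. t \<in> {c..d} \<inter> {a..a'} \<longrightarrow> \<gamma> t = Pt (vtx v) \<longrightarrow> v \<notin> end_comp V E S \<alpha>))"
  have "P a a'"
    using ab(3)
  proof (induction rule: Bolzano)
    case (trans c m d)
    from trans(1)[unfolded P_def] obtain S where S1: "finite S" "S \<subseteq> V"
      "\<forall>t v. t \<in> {c..m} \<inter> {a..a'} \<longrightarrow> \<gamma> t = Pt (vtx v) \<longrightarrow> v \<notin> end_comp V E S \<alpha>"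
      by (elim exE conjE)
    from trans(2)[unfolded P_def] obtain S' where S2: "finite S'" "S' \<subseteq> V"
      "\<forall>t v. t \<in> {m..d} \<inter> {a..a'} \<longrightarrow> \<gamma> t = Pt (vtx v) \<longrightarrow> v \<notin> end_comp V E S' \<alpha>"
      by (elim exE conjE)
    note S = S1(1,2) S2(1,2) S1(3) S2(3)
    have sub: "end_comp V E (S \<union> S') \<alpha> \<subseteq> end_comp V E S \<alpha>" "end_comp V E (S \<union> S') \<alpha> \<subseteq> end_comp V E S' \<alpha>"
      using S by (intro end_comp_antimono[OF \<alpha>]; auto)+
    have "v \<notin> end_comp V E (S \<union> S') \<alpha>" if "t \<in> {c..d} \<inter> {a..a'}" "\<gamma> t = Pt (vtx v)" for t v
    proof (cases "t \<le> m")
      case True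
      then have "t \<in> {c..m} \<inter> {a..a'}" using that by auto
      then have "v \<notin> end_comp V E S \<alpha>" using S(5) that(2) by blast
      then show ?thesis using sub by blast
    next
      case False
      then have "t \<in> {m..d} \<inter> {a..a'}" using that by auto
      then have "v \<notin> end_comp V E S' \<alpha>" using S(6) that(2) by blast
      then show ?thesis using sub by blast
    qed
    then show ?case unfolding P_def using S(1-4) by (intro exI[of _ "S \<union> S'"]) auto
  next
    case (local x)
    have x01: "x \<in> {0..1}" using local ab by auto
    have "\<exists>e S. e > 0 \<and> finite S \<and> S \<subseteq> V \<and> (\<forall>t v. t \<in> {0..1} \<longrightarrow> \<bar>t - x\<bar> < e \<longrightarrow> \<gamma> t = Pt (vtx v) \<longrightarrow> v \<notin> end_comp V E S \<alpha>)"
    proof (cases "\<exists>\<beta>\<in>ends V E. \<gamma> x = EndPt \<beta>")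
      case True
      then obtain \<beta> where \<beta>: "\<beta> \<in> ends V E" "\<gamma> x = EndPt \<beta>" by blast
      then have "\<alpha> \<noteq> \<beta>" using no[of x] local by auto
      then obtain S where S: "finite S" "S \<subseteq> V" "end_comp V E S \<alpha> \<inter> end_comp V E S \<beta> = {}"
        using ends_separate[OF \<alpha> \<beta>(1)] by blast
      obtain e where e: "e > 0" "\<And>s. s \<in> {0..1} \<Longrightarrow> \<bar>s - x\<bar> < e \<Longrightarrow> \<gamma> s \<in> end_nbhd V E S \<beta>"
        using end_nbhd_near[OF x01 \<beta>(2) S(1,2) \<beta>(1)] by blast
      have "v \<notin> end_comp V E S \<alpha>" if "t \<in> {0..1}" "\<bar>t - x\<bar> < e" "\<gamma> t = Pt (vtx v)" for t v
        using end_nbhd_vertex[OF S(1,2) \<beta>(1), of v] e(2)[OF that(1,2)] that(3) S(3) by auto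
      then show ?thesis using e(1) S(1,2) by blast
    next
      case False
      then obtain u where u: "u \<in> V" "b u x > 0" using not_end_pos[OF x01] by blast
      obtain e where e: "e > 0" "\<And>s. s \<in> {0..1} \<Longrightarrow> \<bar>s - x\<bar> < e \<Longrightarrow> b u s > 0"
        using b_open[OF u(1) x01 u(2)] by blast
      have "v \<notin> end_comp V E {u} \<alpha>" if "t \<in> {0..1}" "\<bar>t - x\<bar> < e" "\<gamma> t = Pt (vtx v)" for t v
        using vertex_single[OF that(3) e(2)[OF that(1,2)]] end_comp_sub[OF \<alpha>, of "{u}"] u by auto
      then show ?thesis using e(1) u(1) by (intro exI[of _ e] exI[of _ "{u}"]) auto
    qed
    then obtain e S where e: "e > 0" "finite S" "S \<subseteq> V"
      "\<And>t v. t \<in> {0..1} \<Longrightarrow> \<bar>t - x\<bar> < e \<Longrightarrow> \<gamma> t = Pt (vtx v) \<Longrightarrow> v \<notin> end_comp V E S \<alpha>" by blast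
    have "P c d" if "c \<le> x \<and> x \<le> d \<and> d - c < e" for c d
      unfolding P_def
    proof (intro exI[of _ S] conjI allI impI)
      fix t v assume t: "t \<in> {c..d} \<inter> {a..a'}" "\<gamma> t = Pt (vtx v)"
      then have "\<bar>t - x\<bar> < e" "t \<in> {0..1}" using that ab by (auto simp: abs_if)
      then show "v \<notin> end_comp V E S \<alpha>" using e(4) t(2) by blast
    qed (use e in auto)
    then show ?case using e(1) by blast
  qed
  then show thesis using that unfolding P_def by auto
qed

text \<open>By injectivity the end is met neither on \<open>{0..c}\<close> nor on
  \<open>{d..1}\<close>. Separating it from the vertices of both leaves only those of the
  interval.\<close>

lemma end_comp_in_interval:
  assumes z: "0 \<le> c" "c < z" "z < d" "d \<le> 1" "\<gamma> z = EndPt \<alpha>"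
  obtains S where "finite S" "S \<subseteq> V" "end_comp V E S \<alpha> \<subseteq> VI c d"
proof -
  have z01: "z \<in> {0..1}" using z by auto
  have \<alpha>: "\<alpha> \<in> ends V E" using \<gamma>_end[OF z01 z(5)] .
  have "\<gamma> t \<noteq> EndPt \<alpha>" if "t \<in> {0..1}" "t \<noteq> z" for t using end_inj[OF that(1) z01 _ z(5)] that(2) by blast
  then have no: "\<And>t. t \<in> {0..c} \<Longrightarrow> \<gamma> t \<noteq> EndPt \<alpha>" "\<And>t. t \<in> {d..1} \<Longrightarrow> \<gamma> t \<noteq> EndPt \<alpha>" using z by auto
  have le: "(0::real) \<le> 0" "c \<le> 1" "0 \<le> d" "(1::real) \<le> 1" using z by auto
  obtain S where S: "finite S" "S \<subseteq> V" "\<And>t v. t \<in> {0..c} \<Longrightarrow> \<gamma> t = Pt (vtx v) \<Longrightarrow> v \<notin> end_comp V E S \<alpha>"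
    using separate_interval[OF le(1,2) z(1) \<alpha> no(1)] by blast
  obtain S' where S': "finite S'" "S' \<subseteq> V" "\<And>t v. t \<in> {d..1} \<Longrightarrow> \<gamma> t = Pt (vtx v) \<Longrightarrow> v \<notin> end_comp V E S' \<alpha>"
    using separate_interval[OF le(3,4) z(4) \<alpha> no(2)] by blast
  have fin: "finite (S \<union> S')" "S \<union> S' \<subseteq> V" using S S' by auto
  show thesis
  proof (rule that[OF fin])
    show "end_comp V E (S \<union> S') \<alpha> \<subseteq> VI c d"
    proof
      fix v assume "v \<in> end_comp V E (S \<union> S') \<alpha>"
      then have v: "v \<in> end_comp V E S \<alpha>" "v \<in> end_comp V E S' \<alpha>"
        using end_comp_antimono[OF \<alpha> fin, of S] end_comp_antimono[OF \<alpha> fin, of S'] by auto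
      have vV: "v \<in> V" using end_comp_sub[OF \<alpha> S(1,2)] v by blast
      define t where "t = (if v = v0 then 0 else tm v)"
      have t: "t \<in> {0..1}" "\<gamma> t = Pt (vtx v)" using tm[OF vV] \<gamma>0 by (auto simp: t_def)
      have "\<not> t \<le> c" "\<not> d \<le> t" using S(3)[of t v] S'(3)[of t v] t v by auto
      then have "t \<in> {c..d} \<inter> {0..1}" using t(1) by auto
      with t(2) vV show "v \<in> VI c d" unfolding VI_def by blast
    qed
  qed
qed

text \<open>Intervals of the circle induce connected subgraphs: being joined by a path inside the interval is
  locally constant along the interval, also at its ends, since the components of the graph around an
  end that the circle passes only once lie within the interval.\<close>

lemma interval_connected:
  assumes cd: "c \<in> Tm" "d \<in> Tm" "c \<le> d" and xy: "x \<in> VI c d" "y \<in> VI c d"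
  shows "conn E (VI c d) x y"
proof -
  let ?W = "VI c d"
  have cd01: "0 \<le> c" "d \<le> 1" using Tm_01(1)[OF cd(1)] Tm_01(2)[OF cd(2)] by auto
  let ?N = "\<lambda>a a'. \<forall>s t x y. s \<in> {a..a'} \<inter> {c..d} \<longrightarrow> t \<in> {a..a'} \<inter> {c..d} \<longrightarrow> b x s > 0 \<longrightarrow> b y t > 0 \<longrightarrow> conn E ?W x y"
  \<comment> \<open>The margin \<open>e\<close> makes adjacent pieces overlap. If they meet at an
    end, where every coordinate vanishes, the overlap still contains a vertex time through which
    connections can be composed.\<close>
  define P where "P = (\<lambda>a a'. c \<le> a \<and> a' \<le> d \<longrightarrow> (\<exists>e>0. ?N (a - e) (a' + e)))"
  have "P c d"
    using cd(3)
  proof (induction rule: Bolzano)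
    case (trans a m a')
    show ?case
      unfolding P_def
    proof
      assume acd: "c \<le> a \<and> a' \<le> d"
      have m: "c \<le> m" "m \<le> d" using acd trans by auto
      obtain e1 where e1: "e1 > 0" "?N (a - e1) (m + e1)" using trans(1)[unfolded P_def] acd m by auto
      obtain e2 where e2: "e2 > 0" "?N (m - e2) (a' + e2)" using trans(2)[unfolded P_def] acd m by auto
      define e where "e = min e1 e2"
      have e: "e > 0" "e \<le> e1" "e \<le> e2" using e1 e2 by (auto simp: e_def)
      have m01: "m \<in> {0..1}" using m cd01 by auto
      have "\<exists>s\<in>{m - e..m + e} \<inter> {c..d}. \<exists>v. b v s > 0"
      proof (cases "\<exists>\<beta>\<in>ends V E. \<gamma> m = EndPt \<beta>")
        case True
        then obtain \<beta> where \<beta>: "\<gamma> m = EndPt \<beta>" by blast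
        then have "m \<noteq> c" using end_not_Tm cd by blast
        then have "0 \<le> max c (m - e)" "max c (m - e) < m" "m \<le> 1" using m cd01 e by auto
        then obtain q where q: "q \<in> Tm" "max c (m - e) < q" "q < m"
          using vertex_times_between \<beta> by metis
        have "b (vert q) q > 0" using vertex_b[OF vert(2)[OF q(1)]] by simp
        moreover have "q \<in> {m - e..m + e} \<inter> {c..d}" using q m e by auto
        ultimately show ?thesis by blast
      next
        case False
        then obtain v where "b v m > 0" using not_end_pos[OF m01] by blast
        moreover have "m \<in> {m - e..m + e} \<inter> {c..d}" using m e by auto
        ultimately show ?thesis by blast
      qed
      then obtain s0 v where s0: "s0 \<in> {m - e..m + e} \<inter> {c..d}" "b v s0 > 0" by blast
      have "conn E ?W x v" if "s \<in> {a - e..a' + e} \<inter> {c..d}" "b x s > 0" for s x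
      proof (cases "s \<le> m")
        case True
        then have "s \<in> {a - e1..m + e1} \<inter> {c..d}" "s0 \<in> {a - e1..m + e1} \<inter> {c..d}"
          using that(1) s0(1) e e1(1) trans(3) by auto
        then show ?thesis using e1(2) that(2) s0(2) by blast
      next
        case False
        then have "s \<in> {m - e2..a' + e2} \<inter> {c..d}" "s0 \<in> {m - e2..a' + e2} \<inter> {c..d}"
          using that(1) s0(1) e e2(1) trans(4) by auto
        then show ?thesis using e2(2) that(2) s0(2) by blast
      qed
      then have "?N (a - e) (a' + e)" using conn_trans conn_sym by metis
      then show "\<exists>e>0. ?N (a - e) (a' + e)" using e(1) by blast
    qed
  next
    case (local m)
    have m01: "m \<in> {0..1}" using local cd01 by auto
    have "\<exists>e>0. \<exists>v. \<forall>s x. s \<in> {c..d} \<longrightarrow> \<bar>s - m\<bar> < e \<longrightarrow> b x s > 0 \<longrightarrow> conn E ?W x v"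
    proof (cases "\<exists>\<alpha>\<in>ends V E. \<gamma> m = EndPt \<alpha>")
      case True
      then obtain \<alpha> where \<alpha>: "\<alpha> \<in> ends V E" "\<gamma> m = EndPt \<alpha>" by blast
      then have mcd: "c < m" "m < d" using end_not_Tm cd local by (auto simp: order_le_less)
      obtain S where S: "finite S" "S \<subseteq> V" "end_comp V E S \<alpha> \<subseteq> ?W"
        using end_comp_in_interval[OF cd01(1) mcd cd01(2) \<alpha>(2)] by blast
      obtain e where e: "e > 0" "\<And>s. s \<in> {0..1} \<Longrightarrow> \<bar>s - m\<bar> < e \<Longrightarrow> \<gamma> s \<in> end_nbhd V E S \<alpha>"
        using end_nbhd_near[OF m01 \<alpha>(2) S(1,2) \<alpha>(1)] by blast
      have "0 \<le> max c (m - e)" "max c (m - e) < m" "m \<le> 1" using mcd cd01 e by auto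
      then obtain p where p: "p \<in> Tm" "max c (m - e) < p" "p < m"
        using vertex_times_between \<alpha>(2) by metis
      have "0 \<le> m" "m < min d (m + e)" "min d (m + e) \<le> 1" using mcd cd01 e by auto
      then obtain q where q: "q \<in> Tm" "m < q" "q < min d (m + e)"
        using vertex_times_between \<alpha>(2) by metis
      have inC: "x \<in> end_comp V E S \<alpha>" if x: "x \<in> VI p q" for x
      proof -
        obtain t where t: "t \<in> Tm" "p \<le> t" "t \<le> q" "x = vert t" using x by (rule VI_E)
        then have "\<gamma> t \<in> end_nbhd V E S \<alpha>" using p q Tm_01(1)[OF t(1)] Tm_01(2)[OF t(1)] by (intro e(2)) auto
        then show ?thesis using end_nbhd_vertex[OF S(1,2) \<alpha>(1)] vert(2)[OF t(1)] t(4) by simp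
      qed
      have vp: "vert p \<in> end_comp V E S \<alpha>" by (rule inC, rule vert_VI) (use p q in auto)
      have "conn E ?W x (vert p)" if "\<bar>s - m\<bar> < min (m - p) (q - m)" "b x s > 0" for s x
      proof -
        have "x \<in> end_comp V E S \<alpha>"
          by (rule inC, rule touch[OF p(1) q(1) _ _ that(2)]) (use that(1) in \<open>auto simp: abs_if split: if_splits\<close>)
        then have "conn E (end_comp V E S \<alpha>) x (vert p)"
          using components_conn[OF end_comp_component[OF \<alpha>(1) S(1,2)]] vp by blast
        then show ?thesis using S(3) by (rule conn_mono) simp
      qed
      then show ?thesis using p q by (intro exI[of _ "min (m - p) (q - m)"]) auto
    next
      case False
      then obtain v where v: "v \<in> V" "b v m > 0" using not_end_pos[OF m01] by blast
      obtain e where e: "e > 0" "\<And>s. s \<in> {0..1} \<Longrightarrow> \<bar>s - m\<bar> < e \<Longrightarrow> b v s > 0"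
        using b_open[OF v(1) m01 v(2)] by blast
      have "conn E ?W x v" if s: "s \<in> {c..d}" "\<bar>s - m\<bar> < e" "b x s > 0" for s x
      proof -
        have s01: "s \<in> {0..1}" using s cd01 by auto
        have vs: "b v s > 0" using e(2)[OF s01 s(2)] .
        have W: "x \<in> ?W" "v \<in> ?W" using touch[OF cd(1,2) _ _ s(3)] touch[OF cd(1,2) _ _ vs] s(1) by auto
        show ?thesis
        proof (cases "x = v")
          case False
          then have "{x, v} \<in> E" using b_two(1)[OF s01 s(3) vs] by blast
          with W show ?thesis by (rule conn_edge)
        qed simp
      qed
      then show ?thesis using e(1) by blast
    qed
    then obtain e v where e: "e > 0" "\<And>s x. s \<in> {c..d} \<Longrightarrow> \<bar>s - m\<bar> < e \<Longrightarrow> b x s > 0 \<Longrightarrow> conn E ?W x v" by blast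
    have "P a a'" if a: "a \<le> m \<and> m \<le> a' \<and> a' - a < e / 2" for a a'
      unfolding P_def
    proof
      have "conn E ?W x v" if "s \<in> {a - e/2..a' + e/2} \<inter> {c..d}" "b x s > 0" for s x
        using that a by (intro e(2)[of s]) (auto simp: abs_if)
      then have "?N (a - e/2) (a' + e/2)" using conn_trans conn_sym by metis
      then show "\<exists>e>0. ?N (a - e) (a' + e)" using e(1) by (intro exI[of _ "e/2"]) auto
    qed
    then show ?case using e(1) by (intro exI[of _ "e/2"]) auto
  qed
  then have "c \<le> c \<and> d \<le> d \<longrightarrow> (\<exists>e>0. ?N (c - e) (d + e))" unfolding P_def .
  then obtain e where e: "e > 0" "?N (c - e) (d + e)" by (metis order_refl)
  obtain s where s: "s \<in> Tm" "c \<le> s" "s \<le> d" "x = vert s" using xy(1) by (rule VI_E)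
  obtain t where t: "t \<in> Tm" "c \<le> t" "t \<le> d" "y = vert t" using xy(2) by (rule VI_E)
  have "b x s > 0" "b y t > 0" using vertex_b[OF vert(2)[OF s(1)]] vertex_b[OF vert(2)[OF t(1)]] s(4) t(4) by auto
  moreover have "s \<in> {c - e..d + e} \<inter> {c..d}" "t \<in> {c - e..d + e} \<inter> {c..d}" using s t e by auto
  ultimately show ?thesis using e(2) by blast
qed

section \<open>Stages of gaps and the paths across them\<close>

definition US :: "real \<Rightarrow> real \<Rightarrow> 'a set" where
  "US p q = (SOME U. finite U \<and> U \<subseteq> VI p q \<and> vert p \<in> U \<and> vert q \<in> U \<and> conn E U (vert p) (vert q))"

lemma US:
  assumes "p \<in> Tm" "q \<in> Tm" "p \<le> q"
  shows "finite (US p q)" "US p q \<subseteq> VI p q" "conn E (US p q) (vert p) (vert q)" "vert p \<in> US p q"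
proof -
  have m: "vert p \<in> VI p q" "vert q \<in> VI p q" using vert_VI assms by auto
  obtain U where "finite U" "U \<subseteq> VI p q" "vert p \<in> U" "vert q \<in> U" "conn E U (vert p) (vert q)"
    using conn_finite_support[OF interval_connected[OF assms m] m(1)] by metis
  then have "\<exists>U. finite U \<and> U \<subseteq> VI p q \<and> vert p \<in> U \<and> vert q \<in> U \<and> conn E U (vert p) (vert q)" by blast
  from someI_ex[OF this] show "finite (US p q)" "US p q \<subseteq> VI p q" "conn E (US p q) (vert p) (vert q)" "vert p \<in> US p q"
    unfolding US_def by blast+
qed

definition visits :: "'a set \<Rightarrow> real set" where
  "visits X = {t \<in> Tm. vert t \<in> X}"

lemma visits_finite: assumes "finite X" shows "finite (visits X)"
proof -
  have "visits X \<subseteq> {0, 1} \<union> tm ` X"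
  proof
    fix t assume "t \<in> visits X"
    then have t: "t \<in> Tm" "vert t \<in> X" by (auto simp: visits_def)
    from t(1) show "t \<in> {0, 1} \<union> tm ` X"
    proof (cases rule: Tm_cases)
      case (3 v)
      then show ?thesis using t vert_tm by auto
    qed auto
  qed
  then show ?thesis using assms by (auto intro: finite_subset)
qed

definition gap :: "real set \<Rightarrow> real \<Rightarrow> real \<Rightarrow> bool" where
  "gap Q p q \<longleftrightarrow> p \<in> Q \<and> q \<in> Q \<and> p < q \<and> {p<..<q} \<inter> Q = {}"

text \<open>\<open>US p q\<close> is chosen from \<open>p\<close> and \<open>q\<close> alone, so the
  stages and \<open>EF\<close> use the same paths. Taking up all visits of their vertices keeps old
  paths out of the inside of new gaps; the last union brings every vertex time into some
  stage.\<close>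

primrec Q :: "nat \<Rightarrow> real set" where
  "Q 0 = {0, 1}"
| "Q (Suc n) = Q n \<union> (\<Union>p\<in>Q n. \<Union>q\<in>{q \<in> Q n. gap (Q n) p q}. visits (US p q)) \<union> visits {from_nat_into V n}"

lemma Q_Tm: "Q n \<subseteq> Tm"
  using Tm_01 by (induction n) (auto simp: visits_def)

lemma Q_finite: "finite (Q n)"
proof (induction n)
  case (Suc n)
  have "finite (visits (US p q))" if "gap (Q n) p q" for p q
    using that Q_Tm by (intro visits_finite US) (auto simp: gap_def)
  then have "finite (\<Union>p\<in>Q n. \<Union>q\<in>{q \<in> Q n. gap (Q n) p q}. visits (US p q))" using Suc by auto
  then show ?case using Suc visits_finite[of "{from_nat_into V n}"] by simp
qed simp

lemma Q_mono: "m \<le> n \<Longrightarrow> Q m \<subseteq> Q n"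
  by (induction rule: dec_induct) auto

lemma Q_exhausts: assumes "t \<in> Tm" obtains n where "t \<in> Q n"
proof -
  obtain n where "from_nat_into V n = vert t" using from_nat_into_surj[OF countable_V vert(1)[OF assms]] by blast
  then have "t \<in> Q (Suc n)" using assms by (simp add: visits_def)
  with that show thesis by blast
qed

text \<open>The sparse subgraph: the edges of the circle, and for each gap of each stage a path between the
  two boundary vertices of the gap. All vertices of that path become boundary vertices at the next stage.\<close>

definition EF :: "'a set set" where
  "EF = {{x, y} | x y t. t \<in> {0..1} \<and> x \<noteq> y \<and> b x t > 0 \<and> b y t > 0} \<union>
     {e \<in> E. \<exists>n p q. gap (Q n) p q \<and> e \<subseteq> US p q}"

lemma EF_sub: "EF \<subseteq> E"
  unfolding EF_def using b_two(1) by blast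

lemma gap_Tm: "gap (Q n) p q \<Longrightarrow> p \<in> Tm \<and> q \<in> Tm \<and> p < q"
  using Q_Tm[of n] by (auto simp: gap_def)

text \<open>A circle edge cannot jump over \<open>p\<close> or \<open>q\<close>, since traversals
  contain no vertex time inside. A path of an earlier stage has all its vertices in
  \<open>Q n\<close>, so it misses the inside of the gap. A path of stage \<open>n\<close> or later
  that touches the inside belongs to a smaller gap within this one.\<close>

lemma gap_separates:
  assumes g: "gap (Q n) p q" and x: "x \<in> V" "x \<noteq> v0" "p < tm x" "tm x < q" and xy: "{x, y} \<in> EF"
  shows "y \<in> VI p q"
proof -
  from xy consider t where "t \<in> {0..1}" "x \<noteq> y" "b x t > 0" "b y t > 0"
    | m p' q' where "gap (Q m) p' q'" "x \<in> US p' q'" "y \<in> US p' q'"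
    unfolding EF_def by (auto simp: doubleton_eq_iff)
  then show ?thesis
  proof cases
    case 1
    then obtain l r where "l < t" "t < r" "edge_int x y l r \<or> edge_int y x l r"
      using edge_interval by metis
    then obtain u w where e: "edge_int u w l r" "x = u \<and> y = w \<or> x = w \<and> y = u" by blast
    have lr: "l \<in> {0..1}" "r \<in> {0..1}" "\<gamma> l = Pt (vtx u)" "\<gamma> r = Pt (vtx w)" "l < r" "y \<in> V"
      using e by (auto simp: edge_int_def)
    have pq: "p \<le> l \<or> r \<le> p" "q \<le> l \<or> r \<le> q"
      using edge_int_no_Tm[OF e(1)] gap_Tm[OF g] by blast+
    have tx: "tm x = l \<or> tm x = r"
      using e(2) tm_unique[OF lr(1,3)] tm_unique[OF lr(2,4)] x(2) by metis
    have "p \<le> l" "r \<le> q" using tx pq x lr(5) by auto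
    then have "l \<in> {p..q} \<inter> {0..1}" "r \<in> {p..q} \<inter> {0..1}" using lr by auto
    then show ?thesis using e(2) lr(3,4,6) unfolding VI_def by blast
  next
    case 2
    note g' = gap_Tm[OF 2(1)]
    have sub: "US p' q' \<subseteq> VI p' q'" using US(2) g' by auto
    have tx: "p' \<le> tm x" "tm x \<le> q'" using VI_tm[of x p' q'] sub 2 x by auto
    have "\<not> m < n"
    proof
      assume "m < n"
      have "tm x \<in> visits (US p' q')" using 2 x tm_Tm vert_tm by (simp add: visits_def)
      moreover have "visits (US p' q') \<subseteq> Q (Suc m)" using 2(1) by (fastforce simp: gap_def)
      moreover have "Q (Suc m) \<subseteq> Q n" using Q_mono \<open>m < n\<close> by (metis Suc_leI)
      ultimately have "tm x \<in> Q n" by (meson subsetD)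
      then show False using g x by (auto simp: gap_def)
    qed
    then have "Q n \<subseteq> Q m" using Q_mono by (metis not_less)
    then have "p \<in> Q m" "q \<in> Q m" using g by (auto simp: gap_def)
    then have "p \<notin> {p'<..<q'}" "q \<notin> {p'<..<q'}" using 2(1) unfolding gap_def by blast+
    then have "p \<le> p'" "q' \<le> q" using x tx by auto
    then show ?thesis using sub 2(3) VI_mono by blast
  qed
qed

text \<open>Paths across consecutive gaps are concatenated, by induction on the number of chosen
  times in between.\<close>

lemma Q_conn:
  assumes "p \<in> Q n" "q \<in> Q n" "p \<le> q"
  shows "conn EF (VI p q) (vert p) (vert q)"
  using assms
proof (induction "card ({p<..<q} \<inter> Q n)" arbitrary: p q rule: less_induct)
  case less
  show ?case
  proof (cases "p = q \<or> {p<..<q} \<inter> Q n = {}")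
    case True
    show ?thesis
    proof (cases "p = q")
      case False
      with True less have g: "gap (Q n) p q" by (auto simp: gap_def)
      note g' = gap_Tm[OF g]
      have "conn EF (US p q) (vert p) x" if "conn E (US p q) (vert p) x" for x
        using that
      proof (induction rule: conn_induct)
        case (step y z)
        then have "{y, z} \<in> EF" using g unfolding EF_def by auto
        with step show ?case by (blast intro: conn_trans conn_edge)
      qed simp
      then have "conn EF (US p q) (vert p) (vert q)" using US(3) g' by auto
      then show ?thesis by (rule conn_mono) (use US(2)[of p q] g' in auto)
    qed simp
  next
    case False
    then obtain m where m: "p < m" "m < q" "m \<in> Q n" by auto
    have "card ({p<..<m} \<inter> Q n) < card ({p<..<q} \<inter> Q n)"
      by (rule psubset_card_mono) (use Q_finite m in auto)
    then have 1: "conn EF (VI p m) (vert p) (vert m)" using less m by auto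
    have "card ({m<..<q} \<inter> Q n) < card ({p<..<q} \<inter> Q n)"
      by (rule psubset_card_mono) (use Q_finite m in auto)
    then have 2: "conn EF (VI m q) (vert m) (vert q)" using less m by auto
    have "conn EF (VI p q) (vert p) (vert m)" by (rule conn_mono[OF 1 VI_mono]) (use m in auto)
    moreover have "conn EF (VI p q) (vert m) (vert q)" by (rule conn_mono[OF 2 VI_mono]) (use m in auto)
    ultimately show ?thesis by (rule conn_trans)
  qed
qed

lemma EF_conn_vert:
  assumes "c \<in> Tm" "d \<in> Tm" "c \<le> d"
  shows "conn EF (VI c d) (vert c) (vert d)"
proof -
  obtain m n where "c \<in> Q m" "d \<in> Q n" using Q_exhausts assms by metis
  then have "c \<in> Q (max m n)" "d \<in> Q (max m n)" using Q_mono[of m "max m n"] Q_mono[of n "max m n"] by auto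
  then show ?thesis using Q_conn assms(3) by blast
qed

lemma EF_conn:
  assumes cd: "c \<in> Tm" "d \<in> Tm" and xy: "x \<in> VI c d" "y \<in> VI c d"
  shows "conn EF (VI c d) x y"
proof -
  have "conn EF (VI c d) (vert c) z" if z: "z \<in> VI c d" for z
  proof -
    obtain t where t: "t \<in> Tm" "c \<le> t" "t \<le> d" "z = vert t" using z by (rule VI_E)
    show ?thesis unfolding t(4)
      by (rule conn_mono[OF EF_conn_vert[OF cd(1) t(1,2)] VI_mono]) (use t in auto)
  qed
  from this[OF xy(1)] this[OF xy(2)] show ?thesis by (blast intro: conn_trans conn_sym)
qed

end

subsection \<open>Rays and ends of the sparse subgraph\<close>

context circle_loop
begin

sublocale F: lfgraph V EF
  using EF_sub by (rule subgraph_lfgraph)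

definition end_time :: "real \<Rightarrow> bool" where
  "end_time z \<longleftrightarrow> z \<in> {0..1} \<and> (\<exists>\<alpha>. \<gamma> z = EndPt \<alpha>)"

definition near :: "real \<Rightarrow> real \<Rightarrow> 'a set" where
  "near c d = {v \<in> V. v \<noteq> v0 \<and> c < tm v \<and> tm v < d}"

text \<open>Convergence of the times of \<open>R\<close> to \<open>z\<close>. Tails in
  \<open>near\<close> avoid \<open>v0\<close>, whose value under \<open>tm\<close> is
  unconstrained.\<close>

definition to_time :: "(nat \<Rightarrow> 'a) \<Rightarrow> real \<Rightarrow> bool" where
  "to_time R z \<longleftrightarrow> (\<forall>c d. c < z \<longrightarrow> z < d \<longrightarrow> has_tail_in R (near c d))"

lemma near_VI: "near c d \<subseteq> VI c d"
  using tm_VI by (fastforce simp: near_def)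

lemma VI_near:
  assumes "0 \<le> c" "d \<le> 1" "v \<in> VI c d" "v \<noteq> vert c" "v \<noteq> vert d" shows "v \<in> near c d"
proof -
  obtain t where t: "t \<in> Tm" "c \<le> t" "t \<le> d" "v = vert t" using assms(3) by (rule VI_E)
  then have "c < t" "t < d" using assms(4,5) by (auto simp: order_le_less)
  then have "vert t \<noteq> v0 \<and> tm (vert t) = t" using tm_vert[OF t(1)] assms(1,2) by auto
  then show ?thesis using t \<open>c < t\<close> \<open>t < d\<close> vert(1)[OF t(1)] by (simp add: near_def)
qed

lemma end_time_01: "end_time z \<Longrightarrow> 0 < z \<and> z < 1"
  using end_01 by (auto simp: end_time_def)

lemma end_time_Tm: "end_time z \<Longrightarrow> z \<notin> Tm"
  using end_not_Tm by (auto simp: end_time_def)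

lemma end_time_left:
  assumes "end_time z" "c < z" obtains q where "q \<in> Tm" "c < q" "q < z" "0 < q"
proof -
  obtain \<alpha> where "\<gamma> z = EndPt \<alpha>" using assms by (auto simp: end_time_def)
  then obtain q where "q \<in> Tm" "max 0 c < q" "q < z"
    using vertex_times_between[of "max 0 c" z \<alpha>] end_time_01[OF assms(1)] assms(2) by auto
  with that show thesis by auto
qed

lemma end_time_right:
  assumes "end_time z" "z < d" obtains q where "q \<in> Tm" "z < q" "q < d" "q < 1"
proof -
  obtain \<alpha> where "\<gamma> z = EndPt \<alpha>" using assms by (auto simp: end_time_def)
  then obtain q where "q \<in> Tm" "z < q" "q < min 1 d"
    using vertex_times_between[of z "min 1 d" \<alpha>] end_time_01[OF assms(1)] assms(2) by auto
  with that show thesis by auto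
qed

text \<open>At a stage with chosen times on both sides of \<open>z\<close> close to
  \<open>z\<close>, the last one before and the first one after bound a gap; \<open>z\<close> itself
  is never chosen, as it is no vertex time.\<close>

lemma gap_around:
  assumes z: "end_time z" and cd: "c < z" "z < d"
  obtains n p q where "gap (Q n) p q" "c < p" "p < z" "z < q" "q < d"
proof -
  obtain c' where c': "c' \<in> Tm" "c < c'" "c' < z" using end_time_left[OF z cd(1)] by blast
  obtain d' where d': "d' \<in> Tm" "z < d'" "d' < d" using end_time_right[OF z cd(2)] by blast
  obtain m n where "c' \<in> Q m" "d' \<in> Q n" using Q_exhausts c' d' by metis
  then have N: "c' \<in> Q (max m n)" "d' \<in> Q (max m n)" using Q_mono[of m "max m n"] Q_mono[of n "max m n"] by auto
  let ?Q = "Q (max m n)"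
  have zQ: "z \<notin> ?Q" using Q_Tm end_time_Tm[OF z] by blast
  let ?L = "{x \<in> ?Q. x < z}" and ?U = "{x \<in> ?Q. z < x}"
  have fin: "finite ?L" "finite ?U" using Q_finite by auto
  have ne: "c' \<in> ?L" "d' \<in> ?U" using N c' d' by auto
  have ne': "?L \<noteq> {}" "?U \<noteq> {}" using ne by blast+
  have L: "Max ?L \<in> ?L" "c' \<le> Max ?L" by (rule Max_in[OF fin(1) ne'(1)], rule Max_ge[OF fin(1) ne(1)])
  have U: "Min ?U \<in> ?U" "Min ?U \<le> d'" by (rule Min_in[OF fin(2) ne'(2)], rule Min_le[OF fin(2) ne(2)])
  have "{Max ?L<..<Min ?U} \<inter> ?Q = {}"
  proof (rule equals0I)
    fix x assume x: "x \<in> {Max ?L<..<Min ?U} \<inter> ?Q"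
    then have "x \<noteq> z" using zQ by blast
    then have "x < z \<or> z < x" by linarith
    then show False
    proof
      assume "x < z"
      then have "x \<le> Max ?L" using x fin by (intro Max_ge) auto
      then show False using x by simp
    next
      assume "z < x"
      then have "Min ?U \<le> x" using x fin by (intro Min_le) auto
      then show False using x by simp
    qed
  qed
  then have "gap ?Q (Max ?L) (Min ?U)" using L U by (auto simp: gap_def)
  then show thesis by (rule that) (use L U c' d' in auto)
qed

lemma VI_avoid:
  assumes z: "end_time z" and X: "finite X" and cd: "c < z" "z < d"
  obtains c' d' where "c \<le> c'" "c' < z" "z < d'" "d' \<le> d" "VI c' d' \<inter> X = {}"
proof -
  have "z \<notin> visits X" using end_time_Tm[OF z] by (auto simp: visits_def)
  obtain e where e: "e > 0" "\<forall>t\<in>visits X. t \<noteq> z \<longrightarrow> e \<le> dist z t"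
    using finite_set_avoid[OF visits_finite[OF X], of z] by blast
  let ?c = "max c (z - e/2)" and ?d = "min d (z + e/2)"
  have "VI ?c ?d \<inter> X = {}"
  proof (rule equals0I)
    fix v assume v: "v \<in> VI ?c ?d \<inter> X"
    then obtain t where t: "t \<in> Tm" "?c \<le> t" "t \<le> ?d" "v = vert t" by (auto elim: VI_E)
    then have "t \<in> visits X" using v by (simp add: visits_def)
    then have "e \<le> dist z t" using e \<open>z \<notin> visits X\<close> by metis
    then show False using t e(1) by (auto simp: dist_real_def abs_if split: if_splits)
  qed
  then show thesis by (rule that[rotated 4]) (use cd e in auto)
qed

lemma to_time_mono: "c' \<le> c \<Longrightarrow> d \<le> d' \<Longrightarrow> near c d \<subseteq> near c' d'"
  by (auto simp: near_def)

text \<open>Bolzano-Weierstrass for the times of the vertices of the ray. The limit is an end time,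
  since near any other time only one vertex can be met. In particular the circle passes every end.
  Only accumulation is claimed here; rays of \<open>EF\<close> get convergence in
  \<open>F_ray_limit\<close>.\<close>

lemma ray_limit:
  assumes R: "is_ray V E R"
  obtains z where "end_time z" "\<And>c d. c < z \<Longrightarrow> z < d \<Longrightarrow> infinite {n. R n \<in> near c d}"
proof -
  let ?S = "tm ` (range R - {v0})"
  have RV: "range R \<subseteq> V" and injR: "inj R" using R by (auto simp: is_ray_def)
  have "infinite (range R)" using injR by (simp add: finite_image_iff)
  then have "infinite (range R - {v0})" by simp
  moreover have "inj_on tm (range R - {v0})"
    by (rule inj_on_inverseI[where g = vert]) (use RV vert_tm in auto)
  ultimately have inf: "infinite ?S" by (simp add: finite_image_iff)
  have "?S \<subseteq> {0..1}" using tm RV by fastforce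
  then obtain z where z: "z \<in> {0..1}" "z islimpt ?S"
    using Heine_Borel_imp_Bolzano_Weierstrass[OF compact_Icc inf] by blast
  have many: "infinite (?S \<inter> ball z e)" if "e > 0" for e
    using z(2) that by (auto simp: islimpt_eq_infinite_ball)
  have "end_time z"
  proof (rule ccontr)
    assume "\<not> end_time z"
    then have "\<not> (\<exists>\<beta>\<in>ends V E. \<gamma> z = EndPt \<beta>)" using z(1) by (auto simp: end_time_def)
    then obtain v where v: "v \<in> V" "b v z > 0" using not_end_pos[OF z(1)] by blast
    obtain e where e: "e > 0" "\<And>s. s \<in> {0..1} \<Longrightarrow> \<bar>s - z\<bar> < e \<Longrightarrow> b v s > 0"
      using b_open[OF v(1) z(1) v(2)] by blast
    have "?S \<inter> ball z e \<subseteq> {tm v}"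
    proof
      fix t assume t: "t \<in> ?S \<inter> ball z e"
      then obtain w where w: "w \<in> V" "w \<noteq> v0" "t = tm w" using RV by blast
      then have "t \<in> {0..1}" "\<gamma> t = Pt (vtx w)" using tm[of w] by auto
      moreover have "\<bar>t - z\<bar> < e" using t by (simp add: ball_def dist_real_def abs_minus_commute)
      ultimately have "v = w" using e(2) vertex_single by blast
      then show "t \<in> {tm v}" using w by simp
    qed
    then show False using many[OF e(1)] finite_subset by blast
  qed
  moreover have "infinite {n. R n \<in> near c d}" if cd: "c < z" "z < d" for c d
  proof
    assume fin: "finite {n. R n \<in> near c d}"
    define e where "e = min (z - c) (d - z)"
    have e: "e > 0" using cd by (simp add: e_def)
    have "?S \<inter> ball z e \<subseteq> (\<lambda>n. tm (R n)) ` {n. R n \<in> near c d}"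
    proof
      fix t assume t: "t \<in> ?S \<inter> ball z e"
      then obtain n where n: "R n \<noteq> v0" "t = tm (R n)" by blast
      have "\<bar>t - z\<bar> < e" using t by (simp add: ball_def dist_real_def abs_minus_commute)
      then have "c < t" "t < d" unfolding e_def by (auto simp: abs_if split: if_splits)
      then have "R n \<in> near c d" using n RV by (auto simp: near_def)
      then show "t \<in> (\<lambda>n. tm (R n)) ` {n. R n \<in> near c d}" using n by blast
    qed
    then show False using many[OF e] fin finite_subset by blast
  qed
  ultimately show thesis by (rule that)
qed

lemma ray_in_end:
  assumes R: "is_ray V E R" and z: "z \<in> {0..1}" "\<gamma> z = EndPt \<alpha>"
    and inf: "\<And>c d. c < z \<Longrightarrow> z < d \<Longrightarrow> infinite {n. R n \<in> near c d}"
  shows "R \<in> \<alpha>"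
proof (rule ccontr)
  assume no: "R \<notin> \<alpha>"
  have \<alpha>: "\<alpha> \<in> ends V E" using \<gamma>_end[OF z] .
  have \<delta>: "end_of R \<in> ends V E" "R \<in> end_of R" using end_of_end end_of_self R by auto
  then obtain S where S: "finite S" "S \<subseteq> V" "end_comp V E S \<alpha> \<inter> end_comp V E S (end_of R) = {}"
    using ends_separate[OF \<alpha> \<delta>(1)] no by blast
  obtain e where e: "e > 0" "\<And>s. s \<in> {0..1} \<Longrightarrow> \<bar>s - z\<bar> < e \<Longrightarrow> \<gamma> s \<in> end_nbhd V E S \<alpha>"
    using end_nbhd_near[OF z S(1,2) \<alpha>] by blast
  obtain k where k: "\<And>n. n \<ge> k \<Longrightarrow> R n \<in> end_comp V E S (end_of R)"
    using end_comp_tail[OF \<delta>(1) S(1,2) \<delta>(2)] by (auto simp: has_tail_in_def)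
  have "infinite {n. R n \<in> near (z - e) (z + e)}" using inf e(1) by simp
  then obtain n where n: "n \<ge> k" "R n \<in> near (z - e) (z + e)"
    by (metis (mono_tags) infinite_nat_iff_unbounded_le mem_Collect_eq)
  then have v: "R n \<in> V" "R n \<noteq> v0" "\<bar>tm (R n) - z\<bar> < e" by (auto simp: near_def abs_if)
  have t: "tm (R n) \<in> {0..1}" "\<gamma> (tm (R n)) = Pt (vtx (R n))" using tm[OF v(1,2)] by auto
  have "Pt (vtx (R n)) \<in> end_nbhd V E S \<alpha>" using e(2)[OF t(1) v(3)] t(2) by simp
  then have "R n \<in> end_comp V E S \<alpha>" using end_nbhd_vertex[OF S(1,2) \<alpha>] by blast
  then show False using k[OF n(1)] S(3) by blast
qed

lemma to_time_infinite:
  assumes "to_time R z" "c < z" "z < d" shows "infinite {n. R n \<in> near c d}"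
proof -
  obtain k where "\<And>n. n \<ge> k \<Longrightarrow> R n \<in> near c d" using assms unfolding to_time_def has_tail_in_def by blast
  then have "{k..} \<subseteq> {n. R n \<in> near c d}" by auto
  then show ?thesis using infinite_Ici finite_subset by blast
qed

lemma F_ray: "is_ray V EF R \<Longrightarrow> is_ray V E R"
  using EF_sub by (auto simp: is_ray_def)

text \<open>The ray meets the boundary vertices \<open>vert p\<close> and \<open>vert q\<close> of a
  gap at most once each. Thereafter, by \<open>gap_separates\<close>, it cannot leave the gap once
  it is inside.\<close>

lemma F_ray_limit:
  assumes R: "is_ray V EF R"
  obtains z where "end_time z" "to_time R z"
proof -
  obtain z where z: "end_time z" "\<And>c d. c < z \<Longrightarrow> z < d \<Longrightarrow> infinite {n. R n \<in> near c d}"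
    using ray_limit[OF F_ray[OF R]] by blast
  have "has_tail_in R (near c d)" if cd: "c < z" "z < d" for c d
  proof -
    obtain n p q where g: "gap (Q n) p q" "c < p" "p < z" "z < q" "q < d" using gap_around[OF z(1) cd] by blast
    have pq: "0 \<le> p" "q \<le> 1" using gap_Tm[OF g(1)] Tm_01 by auto
    obtain k where k: "\<And>i. i \<ge> k \<Longrightarrow> R i \<notin> {vert p, vert q}"
      using ray_tail_avoids_finite[of R "{vert p, vert q}"] R by (auto simp: is_ray_def)
    have "infinite {i. R i \<in> near p q}" using z(2)[OF g(3,4)] .
    then obtain m where m: "m \<ge> k" "R m \<in> near p q"
      by (metis (mono_tags) infinite_nat_iff_unbounded_le mem_Collect_eq)
    have "R i \<in> near p q" if "i \<ge> m" for i
      using that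
    proof (induction rule: dec_induct)
      case (step i)
      have "{R i, R (Suc i)} \<in> EF" using R by (simp add: is_ray_def)
      then have "R (Suc i) \<in> VI p q" using gap_separates[OF g(1), of "R i"] step(3) by (auto simp: near_def)
      moreover have "R (Suc i) \<notin> {vert p, vert q}" using k step m by simp
      ultimately show ?case using VI_near[OF pq] by blast
    qed (rule m)
    then have "has_tail_in R (near p q)" by (auto simp: has_tail_in_def)
    then show ?thesis by (rule tail_mono) (use to_time_mono[of c p q d] g in auto)
  qed
  then show thesis using that z(1) unfolding to_time_def by blast
qed

text \<open>A small interval around \<open>z\<close> contains no vertex of \<open>S\<close>, is
  connected in \<open>EF\<close>, and catches tails of both rays.\<close>

lemma to_time_equiv:
  assumes z: "end_time z" and R: "to_time R z" "to_time R' z"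
  shows "ray_equiv V EF R R'"
  unfolding ray_equiv_def
proof (intro allI impI)
  fix S assume S: "finite S \<and> S \<subseteq> V"
  have z01: "0 < z" "z < 1" and fS: "finite S" using S end_time_01[OF z] by auto
  obtain c' d' where "0 \<le> c'" and cd': "c' < z" "z < d'" and "d' \<le> 1" and cd'S: "VI c' d' \<inter> S = {}"
    by (rule VI_avoid[OF z fS z01])
  obtain c where c: "c \<in> Tm" "c' < c" "c < z" using end_time_left[OF z cd'(1)] by blast
  obtain d where d: "d \<in> Tm" "z < d" "d < d'" using end_time_right[OF z cd'(2)] by blast
  have dj: "VI c d \<inter> S = {}" using cd'S VI_mono[of c' c d d'] c d by auto
  have tails: "has_tail_in R (VI c d)" "has_tail_in R' (VI c d)"
    using R c(3) d(2) tail_mono[OF _ near_VI] unfolding to_time_def by auto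
  have vc: "vert c \<in> VI c d" using vert_VI c d by auto
  let ?C = "comp_of V EF S (vert c)"
  have C: "?C \<in> components V EF S" using vc dj VI_V[of c d] unfolding components_def by blast
  have "VI c d \<subseteq> ?C"
  proof
    fix x assume "x \<in> VI c d"
    then have "conn EF (VI c d) (vert c) x" using EF_conn[OF c(1) d(1) vc] by blast
    then have "conn EF (V - S) (vert c) x" by (rule conn_mono) (use dj VI_V[of c d] in auto)
    then show "x \<in> ?C" by (simp add: comp_of_conn)
  qed
  then show "\<exists>C\<in>components V EF S. has_tail_in R C \<and> has_tail_in R' C"
    using C tails tail_mono by blast
qed

lemma to_time_in_end:
  assumes "is_ray V E R" "to_time R z" "z \<in> {0..1}" "\<gamma> z = EndPt \<alpha>"
  shows "R \<in> \<alpha>"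
  using ray_in_end[OF assms(1,3,4)] to_time_infinite[OF assms(2)] by blast

lemma to_time_unique:
  assumes R: "is_ray V E R" "is_ray V E R'" "ray_equiv V E R R'"
    and z: "end_time z" "to_time R z" "end_time z'" "to_time R' z'"
  shows "z = z'"
proof -
  obtain \<alpha> \<alpha>' where a: "\<gamma> z = EndPt \<alpha>" "\<gamma> z' = EndPt \<alpha>'" "z \<in> {0..1}" "z' \<in> {0..1}"
    using z by (auto simp: end_time_def)
  have m: "R \<in> \<alpha>" "R' \<in> \<alpha>'" using to_time_in_end R z a by auto
  have "\<alpha> = end_of R" "\<alpha>' = end_of R'" using end_eq \<gamma>_end a m by auto
  then have "\<alpha> = \<alpha>'" using end_of_eq_iff R by auto
  then show ?thesis using end_inj a by blast
qed

lemma F_equiv_imp: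
  assumes R: "is_ray V EF R" "is_ray V EF R'" and eq: "ray_equiv V EF R R'"
  shows "ray_equiv V E R R'"
  unfolding ray_equiv_def
proof (intro allI impI)
  fix S assume S: "finite S \<and> S \<subseteq> V"
  obtain C where C: "C \<in> components V EF S" "has_tail_in R C" "has_tail_in R' C"
    using eq S unfolding ray_equiv_def by blast
  obtain D where D: "D \<in> components V E S" "has_tail_in R D"
    using ray_tail_component[OF F_ray[OF R(1)]] S by blast
  obtain n where n: "R n \<in> C" "R n \<in> D" using tail_common[OF C(2) D(2)] by blast
  have "C \<subseteq> D"
  proof
    fix x assume "x \<in> C"
    then have "conn EF C (R n) x" using F.components_conn[OF C(1) n(1)] by blast
    then have "conn E C (R n) x" using EF_sub by (rule_tac conn_mono) auto
    then show "x \<in> D"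
      by (rule components_closed[OF D(1) n(2)]) (use F.components_sub[OF C(1)] in blast)
  qed
  then show "\<exists>C\<in>components V E S. has_tail_in R C \<and> has_tail_in R' C"
    using D C(3) tail_mono by blast
qed

text \<open>Finite connected sets of \<open>EF\<close> between consecutive times \<open>c i\<close>
  form an infinite connected set, and Koenig's lemma gives a ray in it. The ray leaves every finite
  union of these sets, hence converges to \<open>z\<close>. The bounds on \<open>tm (R n)\<close>
  allow it to be kept on one side of \<open>z\<close>.\<close>

lemma ray_along:
  fixes c :: "nat \<Rightarrow> real"
  assumes c: "\<And>i. c i \<in> Tm" "\<And>i. 0 < c i" "\<And>i. c i < 1" "inj c" "c \<longlonglongrightarrow> z"
  obtains R where "is_ray V EF R" "to_time R z"
    "\<And>n. R n \<noteq> v0 \<and> (\<exists>i. min (c i) (c (Suc i)) \<le> tm (R n) \<and> tm (R n) \<le> max (c i) (c (Suc i)))"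
proof -
  let ?lo = "\<lambda>i. min (c i) (c (Suc i))" and ?hi = "\<lambda>i. max (c i) (c (Suc i))"
  have lohi: "?lo i \<in> Tm" "?hi i \<in> Tm" "0 < ?lo i" "?hi i < 1" for i
    using c(1)[of i] c(1)[of "Suc i"] c(2,3)[of i] c(2,3)[of "Suc i"] by (auto simp: min_def max_def)
  have "\<exists>U. finite U \<and> U \<subseteq> VI (?lo i) (?hi i) \<and> vert (c i) \<in> U \<and> vert (c (Suc i)) \<in> U \<and> (\<forall>u\<in>U. \<forall>v\<in>U. conn EF U u v)" for i
  proof -
    have m: "vert (c i) \<in> VI (?lo i) (?hi i)" "vert (c (Suc i)) \<in> VI (?lo i) (?hi i)"
      using c(1) by (auto intro: vert_VI)
    obtain U where "finite U" "U \<subseteq> VI (?lo i) (?hi i)" "vert (c i) \<in> U" "vert (c (Suc i)) \<in> U" "\<And>u v. u \<in> U \<Longrightarrow> v \<in> U \<Longrightarrow> conn EF U u v"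
      using conn_finite_support[OF EF_conn[OF lohi(1,2) m] m(1)] by metis
    then show ?thesis by blast
  qed
  then obtain U where U: "\<And>i. finite (U i)" "\<And>i. U i \<subseteq> VI (?lo i) (?hi i)" "\<And>i. vert (c i) \<in> U i"
    "\<And>i. vert (c (Suc i)) \<in> U i" "\<And>i u v. u \<in> U i \<Longrightarrow> v \<in> U i \<Longrightarrow> conn EF (U i) u v"
    by metis
  define W where "W = (\<Union>i. U i)"
  have UW: "U i \<subseteq> W" for i by (auto simp: W_def)
  have UT: "v \<in> V \<and> v \<noteq> v0 \<and> ?lo i \<le> tm v \<and> tm v \<le> ?hi i" if "v \<in> U i" for i v
  proof -
    have "v \<in> VI (?lo i) (?hi i)" using that U(2) by blast
    then obtain t where t: "t \<in> Tm" "?lo i \<le> t" "t \<le> ?hi i" "v = vert t" by (rule VI_E)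
    then have "vert t \<noteq> v0 \<and> tm (vert t) = t" using lohi(3,4)[of i] by (intro tm_vert) auto
    then show ?thesis using t vert(1)[OF t(1)] by simp
  qed
  have "inj (\<lambda>i. vert (c i))"
  proof (rule injI)
    fix i j assume "vert (c i) = vert (c j)"
    then have "c i = c j" using tm_vert[OF c(1-3)] by metis
    then show "i = j" using c(4) by (simp add: inj_eq)
  qed
  then have "infinite (range (\<lambda>i. vert (c i)))" by (simp add: finite_image_iff)
  moreover have "range (\<lambda>i. vert (c i)) \<subseteq> W" using U(3) UW by blast
  ultimately have inf: "infinite W" using finite_subset by blast
  have WV: "W \<subseteq> V" using UT by (auto simp: W_def)
  have to_i: "conn EF W (vert (c 0)) (vert (c i))" for i
  proof (induction i)
    case (Suc i)
    have "conn EF W (vert (c i)) (vert (c (Suc i)))"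
      by (rule conn_mono[OF U(5)[OF U(3,4)] UW order_refl])
    with Suc show ?case by (rule conn_trans)
  qed simp
  have to_x: "conn EF W (vert (c 0)) x" if x: "x \<in> W" for x
  proof -
    obtain i where "x \<in> U i" using x by (auto simp: W_def)
    then have "conn EF W (vert (c i)) x" using conn_mono[OF U(5)[OF U(3)] UW order_refl] by blast
    with to_i show ?thesis by (rule conn_trans)
  qed
  have "conn EF W x y" if "x \<in> W" "y \<in> W" for x y
    using conn_trans[OF conn_sym[OF to_x[OF that(1)]] to_x[OF that(2)]] .
  then obtain R where R: "is_ray V EF R" "range R \<subseteq> W" using F.ray_exists[OF WV inf] by blast
  have "has_tail_in R (near p q)" if pq: "p < z" "z < q" for p q
  proof -
    obtain N where N: "\<And>i. i \<ge> N \<Longrightarrow> p < c i \<and> c i < q"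
      using order_tendstoD[OF c(5)] pq unfolding eventually_sequentially by (metis le_trans nat_le_linear)
    have "finite (\<Union>i<N. U i)" using U(1) by blast
    then obtain k where k: "\<And>n. n \<ge> k \<Longrightarrow> R n \<notin> (\<Union>i<N. U i)"
      using ray_tail_avoids_finite R(1) unfolding is_ray_def by meson
    have "R n \<in> near p q" if n: "n \<ge> k" for n
    proof -
      obtain i where i: "R n \<in> U i" using R(2) by (auto simp: W_def)
      then have "N \<le> i" using k[OF n] by (meson UN_I lessThan_iff not_le)
      then have "p < ?lo i" "?hi i < q" using N[of i] N[of "Suc i"] by auto
      then show ?thesis using UT[OF i] by (auto simp: near_def)
    qed
    then show ?thesis by (auto simp: has_tail_in_def)
  qed
  then have "to_time R z" by (simp add: to_time_def)
  moreover have "R n \<noteq> v0 \<and> (\<exists>i. ?lo i \<le> tm (R n) \<and> tm (R n) \<le> ?hi i)" for n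
  proof -
    obtain i where "R n \<in> U i" using R(2) by (auto simp: W_def)
    then show ?thesis using UT by blast
  qed
  ultimately show thesis using that R(1) by blast
qed

text \<open>This ray and its mirror image \<open>right_ray\<close> are disjoint and converge to the
  same time, which gives the lower bound 2 for the degrees.\<close>

lemma left_ray:
  assumes z: "end_time z"
  obtains R where "is_ray V EF R" "to_time R z" "\<And>n. R n \<noteq> v0 \<and> tm (R n) < z"
proof -
  let ?P = "\<lambda>n x. x \<in> Tm \<and> 0 < x \<and> x < z \<and> z - inverse (real (Suc n)) < x"
  have st: "\<exists>y. ?P (Suc n) y \<and> x < y" if "?P n x" for n x
  proof -
    have "max x (z - inverse (real (Suc (Suc n)))) < z" using that by simp
    then obtain q where "q \<in> Tm" "max x (z - inverse (real (Suc (Suc n)))) < q" "q < z" "0 < q"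
      using end_time_left[OF z] by blast
    then show ?thesis by (intro exI[of _ q]) auto
  qed
  have "z - inverse (real (Suc 0)) < z" by simp
  then have "\<exists>x. ?P 0 x" using end_time_left[OF z] by metis
  then obtain c where c: "\<And>n. ?P n (c n)" "\<And>n. c n < c (Suc n)"
    using dependent_nat_choice[of ?P "\<lambda>_ x y. x < y"] st by metis
  have "(\<lambda>n. z - inverse (real (Suc n))) \<longlonglongrightarrow> z - 0"
    by (intro tendsto_intros LIMSEQ_inverse_real_of_nat)
  then have lim: "c \<longlonglongrightarrow> z"
    by (intro tendsto_sandwich[of "\<lambda>n. z - inverse (real (Suc n))" c sequentially "\<lambda>_. z"])
      (use c(1) in \<open>auto intro!: always_eventually less_imp_le\<close>)
  have "inj c" using c(2) strict_mono_Suc_iff strict_mono_imp_inj_on by blast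
  moreover have "c i < 1" for i using c(1)[of i] end_time_01[OF z] by auto
  ultimately obtain R where R: "is_ray V EF R" "to_time R z"
    "\<And>n. R n \<noteq> v0 \<and> (\<exists>i. min (c i) (c (Suc i)) \<le> tm (R n) \<and> tm (R n) \<le> max (c i) (c (Suc i)))"
    using ray_along[OF _ _ _ _ lim] c(1) by metis
  have "max (c i) (c (Suc i)) < z" for i using c(1)[of i] c(1)[of "Suc i"] by simp
  then have "R n \<noteq> v0 \<and> tm (R n) < z" for n using R(3)[of n] le_less_trans by blast
  then show thesis using that R(1,2) by blast
qed

lemma right_ray:
  assumes z: "end_time z"
  obtains R where "is_ray V EF R" "to_time R z" "\<And>n. R n \<noteq> v0 \<and> z < tm (R n)"
proof -
  let ?P = "\<lambda>n x. x \<in> Tm \<and> x < 1 \<and> z < x \<and> x < z + inverse (real (Suc n))"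
  have st: "\<exists>y. ?P (Suc n) y \<and> y < x" if "?P n x" for n x
  proof -
    have "z < min x (z + inverse (real (Suc (Suc n))))" using that by simp
    then obtain q where "q \<in> Tm" "z < q" "q < min x (z + inverse (real (Suc (Suc n))))" "q < 1"
      using end_time_right[OF z] by blast
    then show ?thesis by (intro exI[of _ q]) auto
  qed
  have "z < z + inverse (real (Suc 0))" by simp
  then have "\<exists>x. ?P 0 x" using end_time_right[OF z] by metis
  then obtain c where c: "\<And>n. ?P n (c n)" "\<And>n. c (Suc n) < c n"
    using dependent_nat_choice[of ?P "\<lambda>_ x y. y < x"] st by metis
  have "(\<lambda>n. z + inverse (real (Suc n))) \<longlonglongrightarrow> z + 0"
    by (intro tendsto_intros LIMSEQ_inverse_real_of_nat)
  then have lim: "c \<longlonglongrightarrow> z"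
    by (intro tendsto_sandwich[of "\<lambda>_. z" c sequentially "\<lambda>n. z + inverse (real (Suc n))"])
      (use c(1) in \<open>auto intro!: always_eventually less_imp_le\<close>)
  have "strict_mono (\<lambda>n. - c n)" using c(2) by (simp add: strict_mono_Suc_iff)
  then have "inj (\<lambda>n. - c n)" by (rule strict_mono_imp_inj_on)
  then have "inj c" by (simp add: inj_def)
  moreover have "0 < c i" for i using c(1)[of i] end_time_01[OF z] by auto
  ultimately obtain R where R: "is_ray V EF R" "to_time R z"
    "\<And>n. R n \<noteq> v0 \<and> (\<exists>i. min (c i) (c (Suc i)) \<le> tm (R n) \<and> tm (R n) \<le> max (c i) (c (Suc i)))"
    using ray_along[OF _ _ _ _ lim] c(1) by metis
  have "z < min (c i) (c (Suc i))" for i using c(1)[of i] c(1)[of "Suc i"] by simp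
  then have "R n \<noteq> v0 \<and> z < tm (R n)" for n using R(3)[of n] less_le_trans by blast
  then show thesis using that R(1,2) by blast
qed

text \<open>Both parts pass through times: a ray of a given end accumulates at an end time, where
  \<open>left_ray\<close> supplies a ray of \<open>EF\<close>, and for rays of \<open>EF\<close>
  equivalence in either graph means convergence to the same time.\<close>

theorem EF_faithful: "faithful V EF V E"
  unfolding faithful_def
proof (intro conjI ballI allI impI)
  fix \<alpha> assume \<alpha>: "\<alpha> \<in> ends V E"
  obtain R0 where R0: "R0 \<in> \<alpha>" using end_nonempty[OF \<alpha>] by blast
  have ray0: "is_ray V E R0" using end_ray[OF \<alpha> R0] .
  obtain z where z: "end_time z" "\<And>c d. c < z \<Longrightarrow> z < d \<Longrightarrow> infinite {n. R0 n \<in> near c d}"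
    using ray_limit[OF ray0] by blast
  obtain \<alpha>' where a: "z \<in> {0..1}" "\<gamma> z = EndPt \<alpha>'" using z(1) by (auto simp: end_time_def)
  have "R0 \<in> \<alpha>'" using ray_in_end[OF ray0 a z(2)] .
  then have eq: "\<alpha>' = \<alpha>" using end_eq[OF \<alpha> R0] end_eq[OF \<gamma>_end[OF a]] by simp
  obtain R where R: "is_ray V EF R" "to_time R z" using left_ray[OF z(1)] by blast
  then have "R \<in> \<alpha>" using to_time_in_end[OF F_ray[OF R(1)] R(2) a] eq by simp
  then show "\<exists>R\<in>\<alpha>. is_ray V EF R" using R(1) by blast
next
  fix R1 R2 assume "is_ray V EF R1 \<and> is_ray V EF R2"
  then have R: "is_ray V EF R1" "is_ray V EF R2" by auto
  show "ray_equiv V EF R1 R2 \<longleftrightarrow> ray_equiv V E R1 R2"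
  proof
    assume eq: "ray_equiv V E R1 R2"
    obtain z1 where z1: "end_time z1" "to_time R1 z1" using F_ray_limit[OF R(1)] by blast
    obtain z2 where z2: "end_time z2" "to_time R2 z2" using F_ray_limit[OF R(2)] by blast
    have "z1 = z2" using to_time_unique[OF F_ray[OF R(1)] F_ray[OF R(2)] eq z1 z2] .
    then show "ray_equiv V EF R1 R2" using to_time_equiv z1 z2 by blast
  qed (rule F_equiv_imp[OF R])
qed

theorem EF_end_degree:
  assumes \<beta>: "\<beta> \<in> ends V EF"
  shows "end_degree V EF \<beta> = 2"
proof -
  obtain R where R: "R \<in> \<beta>" using F.end_nonempty[OF \<beta>] by blast
  have rR: "is_ray V EF R" using F.end_ray[OF \<beta> R] .
  have \<beta>eq: "\<beta> = F.end_of R" using F.end_eq[OF \<beta> R] .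
  obtain z where z: "end_time z" "to_time R z" using F_ray_limit[OF rR] by blast
  have all: "to_time R' z" if R': "R' \<in> \<beta>" for R'
  proof -
    have r': "is_ray V EF R'" using F.end_ray[OF \<beta> R'] .
    obtain z' where z': "end_time z'" "to_time R' z'" using F_ray_limit[OF r'] by blast
    have "ray_equiv V EF R R'" using R' unfolding \<beta>eq F.end_of_def by blast
    then have "ray_equiv V E R R'" by (rule F_equiv_imp[OF rR r'])
    then have "z = z'" using to_time_unique[OF F_ray[OF rR] F_ray[OF r'] _ z z'] by blast
    then show ?thesis using z' by simp
  qed
  have mem: "R' \<in> \<beta>" if "is_ray V EF R'" "to_time R' z" for R'
    using to_time_equiv[OF z that(2)] that(1) unfolding \<beta>eq F.end_of_def by blast
  obtain R1 where R1: "is_ray V EF R1" "to_time R1 z" "\<And>n. R1 n \<noteq> v0 \<and> tm (R1 n) < z"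
    using left_ray[OF z(1)] by blast
  obtain R2 where R2: "is_ray V EF R2" "to_time R2 z" "\<And>n. R2 n \<noteq> v0 \<and> z < tm (R2 n)"
    using right_ray[OF z(1)] by blast
  have dj: "range R1 \<inter> range R2 = {}"
  proof (rule equals0I)
    fix x assume "x \<in> range R1 \<inter> range R2"
    then obtain m n where "x = R1 m" "x = R2 n" by blast
    then show False using R1(3)[of m] R2(3)[of n] by auto
  qed
  then have neq: "R1 \<noteq> R2" by auto
  have "enat (card {R1, R2}) \<le> end_degree V EF \<beta>"
    by (rule end_degree_ge) (use mem R1 R2 dj in \<open>auto simp: pairwise_def\<close>)
  moreover have "card {R1, R2} = 2" using neq by simp
  ultimately have ge: "2 \<le> end_degree V EF \<beta>" by (metis numeral_eq_enat)
  have le: "card Rs \<le> 2" if Rs: "finite Rs" "Rs \<subseteq> \<beta>" "pairwise (\<lambda>R1 R2. range R1 \<inter> range R2 = {}) Rs" for Rs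
  proof -
    have z01: "0 < z" "z < 1" and fin: "finite ((\<lambda>R. R 0) ` Rs)" using Rs(1) end_time_01[OF z(1)] by auto
    \<comment> \<open>The interval is so small that no ray of \<open>Rs\<close> starts in it. Each
      ray then has to enter the gap found inside, and the vertex before its first one in the gap is
      a boundary vertex; disjoint rays use different ones of the two.\<close>
    obtain c d where "0 \<le> c" and cd: "c < z" "z < d" and "d \<le> 1" and cdR: "VI c d \<inter> (\<lambda>R. R 0) ` Rs = {}"
      by (rule VI_avoid[OF z(1) fin z01])
    obtain n p q where g: "gap (Q n) p q" "c < p" "p < z" "z < q" "q < d" using gap_around[OF z(1) cd(1,2)] by blast
    have pq: "0 \<le> p" "q \<le> 1" using gap_Tm[OF g(1)] Tm_01 by auto
    have "\<exists>i. R i \<in> {vert p, vert q}" if RR: "R \<in> Rs" for R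
    proof -
      have rR: "is_ray V EF R" "to_time R z" using Rs(2) RR all F.end_ray[OF \<beta>] by auto
      have "has_tail_in R (near p q)" using rR(2) g by (auto simp: to_time_def)
      then have ex: "\<exists>i. R i \<in> near p q" by (auto simp: has_tail_in_def)
      let ?i = "LEAST i. R i \<in> near p q"
      have i: "R ?i \<in> near p q" using LeastI_ex[OF ex] .
      have "R 0 \<notin> near p q" using cdR RR near_VI[of p q] VI_mono[of c p q d] g by auto
      then have "?i \<noteq> 0" using i by metis
      then obtain j where j: "?i = Suc j" by (metis not0_implies_Suc)
      then have nj: "R j \<notin> near p q" using not_less_Least[of j "\<lambda>i. R i \<in> near p q"] by simp
      have "{R (Suc j), R j} \<in> EF" using rR(1) by (simp add: is_ray_def insert_commute)
      then have "R j \<in> VI p q" using gap_separates[OF g(1), of "R (Suc j)"] i j by (auto simp: near_def)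
      then show ?thesis using nj VI_near[OF pq] by blast
    qed
    then obtain i where i: "\<And>R. R \<in> Rs \<Longrightarrow> R (i R) \<in> {vert p, vert q}" by metis
    have "inj_on (\<lambda>R. R (i R)) Rs"
    proof (rule inj_onI, rule ccontr)
      fix R R' assume RR: "R \<in> Rs" "R' \<in> Rs" "R (i R) = R' (i R')" "R \<noteq> R'"
      then have "range R \<inter> range R' = {}" using Rs(3) by (auto simp: pairwise_def)
      moreover have "R (i R) \<in> range R" "R' (i R') \<in> range R'" by auto
      ultimately show False using RR(3) by (metis disjoint_iff)
    qed
    then have "card Rs = card ((\<lambda>R. R (i R)) ` Rs)" by (simp add: card_image)
    also have "\<dots> \<le> card {vert p, vert q}" by (rule card_mono) (use i in auto)
    also have "\<dots> \<le> 2" by (simp add: card_insert_if)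
    finally show ?thesis .
  qed
  have "end_degree V EF \<beta> \<le> 2"
    unfolding end_degree_def by (rule Sup_least) (use le in \<open>auto simp: numeral_eq_enat\<close>)
  with ge show ?thesis by (rule antisym[rotated])
qed

section \<open>The loop in the compactification of the sparse subgraph\<close>

definition fend :: "real \<Rightarrow> (nat \<Rightarrow> 'a) set" where
  "fend z = F.end_of (SOME R. is_ray V EF R \<and> to_time R z)"

lemma fend:
  assumes "end_time z"
  obtains R where "fend z \<in> ends V EF" "R \<in> fend z" "to_time R z"
proof -
  have "\<exists>R. is_ray V EF R \<and> to_time R z" using left_ray[OF assms] by metis
  then have "is_ray V EF (SOME R. is_ray V EF R \<and> to_time R z) \<and> to_time (SOME R. is_ray V EF R \<and> to_time R z) z"
    by (rule someI_ex)
  then show thesis using that F.end_of_end F.end_of_self unfolding fend_def by blast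
qed

text \<open>Points of edges are kept, since the edges of the circle belong to \<open>EF\<close>; an
  end is replaced by the end of those rays of \<open>EF\<close> that converge to the same
  time.\<close>

definition \<tau> :: "real \<Rightarrow> 'a fpoint" where
  "\<tau> t = (case \<gamma> t of Pt f \<Rightarrow> Pt f | EndPt \<alpha> \<Rightarrow> EndPt (fend t))"

lemma \<tau>_Pt: "\<tau> t = Pt f \<longleftrightarrow> \<gamma> t = Pt f"
  by (simp add: \<tau>_def split: fpoint.splits)

lemma bary_\<tau>: "bary (\<tau> t) v = b v t"
  by (simp add: \<tau>_def b_def bary.simps split: fpoint.splits)

lemma \<tau>_top: assumes t: "t \<in> {0..1}" shows "\<tau> t \<in> topspace F.FX"
  using \<gamma>_top[OF t]
proof (cases rule: topspace_cases)
  case (vtx v)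
  then show ?thesis using F.vtx_topspace by (simp add: \<tau>_def)
next
  case (seg u v s)
  then have "b u t > 0" "b v t > 0" by (auto simp: b_def bary_seg)
  then have "{u, v} \<in> EF" using seg(2) t unfolding EF_def by blast
  then show ?thesis using F.seg_topspace seg by (simp add: \<tau>_def)
next
  case (End \<alpha>)
  then have "end_time t" using t by (auto simp: end_time_def)
  then have "fend t \<in> ends V EF" using fend by metis
  then show ?thesis using F.End_topspace End by (simp add: \<tau>_def)
qed

text \<open>For continuity at an end time, a short interval of the circle that misses
  \<open>S\<close> is connected in \<open>EF\<close>, so its vertices lie in the component of the
  end, and so do tails of rays converging to end times inside it.\<close>

lemma \<tau>_loop: "ham_loop V EF \<tau> v0 tm"
proof
  show "continuous_map (top_of_set {0..1}) F.FX \<tau>"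
  proof (rule F.continuous_map_freudenthalI)
    show "\<tau> x \<in> topspace F.FX" if "x \<in> topspace (top_of_set {0..1})" for x
      using \<tau>_top[of x] that by simp
    show "continuous_map (top_of_set {0..1}) euclideanreal (\<lambda>x. bary (\<tau> x) v)" if "v \<in> V" for v
      using b_cont[OF that] by (simp add: bary_\<tau>)
    fix x \<beta> S assume x: "x \<in> topspace (top_of_set {0..1})" "\<tau> x = EndPt \<beta>" and S: "finite S" "S \<subseteq> V"
    have x01: "x \<in> {0..1}" using x by simp
    then have z: "end_time x" and \<beta>: "\<beta> = fend x" using x(2) by (auto simp: \<tau>_def end_time_def split: fpoint.splits)
    obtain R where R: "\<beta> \<in> ends V EF" "R \<in> \<beta>" "to_time R x" using fend[OF z] \<beta> by metis
    let ?C = "end_comp V EF S \<beta>"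
    have x01': "0 < x" "x < 1" using end_time_01[OF z] by auto
    obtain c' d' where "0 \<le> c'" and cd': "c' < x" "x < d'" and "d' \<le> 1" and cd'S: "VI c' d' \<inter> S = {}"
      by (rule VI_avoid[OF z S(1) x01'])
    obtain c where c: "c \<in> Tm" "c' < c" "c < x" using end_time_left[OF z cd'(1)] by blast
    obtain d where d: "d \<in> Tm" "x < d" "d < d'" using end_time_right[OF z cd'(2)] by blast
    have dj: "VI c d \<inter> S = {}" using cd'S VI_mono[of c' c d d'] c d by auto
    have "has_tail_in R (VI c d)" using R(3) c(3) d(2) tail_mono[OF _ near_VI] unfolding to_time_def by auto
    then obtain n where n: "R n \<in> VI c d" "R n \<in> ?C" using tail_common F.end_comp_tail[OF R(1) S R(2)] by blast
    have sub: "VI c d \<subseteq> ?C"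
    proof
      fix v assume "v \<in> VI c d"
      then have "conn EF (VI c d) (R n) v" using EF_conn[OF c(1) d(1) n(1)] by blast
      then show "v \<in> ?C" by (rule F.components_closed[OF F.end_comp_component[OF R(1) S] n(2)]) (rule dj)
    qed
    let ?U = "{c<..<d} \<inter> {0..1}"
    have "openin (top_of_set {0..1}) ?U" by (metis Int_commute open_greaterThanLessThan openin_open_Int)
    moreover have "x \<in> ?U" using x01 c d by simp
    moreover have "\<tau> s \<in> end_nbhd V EF S \<beta>" if s: "s \<in> ?U" for s
    proof (cases "\<exists>\<alpha>\<in>ends V E. \<gamma> s = EndPt \<alpha>")
      case True
      then have zs: "end_time s" "\<tau> s = EndPt (fend s)" using s by (auto simp: end_time_def \<tau>_def)
      obtain R' where R': "fend s \<in> ends V EF" "R' \<in> fend s" "to_time R' s" using fend[OF zs(1)] by blast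
      have "has_tail_in R' (near c d)" using R'(3) s by (simp add: to_time_def)
      then have "has_tail_in R' ?C" by (rule tail_mono) (use near_VI sub in blast)
      then show ?thesis unfolding F.end_nbhd_iff[OF S R(1)] using \<tau>_top[of s] s R' zs(2) by blast
    next
      case False
      then obtain v where v: "b v s > 0" using not_end_pos[of s] s by blast
      then have "v \<in> ?C" using touch[OF c(1) d(1) _ _ v] s sub by auto
      moreover have "bary (\<tau> s) v > 0" using v by (simp add: bary_\<tau>)
      moreover have "\<tau> s \<in> topspace F.FX" using \<tau>_top[of s] s by simp
      ultimately show ?thesis unfolding F.end_nbhd_iff[OF S R(1)] by blast
    qed
    ultimately show "\<exists>U. openin (top_of_set {0..1}) U \<and> x \<in> U \<and> \<tau> ` U \<subseteq> end_nbhd V EF S \<beta>" by blast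
  qed
  show "t = tm v" if "t \<in> {0..1}" "\<tau> t = Pt (vtx v)" "v \<noteq> v0" for t v
    using tm_unique[of t v] that by (simp add: \<tau>_Pt)
  show "t = 0 \<or> t = 1" if "t \<in> {0..1}" "\<tau> t = Pt (vtx v0)" for t
    using v0_unique[of t] that by (simp add: \<tau>_Pt)
qed (use infV v0 \<gamma>0 \<gamma>1 tm in \<open>auto simp: \<tau>_Pt\<close>)

theorem EF_curve: "has_hamiltonian_curve V EF"
  by (rule ham_loop.curve_if_loop[OF \<tau>_loop])

end

subsection \<open>The equivalence\<close>

lemma circle_imp_subgraph:
  assumes gr: "graph V E" and inf: "infinite V" and lf: "locally_finite V E"
    and circ: "has_hamiltonian_circle V E"
  shows "\<exists>EF. spanning_subgraph V EF V E \<and> faithful V EF V E \<and>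
    has_hamiltonian_curve V EF \<and> (\<forall>\<alpha>\<in>ends V EF. end_degree V EF \<alpha> = 2)"
proof -
  interpret lfgraph V E using gr lf by unfold_locales
  obtain \<sigma> where emb: "embedding_map circle_top FX \<sigma>" and hit: "\<And>v. v \<in> V \<Longrightarrow> Pt (vtx v) \<in> \<sigma> ` sphere 0 1"
    using circ unfolding has_hamiltonian_circle_def by blast
  have cont: "continuous_map circle_top FX \<sigma>" 
    using emb by (simp add: embedding_map_def homeomorphic_eq_everything_map continuous_map_in_subtopology)
  have inj: "inj_on \<sigma> (sphere 0 1)"
    using emb by (simp add: embedding_map_def homeomorphic_eq_everything_map)
  have once: "\<exists>!z. z \<in> sphere 0 1 \<and> \<sigma> z = Pt (vtx v)" if v: "v \<in> V" for v
  proof -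
    obtain z where "z \<in> sphere 0 1" "\<sigma> z = Pt (vtx v)" using hit[OF v] by (metis imageE)
    with inj show ?thesis by (intro ex1I[of _ z]) (metis inj_onD)+
  qed
  obtain z0 v0 tm where z0: "z0 \<in> sphere 0 1" and L0: "ham_loop V E (\<lambda>t. \<sigma> (z0 * cis (2 * pi * t))) v0 tm"
    using loop_if_curve[OF inf cont once] by metis
  interpret circle_loop V E "\<lambda>t. \<sigma> (z0 * cis (2 * pi * t))" v0 tm
  proof (intro circle_loop.intro L0 circle_loop_axioms.intro)
    fix s t :: real
    assume st: "s \<in> {0..1}" "t \<in> {0..1}" and eq: "\<sigma> (z0 * cis (2 * pi * s)) = \<sigma> (z0 * cis (2 * pi * t))"
    have "z0 * cis (2 * pi * s) \<in> sphere 0 1" "z0 * cis (2 * pi * t) \<in> sphere 0 1"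
      using z0 by (simp_all add: norm_mult)
    with eq have "z0 * cis (2 * pi * s) = z0 * cis (2 * pi * t)" using inj by (metis inj_onD)
    moreover have "z0 \<noteq> 0" using z0 by auto
    ultimately have "cis (pi * (2 * s)) = cis (pi * (2 * t))" by (simp add: mult_ac)
    then have "2 * s = 2 * t \<or> {2 * s, 2 * t} = {0, 2}" using st by (intro cis_eq_pi) auto
    then show "s = t \<or> {s, t} = {0, 1}" by (auto simp: doubleton_eq_iff)
  qed
  show ?thesis
    using EF_sub EF_faithful EF_curve EF_end_degree
    by (intro exI[of _ EF]) (auto simp: spanning_subgraph_def)
qed

lemma subgraph_imp_circle:
  assumes gr: "graph V E" and inf: "infinite V" and lf: "locally_finite V E"
    and F: "spanning_subgraph V EF V E" "faithful V EF V E" "has_hamiltonian_curve V EF"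
    and deg: "\<forall>\<alpha>\<in>ends V EF. end_degree V EF \<alpha> \<le> 3"
  shows "has_hamiltonian_circle V E"
proof -
  interpret faithful_subgraph V E EF
    using gr lf F by unfold_locales (auto simp: spanning_subgraph_def)
  show ?thesis using circle_if_degrees_le_3[OF inf F(3)] deg by blast
qed

theorem theorem1:
  fixes V :: "'v set" and E :: "'v set set"
  assumes "graph V E" and "infinite V" and "locally_finite V E"
  shows "(has_hamiltonian_circle V E
          \<longleftrightarrow> (\<exists>EF. spanning_subgraph V EF V E \<and> faithful V EF V E \<and>
                   has_hamiltonian_curve V EF \<and> (\<forall>\<alpha>\<in>ends V EF. end_degree V EF \<alpha> = 2)))
       \<and> (has_hamiltonian_circle V E
          \<longleftrightarrow> (\<exists>EF. spanning_subgraph V EF V E \<and> faithful V EF V E \<and>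
                   has_hamiltonian_curve V EF \<and> (\<forall>\<alpha>\<in>ends V EF. end_degree V EF \<alpha> \<le> 3)))"
proof -
  let ?F = "\<lambda>EF. spanning_subgraph V EF V E \<and> faithful V EF V E \<and> has_hamiltonian_curve V EF"
  have 12: "\<exists>EF. ?F EF \<and> (\<forall>\<alpha>\<in>ends V EF. end_degree V EF \<alpha> = 2)" if "has_hamiltonian_circle V E"
    using circle_imp_subgraph[OF assms that] by blast
  have 31: "has_hamiltonian_circle V E" if "?F EF" "\<forall>\<alpha>\<in>ends V EF. end_degree V EF \<alpha> \<le> 3" for EF
    using subgraph_imp_circle[OF assms] that by blast
  have 23: "\<forall>\<alpha>\<in>ends V EF. end_degree V EF \<alpha> \<le> 3" if "\<forall>\<alpha>\<in>ends V EF. end_degree V EF \<alpha> = 2" for EF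
    using that by (simp add: numeral_eq_enat)
  have 13: "\<exists>EF. ?F EF \<and> (\<forall>\<alpha>\<in>ends V EF. end_degree V EF \<alpha> \<le> 3)" if "has_hamiltonian_circle V E"
    using 12[OF that] 23 by blast
  have 21: "has_hamiltonian_circle V E" if "?F EF" "\<forall>\<alpha>\<in>ends V EF. end_degree V EF \<alpha> = 2" for EF
    using 31[OF that(1) 23[OF that(2)]] .
  have "has_hamiltonian_circle V E \<longleftrightarrow> (\<exists>EF. ?F EF \<and> (\<forall>\<alpha>\<in>ends V EF. end_degree V EF \<alpha> = 2))"
    using 12 21 by blast
  moreover have "has_hamiltonian_circle V E \<longleftrightarrow> (\<exists>EF. ?F EF \<and> (\<forall>\<alpha>\<in>ends V EF. end_degree V EF \<alpha> \<le> 3))"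
    using 13 31 by blast
  ultimately show ?thesis by (simp only: conj_assoc)
qed

end
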